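(* Let $k$ be a field, let $\Lambda$ be a finite-dimensional Gorenstein $k$-algebra, and let $U$ and $V$ be finitely generated $\Lambda$-modules. For every $n>\operatorname{id}_\Lambda\Lambda$ and every positive integer $i<n$, the $i$-th rotation $$\rho_i\colon\operatorname{Ext}^n_\Lambda(U,V)\to\operatorname{Ext}^n_\Lambda(\Omega^i_\Lambda(U),\Omega^i_\Lambda(V))$$ (with respect to any projective resolutions of $U$ and $V$) is an isomorphism.
   Context: Modules are left modules. $\Lambda$ is Gorenstein if it has finite injective dimension both as a left and as a right module over itself; $\operatorname{id}_\Lambda\Lambda$ is the injective dimension of $\Lambda$ as a left module. Rotation maps: let $\pi\colon\cdots\to P_1\to P_0\to U\to0$ and $\tau\colon\cdots\to Q_1\to Q_0\to V\to0$ be projective resolutions, with truncations $$\pi_i\colon 0\to\Omega^i_\Lambda(U)\to P_{i-1}\to\cdots\to P_0\to U\to0,\qquad \tau_i\colon 0\to\Omega^i_\Lambda(V)\to Q_{i-1}\to\cdots\to Q_0\to V\to0,$$ where $\Omega^i_\Lambda$ denotes the $i$-th syzygy in the chosen resolution. Let $(\tau_i)_*\colon\operatorname{Ext}^n_\Lambda(U,V)\to\operatorname{Ext}^{n+i}_\Lambda(U,\Omega^i_\Lambda(V))$ be Yoneda composition with $\tau_i$, and let $\pi_i^*\colon\operatorname{Ext}^n_\Lambda(\Omega^i_\Lambda(U),\Omega^i_\Lambda(V))\to\operatorname{Ext}^{n+i}_\Lambda(U,\Omega^i_\Lambda(V))$ be Yoneda composition with $\pi_i$ (an isomorphism by dimension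 shifting). The $i$-th rotation of $\operatorname{Ext}^n_\Lambda(U,V)$ with respect to $\pi$ and $\tau$ is $\rho_i=(\pi_i^* )^{-1}(\tau_i)_*$. *)

theory Defs
  imports "HOL-Library.Extended_Nat" "HOL-Algebra.Algebra"
begin

section \<open>Left modules over a ring that need not be commutative\<close>

text \<open>The locale \<open>module\<close> of \<open>HOL-Algebra\<close> requires a commutative ring of scalars; its record type is
  reused here. The fields \<open>mult\<close> and \<open>one\<close> of a module record carry no meaning.\<close>

locale left_module = R?: ring R + M?: abelian_group M
  for R :: "('a, 'z) ring_scheme" (structure) and M :: "('a, 'm, 'y) module_scheme" (structure) +
  assumes smult_closed:
      "\<lbrakk>a \<in> carrier R; x \<in> carrier M\<rbrakk> \<Longrightarrow> a \<odot>\<^bsub>M\<^esub> x \<in> carrier M"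
    and smult_l_distr:
      "\<lbrakk>a \<in> carrier R; b \<in> carrier R; x \<in> carrier M\<rbrakk> \<Longrightarrow>
        (a \<oplus> b) \<odot>\<^bsub>M\<^esub> x = a \<odot>\<^bsub>M\<^esub> x \<oplus>\<^bsub>M\<^esub> b \<odot>\<^bsub>M\<^esub> x"
    and smult_r_distr:
      "\<lbrakk>a \<in> carrier R; x \<in> carrier M; y \<in> carrier M\<rbrakk> \<Longrightarrow>
        a \<odot>\<^bsub>M\<^esub> (x \<oplus>\<^bsub>M\<^esub> y) = a \<odot>\<^bsub>M\<^esub> x \<oplus>\<^bsub>M\<^esub> a \<odot>\<^bsub>M\<^esub> y"
    and smult_assoc:
      "\<lbrakk>a \<in> carrier R; b \<in> carrier R; x \<in> carrier M\<rbrakk> \<Longrightarrow>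
        (a \<otimes> b) \<odot>\<^bsub>M\<^esub> x = a \<odot>\<^bsub>M\<^esub> (b \<odot>\<^bsub>M\<^esub> x)"
    and smult_one:
      "x \<in> carrier M \<Longrightarrow> \<one> \<odot>\<^bsub>M\<^esub> x = x"

definition finitely_generated :: "('a, 'z) ring_scheme \<Rightarrow> ('a, 'm) module \<Rightarrow> bool" where
  "finitely_generated R M \<longleftrightarrow>
    (\<exists>B. finite B \<and> B \<subseteq> carrier M \<and>
      (\<forall>x\<in>carrier M. \<exists>a \<in> B \<rightarrow> carrier R. x = (\<Oplus>\<^bsub>M\<^esub>b\<in>B. a b \<odot>\<^bsub>M\<^esub> b)))"

definition mod_hom :: "('a, 'z) ring_scheme \<Rightarrow> ('a, 'm) module \<Rightarrow> ('a, 'n) module \<Rightarrow> ('m \<Rightarrow> 'n) set" where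
  "mod_hom R M N =
    {f \<in> carrier M \<rightarrow> carrier N.
      (\<forall>x\<in>carrier M. \<forall>y\<in>carrier M. f (x \<oplus>\<^bsub>M\<^esub> y) = f x \<oplus>\<^bsub>N\<^esub> f y) \<and>
      (\<forall>a\<in>carrier R. \<forall>x\<in>carrier M. f (a \<odot>\<^bsub>M\<^esub> x) = a \<odot>\<^bsub>N\<^esub> f x)}"

definition mod_iso :: "('a, 'z) ring_scheme \<Rightarrow> ('a, 'm) module \<Rightarrow> ('a, 'n) module \<Rightarrow> ('m \<Rightarrow> 'n) set" where
  "mod_iso R M N = {f \<in> mod_hom R M N. bij_betw f (carrier M) (carrier N)}"

definition quotient_module :: "('a, 'm) module \<Rightarrow> 'm set \<Rightarrow> ('a, 'm set) module" where
  "quotient_module M N =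
    \<lparr>carrier = a_rcosets\<^bsub>M\<^esub> N, monoid.mult = undefined, monoid.one = undefined,
     ring.zero = N, ring.add = (\<lambda>A B. A <+>\<^bsub>M\<^esub> B),
     smult = (\<lambda>a A. \<Union>x\<in>A. N +>\<^bsub>M\<^esub> (a \<odot>\<^bsub>M\<^esub> x))\<rparr>"


section \<open>Finite-dimensional algebras and the Gorenstein property\<close>

text \<open>The locale \<open>algebra\<close> of \<open>HOL-Algebra\<close> covers commutative algebras only. As there, the record
  \<open>A\<close> holds the ring structure as well as the scalar multiplication by \<open>K\<close>.\<close>

locale fin_dim_algebra = K?: field K + module K A + A?: ring A
  for K :: "('k, 'z) ring_scheme" (structure) and A :: "('k, 'a) module" (structure) +
  assumes smult_mult_left:
      "\<lbrakk>c \<in> carrier K; x \<in> carrier A; y \<in> carrier A\<rbrakk> \<Longrightarrow>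
        c \<odot>\<^bsub>A\<^esub> (x \<otimes>\<^bsub>A\<^esub> y) = (c \<odot>\<^bsub>A\<^esub> x) \<otimes>\<^bsub>A\<^esub> y"
    and smult_mult_right:
      "\<lbrakk>c \<in> carrier K; x \<in> carrier A; y \<in> carrier A\<rbrakk> \<Longrightarrow>
        c \<odot>\<^bsub>A\<^esub> (x \<otimes>\<^bsub>A\<^esub> y) = x \<otimes>\<^bsub>A\<^esub> (c \<odot>\<^bsub>A\<^esub> y)"
    and finite_dim: "finitely_generated K A"

definition op_ring :: "('a, 'z) ring_scheme \<Rightarrow> ('a, 'z) ring_scheme" where
  "op_ring R = R\<lparr>monoid.mult := (\<lambda>x y. y \<otimes>\<^bsub>R\<^esub> x)\<rparr>"

definition regular_module :: "('a, 'z) ring_scheme \<Rightarrow> ('a, 'a) module" where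
  "regular_module R =
    \<lparr>carrier = carrier R, monoid.mult = (\<otimes>\<^bsub>R\<^esub>), monoid.one = \<one>\<^bsub>R\<^esub>, ring.zero = \<zero>\<^bsub>R\<^esub>, ring.add = (\<oplus>\<^bsub>R\<^esub>),
     smult = (\<otimes>\<^bsub>R\<^esub>)\<rparr>"

text \<open>A definition in HOL can only test against modules whose carriers live in a fixed type.
  For injectivity the type \<open>'a\<close> of ring elements suffices to obtain the extension property for
  modules of all types: it contains the inclusions of left ideals into \<open>R\<close>, so that Baer's
  criterion applies.\<close>

definition injective_module :: "('a, 'z) ring_scheme \<Rightarrow> ('a, 'm) module \<Rightarrow> bool" where
  "injective_module R I \<longleftrightarrow>
    left_module R I \<and>
    (\<forall>(M :: ('a, 'a) module) (N :: ('a, 'a) module) j f.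
      left_module R M \<and> left_module R N \<and>
      j \<in> mod_hom R M N \<and> inj_on j (carrier M) \<and> f \<in> mod_hom R M I \<longrightarrow>
      (\<exists>g \<in> mod_hom R N I. \<forall>x\<in>carrier M. g (j x) = f x))"

definition injective_resolution ::
  "('a, 'z) ring_scheme \<Rightarrow> ('a, 'm) module \<Rightarrow>
    (nat \<Rightarrow> ('a, 'i) module) \<Rightarrow> (nat \<Rightarrow> 'i \<Rightarrow> 'i) \<Rightarrow> ('m \<Rightarrow> 'i) \<Rightarrow> bool" where
  "injective_resolution R M I \<delta> \<eta> \<longleftrightarrow>
    (\<forall>j. injective_module R (I j)) \<and>
    \<eta> \<in> mod_hom R M (I 0) \<and> (\<forall>j. \<delta> j \<in> mod_hom R (I j) (I (Suc j))) \<and>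
    inj_on \<eta> (carrier M) \<and>
    \<eta> ` carrier M = a_kernel (I 0) (I 1) (\<delta> 0) \<and>
    (\<forall>j. \<delta> j ` carrier (I j) = a_kernel (I (Suc j)) (I (Suc (Suc j))) (\<delta> (Suc j)))"

text \<open>The terms of the resolution have carriers in \<open>nat \<Rightarrow> 'a set\<close>. This is no restriction: a module
  with at most \<open>2\<^sup>\<kappa>\<close> elements, where \<open>\<kappa> = |R| + \<aleph>\<^sub>0\<close>, has an injective hull with at most \<open>2\<^sup>\<kappa>\<close>
  elements, so the minimal injective resolution of the regular module fits into this type.
  (Over a finite-dimensional algebra its terms are even finite-dimensional.)\<close>

definition injective_dimension_le :: "('a, 'z) ring_scheme \<Rightarrow> ('a, 'a) module \<Rightarrow> nat \<Rightarrow> bool" where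
  "injective_dimension_le R M d \<longleftrightarrow>
    (\<exists>(I :: nat \<Rightarrow> ('a, nat \<Rightarrow> 'a set) module) \<delta> \<eta>.
      injective_resolution R M I \<delta> \<eta> \<and> (\<forall>j>d. carrier (I j) = {\<zero>\<^bsub>I j\<^esub>}))"

definition injective_dimension :: "('a, 'z) ring_scheme \<Rightarrow> ('a, 'a) module \<Rightarrow> enat" where
  "injective_dimension R M = Inf (enat ` {d. injective_dimension_le R M d})"

text \<open>Right modules over \<open>R\<close> are left modules over the opposite ring.\<close>

definition gorenstein :: "('a, 'z) ring_scheme \<Rightarrow> bool" where
  "gorenstein R \<longleftrightarrow>
    injective_dimension R (regular_module R) < \<infinity> \<and>
    injective_dimension (op_ring R) (regular_module (op_ring R)) < \<infinity>"


section \<open>Projective resolutions and syzygies\<close>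

text \<open>For projectivity, \<open>'m \<Rightarrow> 'a\<close> contains the free module on the carrier of \<open>P\<close>. The lifting property
  against modules in these types therefore makes \<open>P\<close> a direct summand of a free module, and the
  lifting property for modules of all types follows.\<close>

definition projective_module :: "('a, 'z) ring_scheme \<Rightarrow> ('a, 'm) module \<Rightarrow> bool" where
  "projective_module R P \<longleftrightarrow>
    left_module R P \<and>
    (\<forall>(M :: ('a, 'm \<Rightarrow> 'a) module) (N :: ('a, 'm) module) p f.
      left_module R M \<and> left_module R N \<and>
      p \<in> mod_hom R M N \<and> p ` carrier M = carrier N \<and> f \<in> mod_hom R P N \<longrightarrow>
      (\<exists>g \<in> mod_hom R P M. \<forall>x\<in>carrier P. p (g x) = f x))"

text \<open>An augmented chain complex \<open>\<dots> \<rightarrow> obj 1 \<rightarrow> obj 0 \<rightarrow> U\<close>, with \<open>bd j : obj (j + 1) \<rightarrow> obj j\<close> and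
  \<open>aug : obj 0 \<rightarrow> U\<close>.\<close>

record ('a, 'p, 'u) aug_complex =
  obj :: "nat \<Rightarrow> ('a, 'p) module"
  bd :: "nat \<Rightarrow> 'p \<Rightarrow> 'p"
  aug :: "'p \<Rightarrow> 'u"

definition projective_resolution ::
  "('a, 'z) ring_scheme \<Rightarrow> ('a, 'p, 'u) aug_complex \<Rightarrow> ('a, 'u) module \<Rightarrow> bool" where
  "projective_resolution R P U \<longleftrightarrow>
    (\<forall>j. projective_module R (obj P j)) \<and>
    aug P \<in> mod_hom R (obj P 0) U \<and> (\<forall>j. bd P j \<in> mod_hom R (obj P (Suc j)) (obj P j)) \<and>
    aug P ` carrier (obj P 0) = carrier U \<and>
    bd P 0 ` carrier (obj P 1) = a_kernel (obj P 0) U (aug P) \<and>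
    (\<forall>j. bd P (Suc j) ` carrier (obj P (Suc (Suc j))) = a_kernel (obj P (Suc j)) (obj P j) (bd P j))"

text \<open>The \<open>i\<close>-th syzygy for \<open>i > 0\<close>, as a submodule of \<open>obj P (i - 1)\<close>.\<close>

definition syzygy :: "('a, 'p, 'u) aug_complex \<Rightarrow> nat \<Rightarrow> ('a, 'p) module" where
  "syzygy P i = (obj P (i - 1))\<lparr>carrier := bd P (i - 1) ` carrier (obj P i)\<rparr>"


section \<open>Ext\<close>

text \<open>The set of homomorphisms is a \<open>K\<close>-module through the central elements \<open>c \<cdot> 1\<close> of \<open>A\<close>.\<close>

definition Hom_module ::
  "('k, 'a) module \<Rightarrow> ('a, 'm) module \<Rightarrow> ('a, 'n) module \<Rightarrow> ('k, 'm \<Rightarrow> 'n) module" where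
  "Hom_module A M N =
    \<lparr>carrier = mod_hom A M N \<inter> extensional (carrier M), monoid.mult = undefined, monoid.one = undefined,
     ring.zero = (\<lambda>x\<in>carrier M. \<zero>\<^bsub>N\<^esub>), ring.add = (\<lambda>f g. \<lambda>x\<in>carrier M. f x \<oplus>\<^bsub>N\<^esub> g x),
     smult = (\<lambda>c f. \<lambda>x\<in>carrier M. (c \<odot>\<^bsub>A\<^esub> \<one>\<^bsub>A\<^esub>) \<odot>\<^bsub>N\<^esub> f x)\<rparr>"

definition cocycles ::
  "('k, 'a) module \<Rightarrow> ('a, 'x, 'u) aug_complex \<Rightarrow> nat \<Rightarrow> ('a, 'v) module \<Rightarrow> ('x \<Rightarrow> 'v) set" where
  "cocycles A S n V =
    {f \<in> carrier (Hom_module A (obj S n) V). \<forall>x\<in>carrier (obj S (Suc n)). f (bd S n x) = \<zero>\<^bsub>V\<^esub>}"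

definition coboundaries ::
  "('k, 'a) module \<Rightarrow> ('a, 'x, 'u) aug_complex \<Rightarrow> nat \<Rightarrow> ('a, 'v) module \<Rightarrow> ('x \<Rightarrow> 'v) set" where
  "coboundaries A S n V =
    (case n of
      0 \<Rightarrow> {\<zero>\<^bsub>Hom_module A (obj S 0) V\<^esub>}
    | Suc m \<Rightarrow> {\<lambda>x\<in>carrier (obj S (Suc m)). g (bd S m x) |g. g \<in> carrier (Hom_module A (obj S m) V)})"

text \<open>\<open>Ext\<^sup>n(U, V)\<close>, computed from the projective resolution \<open>S\<close> of \<open>U\<close>.\<close>

definition Ext ::
  "('k, 'a) module \<Rightarrow> ('a, 'x, 'u) aug_complex \<Rightarrow> nat \<Rightarrow> ('a, 'v) module \<Rightarrow> ('k, ('x \<Rightarrow> 'v) set) module" where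
  "Ext A S n V =
    quotient_module ((Hom_module A (obj S n) V)\<lparr>carrier := cocycles A S n V\<rparr>) (coboundaries A S n V)"


section \<open>Yoneda composition with an exact sequence\<close>

text \<open>\<open>chain_lift R S m f E l \<phi>\<close>: the maps \<open>\<phi> 0, \<dots>, \<phi> (l - 1)\<close> form the beginning of a chain map over
  the homomorphism \<open>f\<close> from \<open>obj S m\<close> to the module augmenting \<open>E\<close>, namely
  \<open>\<phi> j : obj S (m + j) \<rightarrow> obj E j\<close> with \<open>aug E \<circ> \<phi> 0 = f\<close> and \<open>bd E j \<circ> \<phi> (j + 1) = \<phi> j \<circ> bd S (m + j)\<close>.\<close>

definition chain_lift ::
  "('a, 'z) ring_scheme \<Rightarrow> ('a, 'x, 'u) aug_complex \<Rightarrow> nat \<Rightarrow> ('x \<Rightarrow> 'v) \<Rightarrow>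
    ('a, 'e, 'v) aug_complex \<Rightarrow> nat \<Rightarrow> (nat \<Rightarrow> 'x \<Rightarrow> 'e) \<Rightarrow> bool" where
  "chain_lift R S m f E l \<phi> \<longleftrightarrow>
    (\<forall>j<l. \<phi> j \<in> mod_hom R (obj S (m + j)) (obj E j)) \<and>
    (\<forall>x\<in>carrier (obj S m). aug E (\<phi> 0 x) = f x) \<and>
    (\<forall>j. Suc j < l \<longrightarrow> (\<forall>x\<in>carrier (obj S (m + Suc j)). bd E j (\<phi> (Suc j) x) = \<phi> j (bd S (m + j) x)))"

text \<open>In the following, an exact sequence \<open>0 \<rightarrow> W \<rightarrow> E\<^bsub>i-1\<^esub> \<rightarrow> \<dots> \<rightarrow> E\<^sub>0 \<rightarrow> V \<rightarrow> 0\<close> with \<open>i > 0\<close> is given by an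
  augmented complex \<open>E\<close>, of which only the part in degrees below \<open>i\<close> matters, the length \<open>i\<close>, and the
  map \<open>\<iota> : W \<rightarrow> E\<^bsub>i-1\<^esub>\<close>. A map \<open>g : S\<^bsub>m+i\<^esub> \<rightarrow> W\<close> is connected with \<open>f : S\<^sub>m \<rightarrow> V\<close> if there is a
  commutative diagram with these maps at its ends:

  \<open>S\<^bsub>m+i\<^esub> \<rightarrow> S\<^bsub>m+i-1\<^esub> \<rightarrow> \<dots> \<rightarrow> S\<^sub>m\<close>

  \<open>W \<rightarrow> E\<^bsub>i-1\<^esub> \<rightarrow> \<dots> \<rightarrow> E\<^sub>0 \<rightarrow> V\<close>\<close>

definition connected_cocycle ::
  "('k, 'a) module \<Rightarrow> ('a, 'x, 'u) aug_complex \<Rightarrow> nat \<Rightarrow> ('x \<Rightarrow> 'v) \<Rightarrow>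
    ('a, 'e, 'v) aug_complex \<Rightarrow> nat \<Rightarrow> ('w \<Rightarrow> 'e) \<Rightarrow> ('a, 'w) module \<Rightarrow> ('x \<Rightarrow> 'w) \<Rightarrow> bool" where
  "connected_cocycle A S m f E i \<iota> W g \<longleftrightarrow>
    g \<in> carrier (Hom_module A (obj S (m + i)) W) \<and>
    (\<exists>\<phi>. chain_lift A S m f E i \<phi> \<and>
      (\<forall>x\<in>carrier (obj S (m + i)). \<iota> (g x) = \<phi> (i - 1) (bd S (m + i - 1) x)))"

text \<open>Yoneda composition \<open>Ext\<^sup>n(U, V) \<rightarrow> Ext\<^bsup>n+i\<^esup>(U, W)\<close> with the sequence
  \<open>0 \<rightarrow> W \<rightarrow> E\<^bsub>i-1\<^esub> \<rightarrow> \<dots> \<rightarrow> E\<^sub>0 \<rightarrow> V \<rightarrow> 0\<close>. Here and below no signs are inserted; other conventions for the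
  identification with classes of exact sequences differ by a sign depending on \<open>n\<close> and \<open>i\<close> only.\<close>

definition yoneda_push ::
  "('k, 'a) module \<Rightarrow> ('a, 'x, 'u) aug_complex \<Rightarrow> nat \<Rightarrow>
    ('a, 'e, 'v) aug_complex \<Rightarrow> nat \<Rightarrow> ('w \<Rightarrow> 'e) \<Rightarrow> ('a, 'w) module \<Rightarrow>
    ('x \<Rightarrow> 'v) set \<Rightarrow> ('x \<Rightarrow> 'w) set" where
  "yoneda_push A S n E i \<iota> W c =
    (THE C. C \<in> carrier (Ext A S (n + i) W) \<and>
      (\<exists>f\<in>c. \<exists>g\<in>C. connected_cocycle A S n f E i \<iota> W g))"

text \<open>Yoneda composition \<open>Ext\<^sup>n(W, V) \<rightarrow> Ext\<^bsup>n+i\<^esup>(U, V)\<close> with the sequence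
  \<open>0 \<rightarrow> W \<rightarrow> E\<^bsub>i-1\<^esub> \<rightarrow> \<dots> \<rightarrow> E\<^sub>0 \<rightarrow> U \<rightarrow> 0\<close>, where \<open>S\<close> and \<open>T\<close> are projective resolutions of \<open>U\<close> and \<open>W\<close>.
  The cocycle \<open>\<theta> : S\<^sub>i \<rightarrow> W\<close> represents the class of the sequence in \<open>Ext\<^sup>i(U, W)\<close>, and \<open>h : T\<^sub>n \<rightarrow> V\<close>
  is composed with a lift \<open>S\<^bsub>i+n\<^esub> \<rightarrow> T\<^sub>n\<close> of \<open>\<theta>\<close>.\<close>

definition yoneda_pull ::
  "('k, 'a) module \<Rightarrow> ('a, 'x, 'u) aug_complex \<Rightarrow> ('a, 'y, 'w) aug_complex \<Rightarrow> nat \<Rightarrow>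
    ('a, 'e, 'u) aug_complex \<Rightarrow> nat \<Rightarrow> ('w \<Rightarrow> 'e) \<Rightarrow> ('a, 'w) module \<Rightarrow> ('a, 'v) module \<Rightarrow>
    ('y \<Rightarrow> 'v) set \<Rightarrow> ('x \<Rightarrow> 'v) set" where
  "yoneda_pull A S T n E i \<iota> W V c =
    (THE C. C \<in> carrier (Ext A S (n + i) V) \<and>
      (\<exists>h\<in>c. \<exists>\<theta> \<psi>. connected_cocycle A S 0 (aug S) E i \<iota> W \<theta> \<and> chain_lift A S i \<theta> T (Suc n) \<psi> \<and>
        (\<lambda>x\<in>carrier (obj S (n + i)). h (\<psi> n x)) \<in> C))"


section \<open>Rotations\<close>

text \<open>The \<open>i\<close>-th rotation of \<open>Ext\<^sup>n(U, V)\<close> with respect to resolutions \<open>\<pi>\<close> of \<open>U\<close> and \<open>\<tau>\<close> of \<open>V\<close>. The groups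
  \<open>Ext(U, -)\<close> and \<open>Ext(\<Omega>\<^sup>i U, -)\<close> are computed from resolutions \<open>S\<close> and \<open>T\<close>, which may but need not be
  \<open>\<pi>\<close> and its part in degrees at least \<open>i\<close>.\<close>

definition rotation ::
  "('k, 'a) module \<Rightarrow> ('a, 'x, 'u) aug_complex \<Rightarrow> ('a, 'y, 'p) aug_complex \<Rightarrow>
    ('a, 'p, 'u) aug_complex \<Rightarrow> ('a, 'q, 'v) aug_complex \<Rightarrow> nat \<Rightarrow> nat \<Rightarrow>
    ('x \<Rightarrow> 'v) set \<Rightarrow> ('y \<Rightarrow> 'q) set" where
  "rotation A S T \<pi> \<tau> n i c =
    inv_into (carrier (Ext A T n (syzygy \<tau> i)))
      (yoneda_pull A S T n \<pi> i (\<lambda>x. x) (syzygy \<pi> i) (syzygy \<tau> i))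
      (yoneda_push A S n \<tau> i (\<lambda>x. x) (syzygy \<tau> i) c)"

end

(*
Dimension shifting shows that composition with the truncation of a projective resolution of U is an
isomorphism in positive degrees, without any hypothesis on the algebra: two projective resolutions of
the same module are compared by chain maps that are unique up to homotopy. Composition with the
truncation of a resolution Q of V is a composite of connecting maps
Ext^(n+j)(U, Omega^j V) -> Ext^(n+j+1)(U, Omega^(j+1) V), which are isomorphisms as soon as
Ext^p(U, Q_j) = 0 for all p >= n. This vanishing is where the Gorenstein hypothesis enters: the algebra is
left Noetherian, so arbitrary direct sums of injective modules are injective by Baer's criterion, and
the direct sums of copies of a finite injective resolution of the regular module bound the injective
dimension of every free module, hence of every projective module.
*)

theory Submission
  imports Defs
begin

section \<open>Modules and homomorphisms\<close>

text \<open>The resolutions are arbitrary, so their terms may be infinitely generated, and finite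
  sums of injectives would not do. \<open>injective_module\<close> tests extension only against
  modules carried by the type of ring elements, whereas direct sums and resolutions live in other
  types. Baer's criterion is the bridge: it mentions left ideals only, and Zorn's lemma recovers
  extension for modules of every type. Projectives are freed from their test types by coordinates in
  a free module.

  No long exact sequence is set up; all arguments take place on cocycles. Both Yoneda compositions
  are definite descriptions of a class that contains a representative related to one of the given
  class, so each isomorphism is derived from a relation between cocycles. For the push this relation
  is linear. For the pull it ranges over all auxiliary choices, and choices made for two cocycles do
  not add; it is therefore enclosed in the linear relation of being cohomologous to the pull along
  one fixed choice.

  The strict inequality pays for the first connecting map: its injectivity needs vanishing already
  in degree \<open>n\<close>, that is, a bound \<open>d\<close> with
  \<open>d \<le> n - 1\<close>.\<close>

lemma mod_homI:
  assumes "\<And>x. x \<in> carrier M \<Longrightarrow> f x \<in> carrier N"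
    and "\<And>x y. \<lbrakk>x \<in> carrier M; y \<in> carrier M\<rbrakk> \<Longrightarrow> f (x \<oplus>\<^bsub>M\<^esub> y) = f x \<oplus>\<^bsub>N\<^esub> f y"
    and "\<And>a x. \<lbrakk>a \<in> carrier R; x \<in> carrier M\<rbrakk> \<Longrightarrow> f (a \<odot>\<^bsub>M\<^esub> x) = a \<odot>\<^bsub>N\<^esub> f x"
  shows "f \<in> mod_hom R M N"
  using assms by (auto simp: mod_hom_def)

lemma mod_hom_closed: "\<lbrakk>f \<in> mod_hom R M N; x \<in> carrier M\<rbrakk> \<Longrightarrow> f x \<in> carrier N"
  by (auto simp: mod_hom_def)

lemma mod_hom_add:
  "\<lbrakk>f \<in> mod_hom R M N; x \<in> carrier M; y \<in> carrier M\<rbrakk> \<Longrightarrow> f (x \<oplus>\<^bsub>M\<^esub> y) = f x \<oplus>\<^bsub>N\<^esub> f y"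
  by (auto simp: mod_hom_def)

lemma mod_hom_smult:
  "\<lbrakk>f \<in> mod_hom R M N; a \<in> carrier R; x \<in> carrier M\<rbrakk> \<Longrightarrow> f (a \<odot>\<^bsub>M\<^esub> x) = a \<odot>\<^bsub>N\<^esub> f x"
  by (auto simp: mod_hom_def)

lemma mod_hom_comp:
  "\<lbrakk>f \<in> mod_hom R M N; g \<in> mod_hom R N P\<rbrakk> \<Longrightarrow> (\<lambda>x. g (f x)) \<in> mod_hom R M P"
  by (rule mod_homI) (simp_all add: mod_hom_closed mod_hom_add mod_hom_smult)

lemma mod_hom_ident: "(\<lambda>x. x) \<in> mod_hom R M M"
  by (auto simp: mod_hom_def)

text \<open>Homomorphisms are total functions that matter on the carrier only. A change outside it
  is harmless because the carrier of a module is closed under the operations.\<close>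

lemma mod_hom_cong:
  assumes "left_module R M" and "f \<in> mod_hom R M N" and "\<And>x. x \<in> carrier M \<Longrightarrow> g x = f x"
  shows "g \<in> mod_hom R M N"
proof -
  interpret M: left_module R M by fact
  show ?thesis
    using assms(2,3) by (auto intro!: mod_homI simp: mod_hom_closed mod_hom_add mod_hom_smult M.smult_closed)
qed

lemma mod_hom_restrict:
  assumes "left_module R M" and "f \<in> mod_hom R M N"
  shows "restrict f (carrier M) \<in> mod_hom R M N"
  by (rule mod_hom_cong[OF assms]) simp

section \<open>Zero, negatives and differences\<close>

lemma (in left_module) smult_zero_left: "x \<in> carrier M \<Longrightarrow> \<zero> \<odot>\<^bsub>M\<^esub> x = \<zero>\<^bsub>M\<^esub>"
  using smult_l_distr[of \<zero> \<zero> x] smult_closed[of \<zero> x] by (simp add: M.add.r_cancel_one')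

lemma (in left_module) smult_zero_right: "a \<in> carrier R \<Longrightarrow> a \<odot>\<^bsub>M\<^esub> \<zero>\<^bsub>M\<^esub> = \<zero>\<^bsub>M\<^esub>"
  using smult_r_distr[of a "\<zero>\<^bsub>M\<^esub>" "\<zero>\<^bsub>M\<^esub>"] smult_closed[of a "\<zero>\<^bsub>M\<^esub>"] by (simp add: M.add.r_cancel_one')

text \<open>Turns negation into a scalar action: whatever is closed under addition and scalars, be
  it a subset, a map or a relation, then respects negatives too.\<close>

lemma (in left_module) smult_uminus_one:
  assumes "x \<in> carrier M"
  shows "(\<ominus> \<one>) \<odot>\<^bsub>M\<^esub> x = \<ominus>\<^bsub>M\<^esub> x"
proof -
  have "(\<ominus> \<one>) \<odot>\<^bsub>M\<^esub> x \<oplus>\<^bsub>M\<^esub> x = (\<ominus> \<one> \<oplus> \<one>) \<odot>\<^bsub>M\<^esub> x"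
    using assms smult_l_distr[of "\<ominus> \<one>" \<one> x] by (simp add: smult_one)
  also have "\<dots> = \<zero>\<^bsub>M\<^esub>"
    using assms by (simp add: R.l_neg smult_zero_left)
  finally show ?thesis
    using assms by (simp add: M.minus_equality smult_closed)
qed

lemma (in left_module) smult_minus_right:
  assumes "a \<in> carrier R" "x \<in> carrier M" "y \<in> carrier M"
  shows "a \<odot>\<^bsub>M\<^esub> (x \<ominus>\<^bsub>M\<^esub> y) = a \<odot>\<^bsub>M\<^esub> x \<ominus>\<^bsub>M\<^esub> a \<odot>\<^bsub>M\<^esub> y"
proof -
  have "a \<odot>\<^bsub>M\<^esub> (\<ominus>\<^bsub>M\<^esub> y) \<oplus>\<^bsub>M\<^esub> a \<odot>\<^bsub>M\<^esub> y = \<zero>\<^bsub>M\<^esub>"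
    using assms smult_r_distr[of a "\<ominus>\<^bsub>M\<^esub> y" y] by (simp add: M.l_neg smult_zero_right)
  then have "a \<odot>\<^bsub>M\<^esub> (\<ominus>\<^bsub>M\<^esub> y) = \<ominus>\<^bsub>M\<^esub> (a \<odot>\<^bsub>M\<^esub> y)"
    using assms by (simp add: M.minus_equality smult_closed)
  then show ?thesis
    using assms by (simp add: a_minus_def smult_r_distr)
qed

lemma (in abelian_group) minus_eq_zero_iff:
  "\<lbrakk>x \<in> carrier G; y \<in> carrier G\<rbrakk> \<Longrightarrow> x \<ominus> y = \<zero> \<longleftrightarrow> x = y"
  by (metis a_minus_def add.inv_closed add.inv_equality add.inv_inv r_neg)

lemma (in abelian_group) minus_add_cancel:
  "\<lbrakk>x \<in> carrier G; y \<in> carrier G\<rbrakk> \<Longrightarrow> (x \<ominus> y) \<oplus> y = x"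
  by (simp add: a_minus_def a_assoc l_neg)

lemma (in abelian_group) add_minus_cancel:
  "\<lbrakk>x \<in> carrier G; y \<in> carrier G\<rbrakk> \<Longrightarrow> (x \<oplus> y) \<ominus> y = x"
  by (simp add: a_minus_def a_assoc r_neg)

lemma (in abelian_group) add_minus_add:
  assumes "x \<in> carrier G" "y \<in> carrier G" "x' \<in> carrier G" "y' \<in> carrier G"
  shows "(x \<oplus> y) \<ominus> (x' \<oplus> y') = (x \<ominus> x') \<oplus> (y \<ominus> y')"
  using assms by (simp add: a_minus_def minus_add a_ac)

lemma mod_hom_zero:
  assumes "left_module R M" "left_module R N" "f \<in> mod_hom R M N"
  shows "f \<zero>\<^bsub>M\<^esub> = \<zero>\<^bsub>N\<^esub>"
proof -
  interpret M: left_module R M by fact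
  interpret N: left_module R N by fact
  show ?thesis
    using mod_hom_smult[OF assms(3), of "\<zero>\<^bsub>R\<^esub>" "\<zero>\<^bsub>M\<^esub>"] mod_hom_closed[OF assms(3), of "\<zero>\<^bsub>M\<^esub>"]
    by (simp add: M.smult_zero_left N.smult_zero_left)
qed

lemma mod_hom_uminus:
  assumes "left_module R M" "left_module R N" "f \<in> mod_hom R M N" "x \<in> carrier M"
  shows "f (\<ominus>\<^bsub>M\<^esub> x) = \<ominus>\<^bsub>N\<^esub> f x"
proof -
  interpret M: left_module R M by fact
  interpret N: left_module R N by fact
  show ?thesis
    using mod_hom_smult[OF assms(3) _ assms(4), of "\<ominus>\<^bsub>R\<^esub> \<one>\<^bsub>R\<^esub>"] mod_hom_closed[OF assms(3,4)] assms(4)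
    by (simp add: M.smult_uminus_one N.smult_uminus_one)
qed

lemma mod_hom_minus:
  assumes "left_module R M" "left_module R N" "f \<in> mod_hom R M N" "x \<in> carrier M" "y \<in> carrier M"
  shows "f (x \<ominus>\<^bsub>M\<^esub> y) = f x \<ominus>\<^bsub>N\<^esub> f y"
proof -
  interpret M: left_module R M by fact
  show ?thesis
    using assms by (simp add: a_minus_def mod_hom_add mod_hom_uminus)
qed

lemma mod_hom_zero_map:
  assumes "left_module R N"
  shows "(\<lambda>x. \<zero>\<^bsub>N\<^esub>) \<in> mod_hom R M N"
proof -
  interpret N: left_module R N by fact
  show ?thesis by (rule mod_homI) (simp_all add: N.smult_zero_right)
qed

lemma mod_hom_add_map:
  assumes "left_module R N" "f \<in> mod_hom R M N" "g \<in> mod_hom R M N"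
  shows "(\<lambda>x. f x \<oplus>\<^bsub>N\<^esub> g x) \<in> mod_hom R M N"
proof -
  interpret N: left_module R N by fact
  show ?thesis
    by (rule mod_homI)
      (use assms(2,3) in \<open>simp_all add: mod_hom_closed mod_hom_add mod_hom_smult N.smult_r_distr N.a_ac\<close>)
qed

lemma mod_hom_minus_map:
  assumes "left_module R N" "f \<in> mod_hom R M N" "g \<in> mod_hom R M N"
  shows "(\<lambda>x. f x \<ominus>\<^bsub>N\<^esub> g x) \<in> mod_hom R M N"
proof -
  interpret N: left_module R N by fact
  show ?thesis
    by (rule mod_homI)
      (use assms(2,3) in \<open>simp_all add: mod_hom_closed mod_hom_add mod_hom_smult
        N.smult_minus_right N.add_minus_add\<close>)
qed

text \<open>A submodule is the ambient record with a smaller carrier. The operations stay literally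
  the same, so changing the source or target of a homomorphism is a matter of carriers
  alone.\<close>

lemma mod_hom_into_subset:
  assumes "f \<in> mod_hom R M N" "\<And>x. x \<in> carrier M \<Longrightarrow> f x \<in> H"
  shows "f \<in> mod_hom R M (N\<lparr>carrier := H\<rparr>)"
  using assms by (auto simp: mod_hom_def)

lemma mod_hom_from_subset:
  assumes "f \<in> mod_hom R M (N\<lparr>carrier := H\<rparr>)" "H \<subseteq> carrier N"
  shows "f \<in> mod_hom R M N"
  using assms by (auto simp: mod_hom_def)

lemma mod_hom_on_subset:
  assumes "f \<in> mod_hom R M N" "H \<subseteq> carrier M"
  shows "f \<in> mod_hom R (M\<lparr>carrier := H\<rparr>) N"
  by (rule mod_homI) (use assms in \<open>auto simp: mod_hom_closed mod_hom_add mod_hom_smult subset_iff\<close>)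


subsection \<open>Submodules\<close>

text \<open>Negatives are multiples by \<open>\<ominus> \<one>\<close>, so closure under inverses is
  inherited from closure under scalars.\<close>

lemma (in left_module) left_submoduleI:
  assumes "H \<subseteq> carrier M" and "\<zero>\<^bsub>M\<^esub> \<in> H"
    and add: "\<And>x y. \<lbrakk>x \<in> H; y \<in> H\<rbrakk> \<Longrightarrow> x \<oplus>\<^bsub>M\<^esub> y \<in> H"
    and smult: "\<And>a x. \<lbrakk>a \<in> carrier R; x \<in> H\<rbrakk> \<Longrightarrow> a \<odot>\<^bsub>M\<^esub> x \<in> H"
  shows "submodule H R M"
proof (intro submodule.intro subgroup.intro submodule_axioms.intro)
  fix x assume "x \<in> H"
  then have "\<ominus>\<^bsub>M\<^esub> x \<in> H"
    using smult[of "\<ominus> \<one>" x] smult_uminus_one[of x] assms(1) by auto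
  then show "inv\<^bsub>add_monoid M\<^esub> x \<in> H" by (simp add: a_inv_def)
qed (use assms in auto)

lemma submodule_subset: "submodule H R M \<Longrightarrow> H \<subseteq> carrier M"
  using submodule.axioms(1) subgroup.subset by fastforce

lemma submodule_zero: "submodule H R M \<Longrightarrow> \<zero>\<^bsub>M\<^esub> \<in> H"
  using submodule.axioms(1) subgroup.one_closed by fastforce

lemma submodule_add: "\<lbrakk>submodule H R M; x \<in> H; y \<in> H\<rbrakk> \<Longrightarrow> x \<oplus>\<^bsub>M\<^esub> y \<in> H"
  using submodule.axioms(1) subgroup.m_closed by fastforce

lemma submodule_smult: "\<lbrakk>submodule H R M; a \<in> carrier R; x \<in> H\<rbrakk> \<Longrightarrow> a \<odot>\<^bsub>M\<^esub> x \<in> H"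
  by (rule submodule.smult_closed)

lemma submodule_uminus: "\<lbrakk>submodule H R M; x \<in> H\<rbrakk> \<Longrightarrow> \<ominus>\<^bsub>M\<^esub> x \<in> H"
  using submodule.axioms(1) subgroup.m_inv_closed unfolding a_inv_def by fastforce

lemma submodule_minus: "\<lbrakk>submodule H R M; x \<in> H; y \<in> H\<rbrakk> \<Longrightarrow> x \<ominus>\<^bsub>M\<^esub> y \<in> H"
  unfolding a_minus_def by (simp add: submodule_add submodule_uminus)

lemma left_module_submodule:
  assumes "left_module R M" "submodule H R M"
  shows "left_module R (M\<lparr>carrier := H\<rparr>)"
proof -
  interpret M: left_module R M by fact
  have sub: "x \<in> carrier M" if "x \<in> H" for x
    using submodule_subset[OF assms(2)] that by auto
  show ?thesis
  proof (intro left_module.intro left_module_axioms.intro abelian_groupI)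
    show "ring R" by (rule M.R.ring_axioms)
  next
    fix x assume "x \<in> carrier (M\<lparr>carrier := H\<rparr>)"
    then show "\<exists>y\<in>carrier (M\<lparr>carrier := H\<rparr>). y \<oplus>\<^bsub>M\<lparr>carrier := H\<rparr>\<^esub> x = \<zero>\<^bsub>M\<lparr>carrier := H\<rparr>\<^esub>"
      using submodule_uminus[OF assms(2)] M.l_neg sub by auto
  qed (auto simp: submodule_add[OF assms(2)] submodule_zero[OF assms(2)] submodule_smult[OF assms(2)]
      sub M.a_ac M.smult_l_distr M.smult_r_distr M.smult_assoc M.smult_one)
qed

lemma mod_hom_kernel_submodule:
  assumes "left_module R M" "left_module R N" "f \<in> mod_hom R M N"
  shows "submodule (a_kernel M N f) R M"
proof -
  interpret M: left_module R M by fact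
  interpret N: left_module R N by fact
  show ?thesis
    using assms(3) mod_hom_zero[OF assms]
    by (intro M.left_submoduleI)
      (auto simp: a_kernel_def kernel_def mod_hom_add mod_hom_smult M.smult_closed N.smult_zero_right)
qed

lemma mod_hom_image_submodule:
  assumes "left_module R M" "left_module R N" "f \<in> mod_hom R M N"
  shows "submodule (f ` carrier M) R N"
proof -
  interpret M: left_module R M by fact
  interpret N: left_module R N by fact
  show ?thesis
  proof (rule N.left_submoduleI)
    show "\<zero>\<^bsub>N\<^esub> \<in> f ` carrier M"
      using mod_hom_zero[OF assms] by (metis M.zero_closed image_eqI)
  next
    fix x y assume "x \<in> f ` carrier M" "y \<in> f ` carrier M"
    then show "x \<oplus>\<^bsub>N\<^esub> y \<in> f ` carrier M"
      by (auto simp: mod_hom_add[OF assms(3), symmetric])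
  next
    fix a x assume "a \<in> carrier R" "x \<in> f ` carrier M"
    then show "a \<odot>\<^bsub>N\<^esub> x \<in> f ` carrier M"
      by (auto simp: mod_hom_smult[OF assms(3), symmetric] M.smult_closed)
  qed (auto simp: mod_hom_closed[OF assms(3)])
qed

section \<open>Kernels and finite sums\<close>

lemma a_kernel_iff: "x \<in> a_kernel M N f \<longleftrightarrow> x \<in> carrier M \<and> f x = \<zero>\<^bsub>N\<^esub>"
  by (simp add: a_kernel_def kernel_def)

lemma mod_hom_finsum:
  assumes "left_module R M" "left_module R N" "f \<in> mod_hom R M N"
    and "finite B" "e \<in> B \<rightarrow> carrier M"
  shows "f (\<Oplus>\<^bsub>M\<^esub>b\<in>B. e b) = (\<Oplus>\<^bsub>N\<^esub>b\<in>B. f (e b))"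
proof -
  interpret M: left_module R M by fact
  interpret N: left_module R N by fact
  show ?thesis
    using assms(4,5)
  proof (induction B rule: finite_induct)
    case empty
    then show ?case using mod_hom_zero[OF assms(1-3)] by simp
  next
    case (insert b B)
    then show ?case
      using assms(3) by (simp add: Pi_def mod_hom_add mod_hom_closed)
  qed
qed

lemma (in left_module) smult_finsum:
  assumes "finite B" "e \<in> B \<rightarrow> carrier M" "a \<in> carrier R"
  shows "a \<odot>\<^bsub>M\<^esub> (\<Oplus>\<^bsub>M\<^esub>b\<in>B. e b) = (\<Oplus>\<^bsub>M\<^esub>b\<in>B. a \<odot>\<^bsub>M\<^esub> e b)"
  using assms(1,2)
  by (induction B rule: finite_induct) (use assms(3) in \<open>simp_all add: Pi_def smult_r_distr smult_closed smult_zero_right\<close>)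

lemma (in left_module) submodule_finsum:
  assumes "submodule H R M" "finite B" "e \<in> B \<rightarrow> H"
  shows "(\<Oplus>\<^bsub>M\<^esub>b\<in>B. e b) \<in> H"
  using assms(2,3)
proof (induction B rule: finite_induct)
  case empty
  then show ?case using submodule_zero[OF assms(1)] by simp
next
  case (insert b B)
  then have "e b \<in> H" "e \<in> B \<rightarrow> H" and sub: "H \<subseteq> carrier M"
    using submodule_subset[OF assms(1)] by auto
  then have "e b \<in> carrier M" "e \<in> B \<rightarrow> carrier M" by auto
  then show ?case using insert \<open>e b \<in> H\<close> by (simp add: submodule_add[OF assms(1)])
qed


section \<open>Finite-dimensional algebras are left Noetherian\<close>

text \<open>Defined from above, so that inclusions between spans follow from minimality and elements
  rarely have to be written as linear combinations.\<close>

definition module_span :: "('a, 'z) ring_scheme \<Rightarrow> ('a, 'm) module \<Rightarrow> 'm set \<Rightarrow> 'm set" where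
  "module_span R M B = \<Inter>{N. submodule N R M \<and> B \<subseteq> N}"

lemma module_span_minimal: "\<lbrakk>submodule N R M; B \<subseteq> N\<rbrakk> \<Longrightarrow> module_span R M B \<subseteq> N"
  by (auto simp: module_span_def)

lemma module_span_superset: "B \<subseteq> module_span R M B"
  by (auto simp: module_span_def)

lemma module_span_mono: "B \<subseteq> C \<Longrightarrow> module_span R M B \<subseteq> module_span R M C"
  by (auto simp: module_span_def)

lemma carrier_submodule:
  assumes "left_module R M"
  shows "submodule (carrier M) R M"
proof -
  interpret left_module R M by fact
  show ?thesis by (rule left_submoduleI) (auto simp: smult_closed)
qed

lemma module_span_submodule:
  assumes "left_module R M" "B \<subseteq> carrier M"
  shows "submodule (module_span R M B) R M"
proof -
  interpret left_module R M by fact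
  show ?thesis
  proof (rule left_submoduleI)
    show "module_span R M B \<subseteq> carrier M"
      using module_span_minimal[OF carrier_submodule[OF assms(1)] assms(2)] .
  qed (auto simp: module_span_def submodule_zero submodule_add submodule_smult)
qed

lemma regular_module_simps [simp]:
  "carrier (regular_module R) = carrier R" "\<zero>\<^bsub>regular_module R\<^esub> = \<zero>\<^bsub>R\<^esub>"
  "x \<oplus>\<^bsub>regular_module R\<^esub> y = x \<oplus>\<^bsub>R\<^esub> y" "a \<odot>\<^bsub>regular_module R\<^esub> x = a \<otimes>\<^bsub>R\<^esub> x"
  by (simp_all add: regular_module_def)

lemma left_module_regular:
  assumes "ring R"
  shows "left_module R (regular_module R)"
proof -
  interpret R: ring R by fact
  show ?thesis
  proof (intro left_module.intro left_module_axioms.intro abelian_groupI)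
    fix x assume "x \<in> carrier (regular_module R)"
    then show "\<exists>y\<in>carrier (regular_module R). y \<oplus>\<^bsub>regular_module R\<^esub> x = \<zero>\<^bsub>regular_module R\<^esub>"
      using R.l_neg by auto
  qed (auto simp: assms R.a_ac R.m_assoc R.l_distr R.r_distr)
qed

text \<open>Finite generation of all left ideals. The inclusion of the span of \<open>C\<close> in
  \<open>J\<close> follows from \<open>C \<subseteq> J\<close> by minimality, hence only the other
  one is demanded.\<close>

abbreviation left_noetherian :: "('a, 'z) ring_scheme \<Rightarrow> bool" where
  "left_noetherian R \<equiv>
    \<forall>J. submodule J R (regular_module R) \<longrightarrow>
      (\<exists>C. finite C \<and> C \<subseteq> J \<and> J \<subseteq> module_span R (regular_module R) C)"

lemma submodule_Int:
  assumes "left_module R M" "submodule N R M" "submodule N' R M"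
  shows "submodule (N \<inter> N') R M"
proof -
  interpret left_module R M by fact
  show ?thesis
    using submodule_subset[OF assms(2)] submodule_zero[OF assms(2)] submodule_zero[OF assms(3)]
    by (intro left_submoduleI)
      (auto simp: submodule_add[OF assms(2)] submodule_add[OF assms(3)]
        submodule_smult[OF assms(2)] submodule_smult[OF assms(3)])
qed

text \<open>This is the left ideal of all \<open>a\<close> for which the multiple of
  \<open>b\<close> by \<open>a\<close> lies in the sum of \<open>N\<close> and \<open>L\<close>.
  With \<open>L\<close> spanned by the other generators, it collects the leading coefficients of
  elements of \<open>N\<close>.\<close>

lemma coefficients_submodule:
  assumes "left_module R M" "submodule N R M" "submodule L R M" "b \<in> carrier M"
  shows "submodule {a \<in> carrier R. \<exists>y\<in>L. a \<odot>\<^bsub>M\<^esub> b \<oplus>\<^bsub>M\<^esub> y \<in> N} R (regular_module R)"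
proof -
  interpret left_module R M by fact
  interpret reg: left_module R "regular_module R"
    by (rule left_module_regular) (rule R.ring_axioms)
  have L: "y \<in> carrier M" if "y \<in> L" for y
    using submodule_subset[OF assms(3)] that by auto
  show ?thesis
  proof (rule reg.left_submoduleI)
    have "\<zero>\<^bsub>R\<^esub> \<odot>\<^bsub>M\<^esub> b \<oplus>\<^bsub>M\<^esub> \<zero>\<^bsub>M\<^esub> \<in> N"
      using assms(4) submodule_zero[OF assms(2)] by (simp add: smult_zero_left)
    then show "\<zero>\<^bsub>regular_module R\<^esub> \<in> {a \<in> carrier R. \<exists>y\<in>L. a \<odot>\<^bsub>M\<^esub> b \<oplus>\<^bsub>M\<^esub> y \<in> N}"
      using submodule_zero[OF assms(3)] by auto
  next
    fix a a' assume a: "a \<in> {a \<in> carrier R. \<exists>y\<in>L. a \<odot>\<^bsub>M\<^esub> b \<oplus>\<^bsub>M\<^esub> y \<in> N}"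
      "a' \<in> {a \<in> carrier R. \<exists>y\<in>L. a \<odot>\<^bsub>M\<^esub> b \<oplus>\<^bsub>M\<^esub> y \<in> N}"
    then obtain y y' where y: "y \<in> L" "a \<odot>\<^bsub>M\<^esub> b \<oplus>\<^bsub>M\<^esub> y \<in> N" "y' \<in> L" "a' \<odot>\<^bsub>M\<^esub> b \<oplus>\<^bsub>M\<^esub> y' \<in> N"
      by auto
    have "(a \<oplus>\<^bsub>R\<^esub> a') \<odot>\<^bsub>M\<^esub> b \<oplus>\<^bsub>M\<^esub> (y \<oplus>\<^bsub>M\<^esub> y') = (a \<odot>\<^bsub>M\<^esub> b \<oplus>\<^bsub>M\<^esub> y) \<oplus>\<^bsub>M\<^esub> (a' \<odot>\<^bsub>M\<^esub> b \<oplus>\<^bsub>M\<^esub> y')"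
      using a y L assms(4) by (simp add: smult_l_distr smult_closed M.a_ac)
    also have "\<dots> \<in> N"
      using y by (simp add: submodule_add[OF assms(2)])
    finally show "a \<oplus>\<^bsub>regular_module R\<^esub> a' \<in> {a \<in> carrier R. \<exists>y\<in>L. a \<odot>\<^bsub>M\<^esub> b \<oplus>\<^bsub>M\<^esub> y \<in> N}"
      using a y submodule_add[OF assms(3)] by auto
  next
    fix c a assume a: "c \<in> carrier R" "a \<in> {a \<in> carrier R. \<exists>y\<in>L. a \<odot>\<^bsub>M\<^esub> b \<oplus>\<^bsub>M\<^esub> y \<in> N}"
    then obtain y where y: "y \<in> L" "a \<odot>\<^bsub>M\<^esub> b \<oplus>\<^bsub>M\<^esub> y \<in> N" by auto
    have "(c \<otimes>\<^bsub>R\<^esub> a) \<odot>\<^bsub>M\<^esub> b \<oplus>\<^bsub>M\<^esub> c \<odot>\<^bsub>M\<^esub> y = c \<odot>\<^bsub>M\<^esub> (a \<odot>\<^bsub>M\<^esub> b \<oplus>\<^bsub>M\<^esub> y)"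
      using a y L assms(4) by (simp add: smult_r_distr smult_closed smult_assoc)
    also have "\<dots> \<in> N"
      using a y by (simp add: submodule_smult[OF assms(2)])
    finally show "c \<odot>\<^bsub>regular_module R\<^esub> a \<in> {a \<in> carrier R. \<exists>y\<in>L. a \<odot>\<^bsub>M\<^esub> b \<oplus>\<^bsub>M\<^esub> y \<in> N}"
      using a y submodule_smult[OF assms(3)] by auto
  qed auto
qed

text \<open>The elements of the required form already make up a submodule containing
  \<open>b\<close> and \<open>B\<close>, so the span is contained in it.\<close>

lemma module_span_insert:
  assumes "left_module R M" "insert b B \<subseteq> carrier M" "x \<in> module_span R M (insert b B)"
  obtains a y where "a \<in> carrier R" "y \<in> module_span R M B" "x = a \<odot>\<^bsub>M\<^esub> b \<oplus>\<^bsub>M\<^esub> y"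
proof -
  interpret left_module R M by fact
  have B: "submodule (module_span R M B) R M"
    by (rule module_span_submodule) (use assms in auto)
  have sub: "y \<in> carrier M" if "y \<in> module_span R M B" for y
    using submodule_subset[OF B] that by auto
  let ?N = "{a \<odot>\<^bsub>M\<^esub> b \<oplus>\<^bsub>M\<^esub> y |a y. a \<in> carrier R \<and> y \<in> module_span R M B}"
  have "submodule ?N R M"
  proof (rule left_submoduleI)
    show "?N \<subseteq> carrier M" using assms(2) sub by (auto simp: smult_closed)
    have "\<zero>\<^bsub>M\<^esub> = \<zero>\<^bsub>R\<^esub> \<odot>\<^bsub>M\<^esub> b \<oplus>\<^bsub>M\<^esub> \<zero>\<^bsub>M\<^esub>"
      using assms(2) by (simp add: smult_zero_left)
    then show "\<zero>\<^bsub>M\<^esub> \<in> ?N" using submodule_zero[OF B] by blast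
  next
    fix x x' assume "x \<in> ?N" "x' \<in> ?N"
    then obtain a y a' y' where *: "x = a \<odot>\<^bsub>M\<^esub> b \<oplus>\<^bsub>M\<^esub> y" "a \<in> carrier R" "y \<in> module_span R M B"
      "x' = a' \<odot>\<^bsub>M\<^esub> b \<oplus>\<^bsub>M\<^esub> y'" "a' \<in> carrier R" "y' \<in> module_span R M B" by blast
    then have "x \<oplus>\<^bsub>M\<^esub> x' = (a \<oplus>\<^bsub>R\<^esub> a') \<odot>\<^bsub>M\<^esub> b \<oplus>\<^bsub>M\<^esub> (y \<oplus>\<^bsub>M\<^esub> y')"
      using sub assms(2) by (simp add: smult_l_distr smult_closed M.a_ac)
    then show "x \<oplus>\<^bsub>M\<^esub> x' \<in> ?N"
      using * submodule_add[OF B] by blast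
  next
    fix c x assume "c \<in> carrier R" "x \<in> ?N"
    then obtain a y where *: "x = a \<odot>\<^bsub>M\<^esub> b \<oplus>\<^bsub>M\<^esub> y" "a \<in> carrier R" "y \<in> module_span R M B" by blast
    then have "c \<odot>\<^bsub>M\<^esub> x = (c \<otimes>\<^bsub>R\<^esub> a) \<odot>\<^bsub>M\<^esub> b \<oplus>\<^bsub>M\<^esub> c \<odot>\<^bsub>M\<^esub> y"
      using sub assms(2) \<open>c \<in> carrier R\<close> by (simp add: smult_r_distr smult_closed smult_assoc)
    then show "c \<odot>\<^bsub>M\<^esub> x \<in> ?N"
      using * submodule_smult[OF B] \<open>c \<in> carrier R\<close> by blast
  qed
  moreover have "insert b B \<subseteq> ?N"
  proof -
    have "b = \<one>\<^bsub>R\<^esub> \<odot>\<^bsub>M\<^esub> b \<oplus>\<^bsub>M\<^esub> \<zero>\<^bsub>M\<^esub>"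
      using assms(2) by (simp add: smult_one)
    then have "b \<in> ?N" using submodule_zero[OF B] by blast
    moreover have "y \<in> ?N" if "y \<in> B" for y
    proof -
      have "y \<in> module_span R M B" using that module_span_superset[of B R M] by blast
      moreover have "y = \<zero>\<^bsub>R\<^esub> \<odot>\<^bsub>M\<^esub> b \<oplus>\<^bsub>M\<^esub> y"
        using assms(2) that by (simp add: smult_zero_left subset_iff)
      ultimately show ?thesis by blast
    qed
    ultimately show ?thesis by auto
  qed
  ultimately have "module_span R M (insert b B) \<subseteq> ?N" by (rule module_span_minimal)
  then show thesis using assms(3) that by blast
qed

text \<open>Induction on the generators, separating off \<open>b\<close>. The elements of
  \<open>N\<close> without a \<open>b\<close>-part are finitely generated by induction, and the
  ideal of coefficients at \<open>b\<close> is finitely generated by assumption. Generators of the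
  former together with lifts to \<open>N\<close> of generators of the latter generate
  \<open>N\<close>.\<close>

lemma submodule_of_fg_is_fg:
  assumes "left_module R M" "left_noetherian R"
    and "finite B" "B \<subseteq> carrier M" "submodule N R M" "N \<subseteq> module_span R M B"
  shows "\<exists>C. finite C \<and> C \<subseteq> N \<and> N \<subseteq> module_span R M C"
  using assms(3-6)
proof (induction B arbitrary: N rule: finite_induct)
  case empty
  have "N \<subseteq> module_span R M {}" by fact
  then show ?case by blast
next
  case (insert b B)
  interpret left_module R M by fact
  let ?L = "module_span R M B"
  have L: "submodule ?L R M" by (rule module_span_submodule) (use insert assms in auto)
  have carr: "y \<in> carrier M" if "y \<in> N \<or> y \<in> ?L" for y
    using submodule_subset[OF L] submodule_subset[OF insert.prems(2)] that by auto
  let ?J = "\<lambda>N. {a \<in> carrier R. \<exists>y\<in>?L. a \<odot>\<^bsub>M\<^esub> b \<oplus>\<^bsub>M\<^esub> y \<in> N}"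
  have J: "submodule (?J N') R (regular_module R)" if "submodule N' R M" for N'
    using coefficients_submodule[OF assms(1) that L, of b] insert.prems by auto
  obtain CJ where CJ: "finite CJ" "CJ \<subseteq> ?J N" "?J N \<subseteq> module_span R (regular_module R) CJ"
    using assms(2) J[OF insert.prems(2)] by meson
  then have "\<forall>a\<in>CJ. \<exists>y\<in>?L. a \<odot>\<^bsub>M\<^esub> b \<oplus>\<^bsub>M\<^esub> y \<in> N" by auto
  then obtain y where y: "\<And>a. a \<in> CJ \<Longrightarrow> y a \<in> ?L" "\<And>a. a \<in> CJ \<Longrightarrow> a \<odot>\<^bsub>M\<^esub> b \<oplus>\<^bsub>M\<^esub> y a \<in> N"
    by metis
  obtain D where D: "finite D" "D \<subseteq> N \<inter> ?L" "N \<inter> ?L \<subseteq> module_span R M D"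
    using insert.IH[of "N \<inter> ?L"] insert.prems submodule_Int[OF assms(1) insert.prems(2) L] by auto
  define C where "C = D \<union> (\<lambda>a. a \<odot>\<^bsub>M\<^esub> b \<oplus>\<^bsub>M\<^esub> y a) ` CJ"
  have CN: "C \<subseteq> N" using D y by (auto simp: C_def)
  then have CM: "C \<subseteq> carrier M" using carr by auto
  have sC: "submodule (module_span R M C) R M" by (rule module_span_submodule[OF assms(1) CM])
  \<comment> \<open>The lifts put the generators of the coefficient ideal of \<open>N\<close> into
    the coefficient ideal of the span of \<open>C\<close>; hence the whole ideal is contained in
    it.\<close>
  have "CJ \<subseteq> ?J (module_span R M C)"
  proof
    fix a assume a: "a \<in> CJ"
    have "a \<odot>\<^bsub>M\<^esub> b \<oplus>\<^bsub>M\<^esub> y a \<in> module_span R M C"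
      using a module_span_superset[of C R M] by (auto simp: C_def)
    then show "a \<in> ?J (module_span R M C)" using a y CJ(2) by auto
  qed
  then have JJ: "?J N \<subseteq> ?J (module_span R M C)"
    using CJ(3) module_span_minimal[OF J[OF sC]] by blast
  have "N \<subseteq> module_span R M C"
  proof
    fix x assume x: "x \<in> N"
    then have "x \<in> module_span R M (insert b B)" using insert.prems(3) by blast
    then obtain a z where az: "a \<in> carrier R" "z \<in> ?L" "x = a \<odot>\<^bsub>M\<^esub> b \<oplus>\<^bsub>M\<^esub> z"
      by (rule module_span_insert[OF assms(1) insert.prems(1)])
    then have "a \<in> ?J N" using x by auto
    then have "a \<in> ?J (module_span R M C)" using JJ by blast
    then obtain z' where z': "z' \<in> ?L" "a \<odot>\<^bsub>M\<^esub> b \<oplus>\<^bsub>M\<^esub> z' \<in> module_span R M C" by auto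
    \<comment> \<open>An element of the span of \<open>C\<close> with the same coefficient at
      \<open>b\<close> as \<open>x\<close>. In the difference the \<open>b\<close>-parts cancel,
      which leaves an element of \<open>N \<inter> ?L\<close>, where \<open>D\<close> takes
      over.\<close>
    let ?x' = "a \<odot>\<^bsub>M\<^esub> b \<oplus>\<^bsub>M\<^esub> z'"
    have x': "?x' \<in> N" using z'(2) module_span_minimal[OF insert.prems(2) CN] by blast
    have b: "a \<odot>\<^bsub>M\<^esub> b \<in> carrier M" using az(1) insert.prems(1) by (simp add: smult_closed)
    have "x \<ominus>\<^bsub>M\<^esub> ?x' = z \<ominus>\<^bsub>M\<^esub> z'"
      using b carr az z'(1) by (simp add: M.add_minus_add) (simp add: a_minus_def M.r_neg)
    then have "x \<ominus>\<^bsub>M\<^esub> ?x' \<in> N \<inter> ?L"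
      using submodule_minus[OF insert.prems(2) x x'] submodule_minus[OF L az(2) z'(1)] by simp
    then have "x \<ominus>\<^bsub>M\<^esub> ?x' \<in> module_span R M C"
      using D(3) module_span_mono[of D C R M] by (auto simp: C_def)
    then have "(x \<ominus>\<^bsub>M\<^esub> ?x') \<oplus>\<^bsub>M\<^esub> ?x' \<in> module_span R M C"
      using z'(2) by (rule submodule_add[OF sC])
    then show "x \<in> module_span R M C" using carr x x' by (simp add: M.minus_add_cancel)
  qed
  moreover have "finite C" using D(1) CJ(1) by (simp add: C_def)
  ultimately show ?case using CN by blast
qed

text \<open>A nonzero element of an ideal is a unit, and dividing by it shows that it generates
  everything.\<close>

lemma field_left_noetherian:
  assumes "field K"
  shows "left_noetherian K"
proof (intro allI impI)
  interpret K: field K by fact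
  fix J assume J: "submodule J K (regular_module K)"
  show "\<exists>C. finite C \<and> C \<subseteq> J \<and> J \<subseteq> module_span K (regular_module K) C"
  proof (cases "J \<subseteq> {\<zero>\<^bsub>K\<^esub>}")
    case True
    then have "J \<subseteq> module_span K (regular_module K) {}"
      using submodule_zero[of _ K "regular_module K"] by (auto simp: module_span_def)
    then show ?thesis by blast
  next
    case False
    then obtain u where u: "u \<in> J" "u \<noteq> \<zero>\<^bsub>K\<^esub>" by auto
    then have "u \<in> Units K"
      using submodule_subset[OF J] K.field_Units by auto
    have "x \<in> N" if N: "submodule N K (regular_module K)" "u \<in> N" and x: "x \<in> carrier K" for x N
    proof -
      have "x \<otimes>\<^bsub>K\<^esub> inv\<^bsub>K\<^esub> u \<otimes>\<^bsub>K\<^esub> u \<in> N"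
        using submodule_smult[OF N(1) _ N(2), of "x \<otimes>\<^bsub>K\<^esub> inv\<^bsub>K\<^esub> u"] x \<open>u \<in> Units K\<close> by simp
      then show ?thesis using x \<open>u \<in> Units K\<close> by (simp add: K.m_assoc K.Units_closed)
    qed
    then have "J \<subseteq> module_span K (regular_module K) {u}"
      using submodule_subset[OF J] by (auto simp: module_span_def)
    then show ?thesis using u by (intro exI[of _ "{u}"]) auto
  qed
qed

lemma (in fin_dim_algebra) left_module_scalars: "left_module K A"
  by (intro left_module.intro left_module_axioms.intro)
    (auto simp: K.ring_axioms A.is_abelian_group smult_l_distr smult_r_distr smult_assoc1)

text \<open>Scalars of \<open>K\<close> act as multiplication by multiples of the unit, so every
  left ideal is a \<open>K\<close>-subspace of the finite-dimensional space \<open>A\<close>. A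
  finite generating set over \<open>K\<close> generates the ideal over \<open>A\<close> as
  well.\<close>

lemma (in fin_dim_algebra) algebra_left_noetherian: "left_noetherian A"
proof (intro allI impI)
  interpret reg: left_module A "regular_module A"
    by (rule left_module_regular) (rule A.ring_axioms)
  have sub: "submodule N K A" if N: "submodule N A (regular_module A)" for N
  proof -
    interpret KA: left_module K A by (rule left_module_scalars)
    show ?thesis
    proof (rule KA.left_submoduleI)
      show "N \<subseteq> carrier A" using submodule_subset[OF N] by simp
      then show "c \<odot>\<^bsub>A\<^esub> x \<in> N" if "c \<in> carrier K" "x \<in> N" for c x
        using submodule_smult[OF N _ \<open>x \<in> N\<close>, of "c \<odot>\<^bsub>A\<^esub> \<one>\<^bsub>A\<^esub>"] that smult_mult_left[of c "\<one>\<^bsub>A\<^esub>" x]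
        by (auto simp: subset_iff)
    qed (use submodule_zero[OF N] submodule_add[OF N] in auto)
  qed
  fix J assume J: "submodule J A (regular_module A)"
  obtain B where B: "finite B" "B \<subseteq> carrier A"
      "\<And>x. x \<in> carrier A \<Longrightarrow> \<exists>a \<in> B \<rightarrow> carrier K. x = (\<Oplus>\<^bsub>A\<^esub>b\<in>B. a b \<odot>\<^bsub>A\<^esub> b)"
    using finite_dim unfolding finitely_generated_def by blast
  interpret KA: left_module K A by (rule left_module_scalars)
  have "carrier A \<subseteq> module_span K A B"
  proof
    fix x assume "x \<in> carrier A"
    then obtain a where a: "a \<in> B \<rightarrow> carrier K" "x = (\<Oplus>\<^bsub>A\<^esub>b\<in>B. a b \<odot>\<^bsub>A\<^esub> b)"
      using B(3) by blast
    have sp: "submodule (module_span K A B) K A"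
      by (rule module_span_submodule[OF left_module_scalars B(2)])
    have "(\<lambda>b. a b \<odot>\<^bsub>A\<^esub> b) \<in> B \<rightarrow> module_span K A B"
      using a(1) submodule_smult[OF sp] module_span_superset[of B K A] by (auto simp: Pi_def)
    then show "x \<in> module_span K A B"
      unfolding a(2) by (rule KA.submodule_finsum[OF sp B(1)])
  qed
  then have "J \<subseteq> module_span K A B" using submodule_subset[OF J] by auto
  then obtain C where C: "finite C" "C \<subseteq> J" "J \<subseteq> module_span K A C"
    using submodule_of_fg_is_fg[OF left_module_scalars field_left_noetherian[OF K.field_axioms]
        B(1,2) sub[OF J]] by blast
  have "submodule (module_span A (regular_module A) C) A (regular_module A)"
    by (rule module_span_submodule) (use C(2) submodule_subset[OF J] reg.left_module_axioms in auto)
  then have "module_span K A C \<subseteq> module_span A (regular_module A) C"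
    by (intro module_span_minimal sub module_span_superset)
  then show "\<exists>C. finite C \<and> C \<subseteq> J \<and> J \<subseteq> module_span A (regular_module A) C"
    using C by blast
qed


section \<open>Direct powers and projective modules\<close>

definition direct_power :: "('a, 'm) module \<Rightarrow> ('a, 'x \<Rightarrow> 'm) module" where
  "direct_power M =
    \<lparr>carrier = {f. (\<forall>x. f x \<in> carrier M) \<and> finite {x. f x \<noteq> \<zero>\<^bsub>M\<^esub>}},
     monoid.mult = undefined, monoid.one = undefined,
     ring.zero = (\<lambda>x. \<zero>\<^bsub>M\<^esub>), ring.add = (\<lambda>f g x. f x \<oplus>\<^bsub>M\<^esub> g x), smult = (\<lambda>a f x. a \<odot>\<^bsub>M\<^esub> f x)\<rparr>"

lemma direct_power_carrier:
  "f \<in> carrier (direct_power M) \<longleftrightarrow> (\<forall>x. f x \<in> carrier M) \<and> finite {x. f x \<noteq> \<zero>\<^bsub>M\<^esub>}"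
  by (simp add: direct_power_def)

lemma direct_power_simps [simp]:
  "\<zero>\<^bsub>direct_power M\<^esub> = (\<lambda>x. \<zero>\<^bsub>M\<^esub>)" "f \<oplus>\<^bsub>direct_power M\<^esub> g = (\<lambda>x. f x \<oplus>\<^bsub>M\<^esub> g x)"
  "a \<odot>\<^bsub>direct_power M\<^esub> f = (\<lambda>x. a \<odot>\<^bsub>M\<^esub> f x)"
  by (simp_all add: direct_power_def)

lemma direct_power_map_carrier:
  assumes "f \<in> carrier (direct_power M)" "h \<zero>\<^bsub>M\<^esub> = \<zero>\<^bsub>N\<^esub>" "\<And>y. y \<in> carrier M \<Longrightarrow> h y \<in> carrier N"
  shows "(\<lambda>x. h (f x)) \<in> carrier (direct_power N)"
proof -
  have "{x. h (f x) \<noteq> \<zero>\<^bsub>N\<^esub>} \<subseteq> {x. f x \<noteq> \<zero>\<^bsub>M\<^esub>}" using assms(2) by auto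
  then show ?thesis
    using assms(1,3) by (auto simp: direct_power_carrier intro: finite_subset)
qed

lemma left_module_direct_power:
  fixes M :: "('a, 'm) module"
  assumes "left_module R M"
  shows "left_module R (direct_power M :: ('a, 'x \<Rightarrow> 'm) module)"
proof -
  let ?D = "direct_power M :: ('a, 'x \<Rightarrow> 'm) module"
  interpret M: left_module R M by fact
  show ?thesis
  proof (intro left_module.intro left_module_axioms.intro abelian_groupI)
    fix f g assume fg: "f \<in> carrier ?D" "g \<in> carrier ?D"
    have "{x. f x \<oplus>\<^bsub>M\<^esub> g x \<noteq> \<zero>\<^bsub>M\<^esub>} \<subseteq> {x. f x \<noteq> \<zero>\<^bsub>M\<^esub>} \<union> {x. g x \<noteq> \<zero>\<^bsub>M\<^esub>}" by auto
    then show "f \<oplus>\<^bsub>?D\<^esub> g \<in> carrier ?D"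
      using fg by (auto simp: direct_power_carrier intro: finite_subset)
  next
    fix f assume f: "f \<in> carrier ?D"
    then have "(\<lambda>x. \<ominus>\<^bsub>M\<^esub> f x) \<in> carrier ?D"
      by (rule direct_power_map_carrier) auto
    moreover have "(\<lambda>x. \<ominus>\<^bsub>M\<^esub> f x) \<oplus>\<^bsub>?D\<^esub> f = \<zero>\<^bsub>?D\<^esub>"
      using f by (simp add: direct_power_carrier M.l_neg)
    ultimately show "\<exists>g\<in>carrier ?D. g \<oplus>\<^bsub>?D\<^esub> f = \<zero>\<^bsub>?D\<^esub>" by blast
  next
    fix a f assume "a \<in> carrier R" "f \<in> carrier ?D"
    then show "a \<odot>\<^bsub>?D\<^esub> f \<in> carrier ?D"
      using direct_power_map_carrier[of f M "\<lambda>y. a \<odot>\<^bsub>M\<^esub> y" M] M.smult_zero_right[of a] M.smult_closed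
      by simp
  qed (auto simp: M.R.ring_axioms direct_power_carrier M.a_ac M.smult_l_distr M.smult_r_distr
      M.smult_assoc M.smult_one)
qed

lemma direct_power_map_hom:
  assumes "left_module R M" "left_module R N" "h \<in> mod_hom R M N"
  shows "(\<lambda>f x. h (f x)) \<in> mod_hom R (direct_power M) (direct_power N)"
proof (rule mod_homI)
  fix f assume "f \<in> carrier (direct_power M)"
  then show "(\<lambda>x. h (f x)) \<in> carrier (direct_power N)"
    by (rule direct_power_map_carrier) (use mod_hom_zero[OF assms] mod_hom_closed[OF assms(3)] in auto)
qed (use assms(3) in \<open>auto simp: direct_power_carrier mod_hom_add mod_hom_smult\<close>)

section \<open>Homomorphisms out of free modules\<close>

definition lin_comb :: "('a, 'z) ring_scheme \<Rightarrow> ('a, 'n) module \<Rightarrow> ('x \<Rightarrow> 'n) \<Rightarrow> ('x \<Rightarrow> 'a) \<Rightarrow> 'n" where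
  "lin_comb R N e c = (\<Oplus>\<^bsub>N\<^esub>x\<in>{x. c x \<noteq> \<zero>\<^bsub>R\<^esub>}. c x \<odot>\<^bsub>N\<^esub> e x)"

text \<open>Padding with zero terms lets two combinations be compared over a common finite index
  set; this is how additivity is shown.\<close>

lemma lin_comb_eq:
  assumes "left_module R N" "\<And>x. e x \<in> carrier N" "c \<in> carrier (direct_power (regular_module R))"
    and "finite T" "{x. c x \<noteq> \<zero>\<^bsub>R\<^esub>} \<subseteq> T"
  shows "lin_comb R N e c = (\<Oplus>\<^bsub>N\<^esub>x\<in>T. c x \<odot>\<^bsub>N\<^esub> e x)"
proof -
  interpret N: left_module R N by fact
  show ?thesis
    unfolding lin_comb_def
    by (rule N.add.finprod_mono_neutral_cong_left)
      (use assms(2-5) in \<open>auto simp: direct_power_carrier N.smult_zero_left N.smult_closed\<close>)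
qed

lemma lin_comb_hom:
  fixes R :: "('a, 'z) ring_scheme" and N :: "('a, 'n) module" and e :: "'x \<Rightarrow> 'n"
  assumes "left_module R N" "\<And>x. e x \<in> carrier N"
  shows "lin_comb R N e \<in> mod_hom R (direct_power (regular_module R)) N"
proof -
  interpret N: left_module R N by fact
  let ?F = "direct_power (regular_module R) :: ('a, 'x \<Rightarrow> 'a) module"
  interpret F: left_module R ?F
    by (intro left_module_direct_power left_module_regular N.R.ring_axioms)
  let ?s = "\<lambda>c. {x. c x \<noteq> \<zero>\<^bsub>R\<^esub>}"
  have fin: "finite (?s c)" and carr: "c x \<in> carrier R" if "c \<in> carrier ?F" for c x
    using that by (auto simp: direct_power_carrier)
  show ?thesis
  proof (rule mod_homI)
    fix c assume "c \<in> carrier ?F"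
    then show "lin_comb R N e c \<in> carrier N"
      using assms(2) carr unfolding lin_comb_def by (auto intro!: N.finsum_closed simp: N.smult_closed)
  next
    fix c d assume cd: "c \<in> carrier ?F" "d \<in> carrier ?F"
    let ?T = "?s c \<union> ?s d"
    have *: "lin_comb R N e f = (\<Oplus>\<^bsub>N\<^esub>x\<in>?T. f x \<odot>\<^bsub>N\<^esub> e x)"
      if "f \<in> carrier ?F" "?s f \<subseteq> ?T" for f
      by (rule lin_comb_eq) (use assms that fin cd in auto)
    have "lin_comb R N e (c \<oplus>\<^bsub>?F\<^esub> d) = (\<Oplus>\<^bsub>N\<^esub>x\<in>?T. c x \<odot>\<^bsub>N\<^esub> e x \<oplus>\<^bsub>N\<^esub> d x \<odot>\<^bsub>N\<^esub> e x)"
    proof (subst *)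
      show "c \<oplus>\<^bsub>?F\<^esub> d \<in> carrier ?F" using cd by (rule F.a_closed)
      show "(\<Oplus>\<^bsub>N\<^esub>x\<in>?T. (c \<oplus>\<^bsub>?F\<^esub> d) x \<odot>\<^bsub>N\<^esub> e x) = (\<Oplus>\<^bsub>N\<^esub>x\<in>?T. c x \<odot>\<^bsub>N\<^esub> e x \<oplus>\<^bsub>N\<^esub> d x \<odot>\<^bsub>N\<^esub> e x)"
        by (rule N.finsum_cong') (use carr cd assms(2) in \<open>auto simp: N.smult_l_distr N.smult_closed\<close>)
    qed auto
    also have "\<dots> = lin_comb R N e c \<oplus>\<^bsub>N\<^esub> lin_comb R N e d"
      using cd carr assms(2) by (subst N.finsum_addf) (auto simp: * N.smult_closed)
    finally show "lin_comb R N e (c \<oplus>\<^bsub>?F\<^esub> d) = lin_comb R N e c \<oplus>\<^bsub>N\<^esub> lin_comb R N e d" .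
  next
    fix a c assume ac: "a \<in> carrier R" "c \<in> carrier ?F"
    have "lin_comb R N e (a \<odot>\<^bsub>?F\<^esub> c) = (\<Oplus>\<^bsub>N\<^esub>x\<in>?s c. (a \<odot>\<^bsub>?F\<^esub> c) x \<odot>\<^bsub>N\<^esub> e x)"
      by (rule lin_comb_eq) (use assms fin ac F.smult_closed in auto)
    also have "\<dots> = (\<Oplus>\<^bsub>N\<^esub>x\<in>?s c. a \<odot>\<^bsub>N\<^esub> (c x \<odot>\<^bsub>N\<^esub> e x))"
      by (rule N.finsum_cong') (use carr ac assms(2) in \<open>auto simp: N.smult_assoc N.smult_closed\<close>)
    also have "\<dots> = a \<odot>\<^bsub>N\<^esub> lin_comb R N e c"
      unfolding lin_comb_def using fin carr ac assms(2) by (subst N.smult_finsum) (auto simp: N.smult_closed)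
    finally show "lin_comb R N e (a \<odot>\<^bsub>?F\<^esub> c) = a \<odot>\<^bsub>N\<^esub> lin_comb R N e c" .
  qed
qed

lemma mod_hom_lin_comb:
  assumes "left_module R M" "left_module R N" "f \<in> mod_hom R M N" "\<And>x. e x \<in> carrier M"
    and "c \<in> carrier (direct_power (regular_module R))"
  shows "f (lin_comb R M e c) = lin_comb R N (\<lambda>x. f (e x)) c"
proof -
  interpret M: left_module R M by fact
  interpret N: left_module R N by fact
  have c: "finite {x. c x \<noteq> \<zero>\<^bsub>R\<^esub>}" "c x \<in> carrier R" for x
    using assms(5) by (auto simp: direct_power_carrier)
  have "f (lin_comb R M e c) = (\<Oplus>\<^bsub>N\<^esub>x\<in>{x. c x \<noteq> \<zero>\<^bsub>R\<^esub>}. f (c x \<odot>\<^bsub>M\<^esub> e x))"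
    unfolding lin_comb_def
    by (rule mod_hom_finsum[OF assms(1-3) c(1)]) (simp add: Pi_def c(2) assms(4) M.smult_closed)
  also have "\<dots> = lin_comb R N (\<lambda>x. f (e x)) c"
    unfolding lin_comb_def
    by (rule N.finsum_cong'[OF refl])
      (simp_all add: Pi_def c(2) assms(4) mod_hom_closed[OF assms(3)] mod_hom_smult[OF assms(3)] N.smult_closed)
  finally show ?thesis .
qed

section \<open>Projective modules as retracts of free modules\<close>

lemma projective_left_module: "projective_module R P \<Longrightarrow> left_module R P"
  by (simp add: projective_module_def)

text \<open>The identity of \<open>P\<close> is lifted along the surjection from the free module on
  the elements of \<open>P\<close>. The two types in \<open>projective_module\<close> are exactly
  the ones this instance calls for.\<close>

lemma projective_coordinates:
  fixes P :: "('a, 'm) module"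
  assumes "projective_module R P"
  shows "\<exists>s\<in>mod_hom R P (direct_power (regular_module R) :: ('a, 'm \<Rightarrow> 'a) module).
    \<forall>x\<in>carrier P. lin_comb R P (\<lambda>x. if x \<in> carrier P then x else \<zero>\<^bsub>P\<^esub>) (s x) = x"
proof -
  interpret P: left_module R P by (rule projective_left_module) fact
  let ?F = "direct_power (regular_module R) :: ('a, 'm \<Rightarrow> 'a) module"
  interpret F: left_module R ?F
    by (intro left_module_direct_power left_module_regular P.R.ring_axioms)
  \<comment> \<open>The basis is the whole type, so basis elements outside the carrier need a value
    too; zero is harmless.\<close>
  let ?e = "\<lambda>x. if x \<in> carrier P then x else \<zero>\<^bsub>P\<^esub>"
  let ?p = "lin_comb R P ?e"
  have hom: "?p \<in> mod_hom R ?F P"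
    by (rule lin_comb_hom) (auto simp: P.left_module_axioms)
  have "?p ` carrier ?F = carrier P"
  proof
    show "?p ` carrier ?F \<subseteq> carrier P" by (auto intro: mod_hom_closed[OF hom])
    show "carrier P \<subseteq> ?p ` carrier ?F"
    proof
      fix x assume x: "x \<in> carrier P"
      let ?c = "\<lambda>y. if y = x then \<one>\<^bsub>R\<^esub> else \<zero>\<^bsub>R\<^esub>"
      have c: "?c \<in> carrier ?F"
        by (auto simp: direct_power_carrier)
      have "?p ?c = (\<Oplus>\<^bsub>P\<^esub>y\<in>{x}. ?c y \<odot>\<^bsub>P\<^esub> ?e y)"
        by (rule lin_comb_eq) (use c in \<open>auto simp: P.left_module_axioms\<close>)
      also have "\<dots> = x" using x by (simp add: P.smult_one)
      finally show "x \<in> ?p ` carrier ?F"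
        by (intro image_eqI[where x = ?c] c) (rule sym)
    qed
  qed
  then have "left_module R ?F \<and> left_module R P \<and> ?p \<in> mod_hom R ?F P \<and>
      ?p ` carrier ?F = carrier P \<and> (\<lambda>x. x) \<in> mod_hom R P P"
    by (intro conjI F.left_module_axioms P.left_module_axioms hom mod_hom_ident)
  with assms[unfolded projective_module_def, THEN conjunct2, THEN spec[of _ ?F], THEN spec[of _ P],
      THEN spec[of _ ?p], THEN spec[of _ "\<lambda>x. x"]]
  show ?thesis by (rule mp)
qed

text \<open>Coordinates reduce the lifting problem to a choice of preimages \<open>d x\<close> for
  the basis elements. Therefore \<open>M\<close> and \<open>N\<close> may live in any types, and it
  is enough that the values of \<open>f\<close> lie in the image of \<open>p\<close>.\<close>

lemma projective_lift:
  assumes "projective_module R P" "left_module R M" "left_module R N"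
    and "p \<in> mod_hom R M N" "f \<in> mod_hom R P N"
    and surj: "\<And>x. x \<in> carrier P \<Longrightarrow> f x \<in> p ` carrier M"
  shows "\<exists>g\<in>mod_hom R P M. \<forall>x\<in>carrier P. p (g x) = f x"
proof -
  interpret P: left_module R P by (rule projective_left_module) fact
  let ?e = "\<lambda>x. if x \<in> carrier P then x else \<zero>\<^bsub>P\<^esub>"
  obtain s where s: "s \<in> mod_hom R P (direct_power (regular_module R))"
      and s_eq: "\<forall>x\<in>carrier P. lin_comb R P ?e (s x) = x"
    by (rule bexE[OF projective_coordinates[OF assms(1)]])
  have e: "?e x \<in> carrier P" for x by simp
  have "\<exists>y. y \<in> carrier M \<and> p y = f (?e x)" for x
    using surj[OF e, of x] by (metis imageE)
  then have "\<exists>d. \<forall>x. d x \<in> carrier M \<and> p (d x) = f (?e x)"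
    by (intro choice allI)
  then obtain d where d: "\<And>x. d x \<in> carrier M" "\<And>x. p (d x) = f (?e x)" by blast
  show ?thesis
  proof (intro bexI ballI)
    show "(\<lambda>x. lin_comb R M d (s x)) \<in> mod_hom R P M"
      by (rule mod_hom_comp[OF s]) (rule lin_comb_hom[OF assms(2) d(1)])
  next
    fix x assume x: "x \<in> carrier P"
    have sx: "s x \<in> carrier (direct_power (regular_module R))" by (rule mod_hom_closed[OF s x])
    have "p (lin_comb R M d (s x)) = lin_comb R N (\<lambda>x. f (?e x)) (s x)"
      using mod_hom_lin_comb[OF assms(2-4) d(1) sx] by (simp only: d(2))
    also have "\<dots> = f (lin_comb R P ?e (s x))"
      by (rule mod_hom_lin_comb[OF P.left_module_axioms assms(3,5) e sx, symmetric])
    also have "\<dots> = f x" by (rule arg_cong[OF bspec[OF s_eq x]])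
    finally show "p (lin_comb R M d (s x)) = f x" .
  qed
qed


section \<open>Baer's criterion\<close>

text \<open>Extending \<open>f\<close> to the ring amounts to choosing the value \<open>y\<close> at
  the unit. In this form no test module occurs, so the property does not depend on the types of
  other modules.\<close>

definition baer_injective :: "('a, 'z) ring_scheme \<Rightarrow> ('a, 'm) module \<Rightarrow> bool" where
  "baer_injective R I \<longleftrightarrow>
    left_module R I \<and>
    (\<forall>J f. submodule J R (regular_module R) \<and> f \<in> mod_hom R ((regular_module R)\<lparr>carrier := J\<rparr>) I \<longrightarrow>
      (\<exists>y\<in>carrier I. \<forall>a\<in>J. f a = a \<odot>\<^bsub>I\<^esub> y))"

lemma baer_injective_left_module: "baer_injective R I \<Longrightarrow> left_module R I"
  by (simp add: baer_injective_def)

lemma baer_injectiveD: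
  assumes "baer_injective R I" "submodule J R (regular_module R)"
    and "f \<in> mod_hom R ((regular_module R)\<lparr>carrier := J\<rparr>) I"
  shows "\<exists>y\<in>carrier I. \<forall>a\<in>J. f a = a \<odot>\<^bsub>I\<^esub> y"
  using assms by (simp add: baer_injective_def)

text \<open>The inclusion of a left ideal into the ring lives in the type against which
  \<open>injective_module\<close> tests; the required element is the value of the extension at the
  unit.\<close>

lemma injective_imp_baer_injective:
  fixes R :: "('a, 'z) ring_scheme" and I :: "('a, 'm) module"
  assumes "injective_module R I"
  shows "baer_injective R I"
  unfolding baer_injective_def
proof (intro conjI allI impI)
  show I: "left_module R I" using assms by (simp add: injective_module_def)
  interpret I: left_module R I by (rule I)
  let ?A = "regular_module R"
  fix J f assume "submodule J R ?A \<and> f \<in> mod_hom R (?A\<lparr>carrier := J\<rparr>) I"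
  then have J: "submodule J R ?A" and f: "f \<in> mod_hom R (?A\<lparr>carrier := J\<rparr>) I" by auto
  have A: "left_module R ?A" by (rule left_module_regular) (rule I.R.ring_axioms)
  have "left_module R (?A\<lparr>carrier := J\<rparr>) \<and> left_module R ?A \<and>
    (\<lambda>x. x) \<in> mod_hom R (?A\<lparr>carrier := J\<rparr>) ?A \<and> inj_on (\<lambda>x. x) (carrier (?A\<lparr>carrier := J\<rparr>)) \<and>
    f \<in> mod_hom R (?A\<lparr>carrier := J\<rparr>) I"
    by (intro conjI left_module_submodule A J f mod_hom_on_subset mod_hom_ident submodule_subset[OF J]) simp
  with assms[unfolded injective_module_def, THEN conjunct2, THEN spec[of _ "?A\<lparr>carrier := J\<rparr>"],
      THEN spec[of _ ?A], THEN spec[of _ "\<lambda>x. x"], THEN spec[of _ f]]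
  have "\<exists>g\<in>mod_hom R ?A I. \<forall>x\<in>carrier (?A\<lparr>carrier := J\<rparr>). g x = f x" by (rule mp)
  then obtain g where g: "g \<in> mod_hom R ?A I" "\<forall>x\<in>J. g x = f x" by auto
  have "f a = a \<odot>\<^bsub>I\<^esub> g \<one>\<^bsub>R\<^esub>" if "a \<in> J" for a
  proof -
    have "a \<in> carrier R" using submodule_subset[OF J] that by auto
    then show ?thesis
      using g(2) that mod_hom_smult[OF g(1), of a "\<one>\<^bsub>R\<^esub>"] by simp
  qed
  then show "\<exists>y\<in>carrier I. \<forall>a\<in>J. f a = a \<odot>\<^bsub>I\<^esub> y"
    using mod_hom_closed[OF g(1), of "\<one>\<^bsub>R\<^esub>"] by auto
qed

text \<open>A homomorphism \<open>f\<close> on \<open>J\<close> is controlled by its values on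
  finitely many generators, each of finite support. So all of its values are supported in one finite
  set \<open>T\<close>, and \<open>f\<close> can be extended coordinate by coordinate without
  leaving the direct sum.\<close>

lemma baer_injective_direct_power:
  fixes R :: "('a, 'z) ring_scheme" and I :: "('a, 'm) module"
  assumes "left_noetherian R" "baer_injective R I"
  shows "baer_injective R (direct_power I :: ('a, 'x \<Rightarrow> 'm) module)"
  unfolding baer_injective_def
proof (intro conjI allI impI)
  let ?D = "direct_power I :: ('a, 'x \<Rightarrow> 'm) module"
  let ?A = "regular_module R"
  have I: "left_module R I" by (rule baer_injective_left_module) fact
  interpret I: left_module R I by (rule I)
  have A: "left_module R ?A" by (rule left_module_regular) (rule I.R.ring_axioms)
  interpret A: left_module R ?A by (rule A)
  show D: "left_module R ?D" by (rule left_module_direct_power[OF I])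
  fix J f assume "submodule J R ?A \<and> f \<in> mod_hom R (?A\<lparr>carrier := J\<rparr>) ?D"
  then have J: "submodule J R ?A" and f: "f \<in> mod_hom R (?A\<lparr>carrier := J\<rparr>) ?D" by auto
  note f_add = mod_hom_add[OF f, simplified] and f_smult = mod_hom_smult[OF f, simplified]
  have f_closed: "f a \<in> carrier ?D" if "a \<in> J" for a
    using mod_hom_closed[OF f, of a] that by simp
  then have f_carr: "f a x \<in> carrier I" and f_fin: "finite {x. f a x \<noteq> \<zero>\<^bsub>I\<^esub>}" if "a \<in> J" for a x
    using that by (auto simp: direct_power_carrier)
  have f_zero: "f \<zero>\<^bsub>R\<^esub> = (\<lambda>x. \<zero>\<^bsub>I\<^esub>)"
    using mod_hom_zero[OF left_module_submodule[OF A J] D f] by simp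
  obtain C where C: "finite C" "C \<subseteq> J" "J \<subseteq> module_span R ?A C"
    using assms(1) J by meson
  define T where "T = (\<Union>c\<in>C. {x. f c x \<noteq> \<zero>\<^bsub>I\<^esub>})"
  have T: "finite T" using C f_fin unfolding T_def by blast
  \<comment> \<open>The elements of \<open>J\<close> whose values are supported in \<open>T\<close>
    form a left ideal that contains the generators, hence they are all of \<open>J\<close>.\<close>
  have "submodule {a \<in> J. \<forall>x. x \<notin> T \<longrightarrow> f a x = \<zero>\<^bsub>I\<^esub>} R ?A"
  proof (rule A.left_submoduleI)
    fix a a' assume a: "a \<in> {a \<in> J. \<forall>x. x \<notin> T \<longrightarrow> f a x = \<zero>\<^bsub>I\<^esub>}"
      "a' \<in> {a \<in> J. \<forall>x. x \<notin> T \<longrightarrow> f a x = \<zero>\<^bsub>I\<^esub>}"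
    then have "f (a \<oplus>\<^bsub>R\<^esub> a') = (\<lambda>x. f a x \<oplus>\<^bsub>I\<^esub> f a' x)" by (intro f_add) auto
    with a show "a \<oplus>\<^bsub>?A\<^esub> a' \<in> {a \<in> J. \<forall>x. x \<notin> T \<longrightarrow> f a x = \<zero>\<^bsub>I\<^esub>}"
      using submodule_add[OF J, of a a'] by simp
  next
    fix c a assume a: "c \<in> carrier R" "a \<in> {a \<in> J. \<forall>x. x \<notin> T \<longrightarrow> f a x = \<zero>\<^bsub>I\<^esub>}"
    then have "f (c \<otimes>\<^bsub>R\<^esub> a) = (\<lambda>x. c \<odot>\<^bsub>I\<^esub> f a x)" by (intro f_smult) auto
    with a show "c \<odot>\<^bsub>?A\<^esub> a \<in> {a \<in> J. \<forall>x. x \<notin> T \<longrightarrow> f a x = \<zero>\<^bsub>I\<^esub>}"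
      using submodule_smult[OF J, of c a] by (simp add: I.smult_zero_right)
  qed (use submodule_subset[OF J] submodule_zero[OF J] f_zero in auto)
  moreover have "C \<subseteq> {a \<in> J. \<forall>x. x \<notin> T \<longrightarrow> f a x = \<zero>\<^bsub>I\<^esub>}"
    using C(2) by (auto simp: T_def)
  ultimately have JT: "J \<subseteq> {a \<in> J. \<forall>x. x \<notin> T \<longrightarrow> f a x = \<zero>\<^bsub>I\<^esub>}"
    by (rule order_trans[OF C(3) module_span_minimal])
  have ex_coord: "\<exists>y\<in>carrier I. \<forall>a\<in>J. f a x = a \<odot>\<^bsub>I\<^esub> y" for x
  proof (rule baer_injectiveD[OF assms(2) J])
    show "(\<lambda>a. f a x) \<in> mod_hom R (?A\<lparr>carrier := J\<rparr>) I"
    proof (rule mod_homI)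
      fix a a' assume "a \<in> carrier (?A\<lparr>carrier := J\<rparr>)" "a' \<in> carrier (?A\<lparr>carrier := J\<rparr>)"
      then show "f (a \<oplus>\<^bsub>?A\<lparr>carrier := J\<rparr>\<^esub> a') x = f a x \<oplus>\<^bsub>I\<^esub> f a' x"
        using fun_cong[OF f_add[of a a'], of x] by simp
    next
      fix c a assume "c \<in> carrier R" "a \<in> carrier (?A\<lparr>carrier := J\<rparr>)"
      then show "f (c \<odot>\<^bsub>?A\<lparr>carrier := J\<rparr>\<^esub> a) x = c \<odot>\<^bsub>I\<^esub> f a x"
        using fun_cong[OF f_smult[of c a], of x] by simp
    qed (simp add: f_carr)
  qed
  have "\<exists>y. \<forall>x. y x \<in> carrier I \<and> (\<forall>a\<in>J. f a x = a \<odot>\<^bsub>I\<^esub> y x)"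
    by (intro choice allI) (use ex_coord in blast)
  then obtain y where y: "\<And>x. y x \<in> carrier I" "\<And>x a. a \<in> J \<Longrightarrow> f a x = a \<odot>\<^bsub>I\<^esub> y x" by blast
  \<comment> \<open>The coordinates \<open>y x\<close> are chosen independently and may be nonzero
    infinitely often. Cutting them off outside \<open>T\<close> changes nothing on \<open>J\<close>,
    because \<open>f\<close> vanishes there.\<close>
  let ?z = "\<lambda>x. if x \<in> T then y x else \<zero>\<^bsub>I\<^esub>"
  have "{x. ?z x \<noteq> \<zero>\<^bsub>I\<^esub>} \<subseteq> T" by auto
  then have "?z \<in> carrier ?D"
    using y(1) T by (simp add: direct_power_carrier finite_subset)
  moreover have "f a = a \<odot>\<^bsub>?D\<^esub> ?z" if "a \<in> J" for a
  proof
    fix x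
    have "a \<in> carrier R" using submodule_subset[OF J] that by auto
    show "f a x = (a \<odot>\<^bsub>?D\<^esub> ?z) x"
      using subsetD[OF JT that] y(2)[OF that, of x] \<open>a \<in> carrier R\<close>
      by (auto simp: I.smult_zero_right)
  qed
  ultimately show "\<exists>y\<in>carrier ?D. \<forall>a\<in>J. f a = a \<odot>\<^bsub>?D\<^esub> y" by blast
qed

text \<open>Partially defined homomorphisms are handled as graphs, so that Zorn's lemma applies to inclusion.\<close>

definition partial_hom_graph ::
  "('a, 'z) ring_scheme \<Rightarrow> ('a, 'n) module \<Rightarrow> ('a, 'm) module \<Rightarrow> ('n \<times> 'm) set \<Rightarrow> bool" where
  "partial_hom_graph R N I G \<longleftrightarrow>
    G \<subseteq> carrier N \<times> carrier I \<and>
    (\<forall>x y x' y'. (x, y) \<in> G \<longrightarrow> (x', y') \<in> G \<longrightarrow> (x \<oplus>\<^bsub>N\<^esub> x', y \<oplus>\<^bsub>I\<^esub> y') \<in> G) \<and>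
    (\<forall>a x y. a \<in> carrier R \<longrightarrow> (x, y) \<in> G \<longrightarrow> (a \<odot>\<^bsub>N\<^esub> x, a \<odot>\<^bsub>I\<^esub> y) \<in> G) \<and>
    (\<forall>y. (\<zero>\<^bsub>N\<^esub>, y) \<in> G \<longrightarrow> y = \<zero>\<^bsub>I\<^esub>)"

text \<open>The difference of the two pairs lies in \<open>G\<close> and has first entry zero, so
  the last clause of \<open>partial_hom_graph\<close> forces the second entry to vanish.\<close>

lemma partial_hom_graph_unique:
  assumes "left_module R N" "left_module R I" "partial_hom_graph R N I G" "(x, y) \<in> G" "(x, y') \<in> G"
  shows "y = y'"
proof -
  interpret N: left_module R N by fact
  interpret I: left_module R I by fact
  have carr: "x \<in> carrier N" "y \<in> carrier I" "y' \<in> carrier I"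
    using assms(3-5) by (auto simp: partial_hom_graph_def)
  have "((\<ominus>\<^bsub>R\<^esub> \<one>\<^bsub>R\<^esub>) \<odot>\<^bsub>N\<^esub> x, (\<ominus>\<^bsub>R\<^esub> \<one>\<^bsub>R\<^esub>) \<odot>\<^bsub>I\<^esub> y') \<in> G"
    using assms(3,5) unfolding partial_hom_graph_def by blast
  then have "(\<ominus>\<^bsub>N\<^esub> x, \<ominus>\<^bsub>I\<^esub> y') \<in> G"
    using carr by (simp add: N.smult_uminus_one I.smult_uminus_one)
  then have "(x \<oplus>\<^bsub>N\<^esub> \<ominus>\<^bsub>N\<^esub> x, y \<oplus>\<^bsub>I\<^esub> \<ominus>\<^bsub>I\<^esub> y') \<in> G"
    using assms(3,4) unfolding partial_hom_graph_def by blast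
  then have "y \<ominus>\<^bsub>I\<^esub> y' = \<zero>\<^bsub>I\<^esub>"
    using assms(3) carr unfolding partial_hom_graph_def by (simp add: N.r_neg a_minus_def)
  then show ?thesis using carr by (simp add: I.minus_eq_zero_iff)
qed

text \<open>The scalars that move \<open>b\<close> into the domain of \<open>G\<close> form a left
  ideal \<open>J\<close>, on which \<open>G\<close> induces a homomorphism. Baer's criterion
  represents it by an element \<open>z\<close>, and \<open>z\<close> is the value that can
  consistently be assigned to \<open>b\<close>.\<close>

lemma partial_hom_graph_extend:
  assumes "left_module R N" "baer_injective R I" "partial_hom_graph R N I G" "G \<noteq> {}" "b \<in> carrier N"
  shows "\<exists>G'. partial_hom_graph R N I G' \<and> G \<subseteq> G' \<and> b \<in> Domain G'"
proof -
  have I: "left_module R I" by (rule baer_injective_left_module) fact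
  interpret I: left_module R I by (rule I)
  interpret N: left_module R N by fact
  let ?A = "regular_module R"
  interpret A: left_module R ?A by (rule left_module_regular) (rule I.R.ring_axioms)
  have carr: "x \<in> carrier N" "y \<in> carrier I" if "(x, y) \<in> G" for x y
    using assms(3) that by (auto simp: partial_hom_graph_def)
  have add: "(x \<oplus>\<^bsub>N\<^esub> x', y \<oplus>\<^bsub>I\<^esub> y') \<in> G" if "(x, y) \<in> G" "(x', y') \<in> G" for x y x' y'
    using assms(3) that by (auto simp: partial_hom_graph_def)
  have smult: "(a \<odot>\<^bsub>N\<^esub> x, a \<odot>\<^bsub>I\<^esub> y) \<in> G" if "a \<in> carrier R" "(x, y) \<in> G" for a x y
    using assms(3) that by (auto simp: partial_hom_graph_def)
  have unique: "y = y'" if "(x, y) \<in> G" "(x, y') \<in> G" for x y y'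
    by (rule partial_hom_graph_unique[OF assms(1) I assms(3) that])
  obtain x0 y0 where "(x0, y0) \<in> G" using assms(4) by auto
  from smult[OF I.R.zero_closed this] have zero: "(\<zero>\<^bsub>N\<^esub>, \<zero>\<^bsub>I\<^esub>) \<in> G"
    using carr[OF \<open>(x0, y0) \<in> G\<close>] by (simp add: N.smult_zero_left I.smult_zero_left)
  let ?J = "{a \<in> carrier R. \<exists>y. (a \<odot>\<^bsub>N\<^esub> b, y) \<in> G}"
  define f where "f a = (THE y. (a \<odot>\<^bsub>N\<^esub> b, y) \<in> G)" for a
  have f_eq: "f a = y" if "(a \<odot>\<^bsub>N\<^esub> b, y) \<in> G" for a y
    unfolding f_def using that unique by blast
  have J_add: "((a \<oplus>\<^bsub>R\<^esub> a') \<odot>\<^bsub>N\<^esub> b, y \<oplus>\<^bsub>I\<^esub> y') \<in> G"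
    if "a \<in> carrier R" "a' \<in> carrier R" "(a \<odot>\<^bsub>N\<^esub> b, y) \<in> G" "(a' \<odot>\<^bsub>N\<^esub> b, y') \<in> G" for a a' y y'
    using add[OF that(3,4)] that(1,2) assms(5) by (simp add: N.smult_l_distr)
  have J_smult: "((c \<otimes>\<^bsub>R\<^esub> a) \<odot>\<^bsub>N\<^esub> b, c \<odot>\<^bsub>I\<^esub> y) \<in> G"
    if "a \<in> carrier R" "c \<in> carrier R" "(a \<odot>\<^bsub>N\<^esub> b, y) \<in> G" for a c y
    using smult[OF that(2,3)] that(1,2) assms(5) by (simp add: N.smult_assoc)
  have J: "submodule ?J R ?A"
  proof (rule A.left_submoduleI)
    show "\<zero>\<^bsub>?A\<^esub> \<in> ?J" using zero assms(5) by (auto simp: N.smult_zero_left)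
  next
    fix a a' assume "a \<in> ?J" "a' \<in> ?J"
    then obtain y y' where "a \<in> carrier R" "a' \<in> carrier R" "(a \<odot>\<^bsub>N\<^esub> b, y) \<in> G" "(a' \<odot>\<^bsub>N\<^esub> b, y') \<in> G"
      by auto
    from J_add[OF this] this(1,2) show "a \<oplus>\<^bsub>?A\<^esub> a' \<in> ?J" by auto
  next
    fix c a assume "c \<in> carrier R" "a \<in> ?J"
    then obtain y where "a \<in> carrier R" "c \<in> carrier R" "(a \<odot>\<^bsub>N\<^esub> b, y) \<in> G"
      by auto
    from J_smult[OF this] this(1,2) show "c \<odot>\<^bsub>?A\<^esub> a \<in> ?J" by auto
  qed auto
  have "f \<in> mod_hom R (?A\<lparr>carrier := ?J\<rparr>) I"
  proof (rule mod_homI)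
    fix a assume "a \<in> carrier (?A\<lparr>carrier := ?J\<rparr>)"
    then show "f a \<in> carrier I" using f_eq carr by auto
  next
    fix a a' assume "a \<in> carrier (?A\<lparr>carrier := ?J\<rparr>)" "a' \<in> carrier (?A\<lparr>carrier := ?J\<rparr>)"
    then obtain y y' where "a \<in> carrier R" "a' \<in> carrier R" "(a \<odot>\<^bsub>N\<^esub> b, y) \<in> G" "(a' \<odot>\<^bsub>N\<^esub> b, y') \<in> G"
      by auto
    then show "f (a \<oplus>\<^bsub>?A\<lparr>carrier := ?J\<rparr>\<^esub> a') = f a \<oplus>\<^bsub>I\<^esub> f a'"
      using f_eq J_add by simp
  next
    fix c a assume "c \<in> carrier R" "a \<in> carrier (?A\<lparr>carrier := ?J\<rparr>)"
    then obtain y where "a \<in> carrier R" "c \<in> carrier R" "(a \<odot>\<^bsub>N\<^esub> b, y) \<in> G"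
      by auto
    then show "f (c \<odot>\<^bsub>?A\<lparr>carrier := ?J\<rparr>\<^esub> a) = c \<odot>\<^bsub>I\<^esub> f a"
      using f_eq J_smult by simp
  qed
  from baer_injectiveD[OF assms(2) J this]
  obtain z where z: "z \<in> carrier I" "\<forall>a\<in>?J. f a = a \<odot>\<^bsub>I\<^esub> z" ..
  have value_eq: "y = a \<odot>\<^bsub>I\<^esub> z" if "a \<in> carrier R" "(a \<odot>\<^bsub>N\<^esub> b, y) \<in> G" for a y
    using z(2) that f_eq[OF that(2)] by auto
  let ?G = "{(x \<oplus>\<^bsub>N\<^esub> a \<odot>\<^bsub>N\<^esub> b, y \<oplus>\<^bsub>I\<^esub> a \<odot>\<^bsub>I\<^esub> z) |x y a. (x, y) \<in> G \<and> a \<in> carrier R}"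
  have mem: "(u, v) \<in> ?G"
    if "(x, y) \<in> G" "a \<in> carrier R" "u = x \<oplus>\<^bsub>N\<^esub> a \<odot>\<^bsub>N\<^esub> b" "v = y \<oplus>\<^bsub>I\<^esub> a \<odot>\<^bsub>I\<^esub> z" for u v x y a
    using that by blast
  have "partial_hom_graph R N I ?G"
    unfolding partial_hom_graph_def
  proof (intro conjI allI impI)
    show "?G \<subseteq> carrier N \<times> carrier I"
      using carr assms(5) z(1) by (auto simp: N.smult_closed I.smult_closed)
  next
    fix u v u' v' assume "(u, v) \<in> ?G" "(u', v') \<in> ?G"
    then obtain x y a x' y' a' where *: "(x, y) \<in> G" "a \<in> carrier R" "(x', y') \<in> G" "a' \<in> carrier R"
      and uv: "u = x \<oplus>\<^bsub>N\<^esub> a \<odot>\<^bsub>N\<^esub> b" "v = y \<oplus>\<^bsub>I\<^esub> a \<odot>\<^bsub>I\<^esub> z"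
        "u' = x' \<oplus>\<^bsub>N\<^esub> a' \<odot>\<^bsub>N\<^esub> b" "v' = y' \<oplus>\<^bsub>I\<^esub> a' \<odot>\<^bsub>I\<^esub> z" by blast
    show "(u \<oplus>\<^bsub>N\<^esub> u', v \<oplus>\<^bsub>I\<^esub> v') \<in> ?G"
    proof (rule mem[OF add[OF *(1,3)]])
      show "a \<oplus>\<^bsub>R\<^esub> a' \<in> carrier R" using * by simp
      show "u \<oplus>\<^bsub>N\<^esub> u' = (x \<oplus>\<^bsub>N\<^esub> x') \<oplus>\<^bsub>N\<^esub> (a \<oplus>\<^bsub>R\<^esub> a') \<odot>\<^bsub>N\<^esub> b"
        using * carr[OF *(1)] carr[OF *(3)] assms(5)
        by (simp add: uv N.smult_l_distr N.smult_closed N.a_ac)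
      show "v \<oplus>\<^bsub>I\<^esub> v' = (y \<oplus>\<^bsub>I\<^esub> y') \<oplus>\<^bsub>I\<^esub> (a \<oplus>\<^bsub>R\<^esub> a') \<odot>\<^bsub>I\<^esub> z"
        using * carr[OF *(1)] carr[OF *(3)] z(1)
        by (simp add: uv I.smult_l_distr I.smult_closed I.a_ac)
    qed
  next
    fix c u v assume c: "c \<in> carrier R" and "(u, v) \<in> ?G"
    then obtain x y a where *: "(x, y) \<in> G" "a \<in> carrier R"
      and uv: "u = x \<oplus>\<^bsub>N\<^esub> a \<odot>\<^bsub>N\<^esub> b" "v = y \<oplus>\<^bsub>I\<^esub> a \<odot>\<^bsub>I\<^esub> z" by blast
    show "(c \<odot>\<^bsub>N\<^esub> u, c \<odot>\<^bsub>I\<^esub> v) \<in> ?G"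
    proof (rule mem[OF smult[OF c *(1)]])
      show "c \<otimes>\<^bsub>R\<^esub> a \<in> carrier R" using * c by simp
      show "c \<odot>\<^bsub>N\<^esub> u = c \<odot>\<^bsub>N\<^esub> x \<oplus>\<^bsub>N\<^esub> (c \<otimes>\<^bsub>R\<^esub> a) \<odot>\<^bsub>N\<^esub> b"
        using * c carr[OF *(1)] assms(5)
        by (simp add: uv N.smult_r_distr N.smult_closed N.smult_assoc)
      show "c \<odot>\<^bsub>I\<^esub> v = c \<odot>\<^bsub>I\<^esub> y \<oplus>\<^bsub>I\<^esub> (c \<otimes>\<^bsub>R\<^esub> a) \<odot>\<^bsub>I\<^esub> z"
        using * c carr[OF *(1)] z(1)
        by (simp add: uv I.smult_r_distr I.smult_closed I.smult_assoc)
    qed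
  next
    \<comment> \<open>This is consistency of the extension: the multiple of \<open>b\<close> by
      \<open>a\<close> equals the negative of \<open>x\<close>, so it lies in the domain of
      \<open>G\<close>, and there \<open>G\<close> already takes the value prescribed by
      \<open>z\<close>.\<close>
    fix v assume "(\<zero>\<^bsub>N\<^esub>, v) \<in> ?G"
    then obtain x y a where *: "(x, y) \<in> G" "a \<in> carrier R"
      and uv: "\<zero>\<^bsub>N\<^esub> = x \<oplus>\<^bsub>N\<^esub> a \<odot>\<^bsub>N\<^esub> b" "v = y \<oplus>\<^bsub>I\<^esub> a \<odot>\<^bsub>I\<^esub> z" by blast
    note c = carr[OF *(1)]
    have ab: "a \<odot>\<^bsub>N\<^esub> b \<in> carrier N" using * assms(5) by (simp add: N.smult_closed)
    then have "\<ominus>\<^bsub>N\<^esub> x = a \<odot>\<^bsub>N\<^esub> b"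
      using N.minus_equality[of "a \<odot>\<^bsub>N\<^esub> b" x] uv(1) c by (simp add: N.a_comm)
    moreover have "(\<ominus>\<^bsub>N\<^esub> x, \<ominus>\<^bsub>I\<^esub> y) \<in> G"
      using smult[OF _ *(1), of "\<ominus>\<^bsub>R\<^esub> \<one>\<^bsub>R\<^esub>"] c by (simp add: N.smult_uminus_one I.smult_uminus_one)
    ultimately have "\<ominus>\<^bsub>I\<^esub> y = a \<odot>\<^bsub>I\<^esub> z"
      using value_eq * by simp
    then show "v = \<zero>\<^bsub>I\<^esub>" using uv(2) c by (metis I.r_neg)
  qed
  moreover have "G \<subseteq> ?G"
  proof
    fix p assume "p \<in> G"
    then obtain x y where p: "p = (x, y)" "(x, y) \<in> G" by (cases p) auto
    show "p \<in> ?G"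
      unfolding p(1) by (rule mem[OF p(2) I.R.zero_closed])
        (use carr[OF p(2)] assms(5) z(1) in \<open>simp_all add: N.smult_zero_left I.smult_zero_left\<close>)
  qed
  moreover have "(b, z) \<in> ?G"
    by (rule mem[OF zero I.R.one_closed]) (use assms(5) z(1) in \<open>simp_all add: N.smult_one I.smult_one\<close>)
  ultimately show ?thesis by blast
qed

text \<open>Each clause of \<open>partial_hom_graph\<close> involves at most two given pairs, and
  two pairs from the union of a chain lie in a common member.\<close>

lemma partial_hom_graph_Union:
  assumes "subset.chain {G. partial_hom_graph R N I G \<and> G0 \<subseteq> G} C" "C \<noteq> {}"
  shows "partial_hom_graph R N I (\<Union>C) \<and> G0 \<subseteq> \<Union>C"
proof -
  have C: "partial_hom_graph R N I G" "G0 \<subseteq> G" if "G \<in> C" for G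
    using assms(1) that by (auto simp: subset_chain_def)
  have chain: "G \<subseteq> G' \<or> G' \<subseteq> G" if "G \<in> C" "G' \<in> C" for G G'
    using assms(1) that by (auto simp: subset_chain_def)
  have "partial_hom_graph R N I (\<Union>C)"
    unfolding partial_hom_graph_def
  proof (intro conjI allI impI)
    show "\<Union>C \<subseteq> carrier N \<times> carrier I"
      using C(1) unfolding partial_hom_graph_def by blast
  next
    fix x y x' y' assume "(x, y) \<in> \<Union>C" "(x', y') \<in> \<Union>C"
    then obtain G where "G \<in> C" "(x, y) \<in> G" "(x', y') \<in> G" using chain by blast
    then show "(x \<oplus>\<^bsub>N\<^esub> x', y \<oplus>\<^bsub>I\<^esub> y') \<in> \<Union>C"
      using C(1) unfolding partial_hom_graph_def by blast
  next
    fix a x y assume "a \<in> carrier R" "(x, y) \<in> \<Union>C"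
    then show "(a \<odot>\<^bsub>N\<^esub> x, a \<odot>\<^bsub>I\<^esub> y) \<in> \<Union>C"
      using C(1) unfolding partial_hom_graph_def by blast
  next
    fix y assume "(\<zero>\<^bsub>N\<^esub>, y) \<in> \<Union>C"
    then show "y = \<zero>\<^bsub>I\<^esub>"
      using C(1) unfolding partial_hom_graph_def by blast
  qed
  then show ?thesis using C(2) assms(2) by blast
qed

text \<open>Zorn's lemma yields a maximal graph containing that of \<open>f\<close>. The types of
  \<open>N\<close> and \<open>I\<close> are unrelated to the type of ring elements, which is what
  the later uses with resolutions and direct sums require.\<close>

lemma baer_injective_extend:
  assumes "baer_injective R I" "left_module R N" "submodule H R N"
    and f: "f \<in> mod_hom R (N\<lparr>carrier := H\<rparr>) I"
  shows "\<exists>g\<in>mod_hom R N I. \<forall>x\<in>H. g x = f x"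
proof -
  have I: "left_module R I" by (rule baer_injective_left_module) fact
  interpret I: left_module R I by (rule I)
  interpret N: left_module R N by fact
  let ?G0 = "(\<lambda>x. (x, f x)) ` H"
  let ?P = "{G. partial_hom_graph R N I G \<and> ?G0 \<subseteq> G}"
  have f0: "f \<zero>\<^bsub>N\<^esub> = \<zero>\<^bsub>I\<^esub>"
    using mod_hom_zero[OF left_module_submodule[OF assms(2,3)] I f] by simp
  have "partial_hom_graph R N I ?G0"
    unfolding partial_hom_graph_def
  proof (intro conjI allI impI)
    show "?G0 \<subseteq> carrier N \<times> carrier I"
      using submodule_subset[OF assms(3)] mod_hom_closed[OF f] by auto
  next
    fix x y x' y' assume "(x, y) \<in> ?G0" "(x', y') \<in> ?G0"
    then have "x \<in> H" "x' \<in> H" "y = f x" "y' = f x'" by auto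
    then show "(x \<oplus>\<^bsub>N\<^esub> x', y \<oplus>\<^bsub>I\<^esub> y') \<in> ?G0"
      using submodule_add[OF assms(3), of x x'] mod_hom_add[OF f, of x x'] by (simp add: image_iff)
  next
    fix a x y assume "a \<in> carrier R" "(x, y) \<in> ?G0"
    then have "a \<in> carrier R" "x \<in> H" "y = f x" by auto
    then show "(a \<odot>\<^bsub>N\<^esub> x, a \<odot>\<^bsub>I\<^esub> y) \<in> ?G0"
      using submodule_smult[OF assms(3), of a x] mod_hom_smult[OF f, of a x] by (simp add: image_iff)
  next
    fix y assume "(\<zero>\<^bsub>N\<^esub>, y) \<in> ?G0"
    then show "y = \<zero>\<^bsub>I\<^esub>" using f0 by auto
  qed
  define P where "P = ?P"
  have "P \<noteq> {}" using \<open>partial_hom_graph R N I ?G0\<close> unfolding P_def by blast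
  then have "\<exists>M\<in>P. \<forall>G\<in>P. M \<subseteq> G \<longrightarrow> G = M"
  proof (rule subset_Zorn_nonempty)
    fix C assume "C \<noteq> {}" "subset.chain P C"
    then show "\<Union>C \<in> P"
      unfolding P_def using partial_hom_graph_Union[of R N I ?G0 C] by (intro CollectI)
  qed
  then obtain M where M: "M \<in> P" and max_P: "\<forall>G\<in>P. M \<subseteq> G \<longrightarrow> G = M" by blast
  from M max_P have M: "partial_hom_graph R N I M" "?G0 \<subseteq> M"
    and max: "\<And>G. \<lbrakk>partial_hom_graph R N I G; ?G0 \<subseteq> G; M \<subseteq> G\<rbrakk> \<Longrightarrow> G = M"
    unfolding P_def by blast+
  have M_add: "(x \<oplus>\<^bsub>N\<^esub> x', y \<oplus>\<^bsub>I\<^esub> y') \<in> M" if "(x, y) \<in> M" "(x', y') \<in> M" for x y x' y'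
    using M(1) that unfolding partial_hom_graph_def by blast
  have M_smult: "(a \<odot>\<^bsub>N\<^esub> x, a \<odot>\<^bsub>I\<^esub> y) \<in> M" if "a \<in> carrier R" "(x, y) \<in> M" for a x y
    using M(1) that unfolding partial_hom_graph_def by blast
  have "M \<noteq> {}" using M(2) submodule_zero[OF assms(3)] by blast
  \<comment> \<open>A graph whose domain missed \<open>x\<close> could be enlarged by the one-step
    extension, contrary to maximality.\<close>
  have total: "\<exists>y. (x, y) \<in> M" if x: "x \<in> carrier N" for x
  proof -
    obtain G where G: "partial_hom_graph R N I G" "M \<subseteq> G" "x \<in> Domain G"
      using partial_hom_graph_extend[OF assms(2,1) M(1) \<open>M \<noteq> {}\<close> x] by blast
    then have "G = M" using max M(2) by blast
    then show ?thesis using G(3) by blast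
  qed
  define g where "g x = (THE y. (x, y) \<in> M)" for x
  have g_eq: "g x = y" if "(x, y) \<in> M" for x y
    unfolding g_def using that partial_hom_graph_unique[OF assms(2) I M(1)] by blast
  have g_mem: "(x, g x) \<in> M" if "x \<in> carrier N" for x
    using total[OF that] g_eq by auto
  have "g \<in> mod_hom R N I"
  proof (rule mod_homI)
    fix x assume "x \<in> carrier N"
    then show "g x \<in> carrier I" using g_mem M(1) unfolding partial_hom_graph_def by blast
  next
    fix x y assume "x \<in> carrier N" "y \<in> carrier N"
    then show "g (x \<oplus>\<^bsub>N\<^esub> y) = g x \<oplus>\<^bsub>I\<^esub> g y"
      using M_add[OF g_mem g_mem] by (intro g_eq)
  next
    fix a x assume "a \<in> carrier R" "x \<in> carrier N"
    then show "g (a \<odot>\<^bsub>N\<^esub> x) = a \<odot>\<^bsub>I\<^esub> g x"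
      using M_smult[OF _ g_mem] by (intro g_eq)
  qed
  moreover have "\<forall>x\<in>H. g x = f x" using M(2) g_eq by auto
  ultimately show ?thesis by blast
qed


section \<open>Vanishing of Ext into projective modules\<close>

lemma resolution_projective: "projective_resolution R S U \<Longrightarrow> projective_module R (obj S j)"
  by (simp add: projective_resolution_def)

lemma resolution_left_module: "projective_resolution R S U \<Longrightarrow> left_module R (obj S j)"
  by (simp add: projective_resolution_def projective_module_def)

lemma resolution_bd_hom: "projective_resolution R S U \<Longrightarrow> bd S j \<in> mod_hom R (obj S (Suc j)) (obj S j)"
  by (simp add: projective_resolution_def)

lemma resolution_aug_hom: "projective_resolution R S U \<Longrightarrow> aug S \<in> mod_hom R (obj S 0) U"
  by (simp add: projective_resolution_def)

lemma resolution_aug_surj: "projective_resolution R S U \<Longrightarrow> aug S ` carrier (obj S 0) = carrier U"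
  by (simp add: projective_resolution_def)

lemma resolution_exact:
  "projective_resolution R S U \<Longrightarrow>
    bd S (Suc j) ` carrier (obj S (Suc (Suc j))) = a_kernel (obj S (Suc j)) (obj S j) (bd S j)"
  by (simp add: projective_resolution_def)

lemma resolution_aug_exact:
  "projective_resolution R S U \<Longrightarrow> bd S 0 ` carrier (obj S (Suc 0)) = a_kernel (obj S 0) U (aug S)"
  by (simp add: projective_resolution_def)

lemma resolution_bd_closed:
  "\<lbrakk>projective_resolution R S U; x \<in> carrier (obj S (Suc j))\<rbrakk> \<Longrightarrow> bd S j x \<in> carrier (obj S j)"
  by (rule mod_hom_closed[OF resolution_bd_hom])

lemma resolution_bd_bd:
  assumes "projective_resolution R S U" "x \<in> carrier (obj S (Suc (Suc j)))"
  shows "bd S j (bd S (Suc j) x) = \<zero>\<^bsub>obj S j\<^esub>"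
proof -
  have "bd S (Suc j) x \<in> a_kernel (obj S (Suc j)) (obj S j) (bd S j)"
    unfolding resolution_exact[OF assms(1), symmetric] using assms(2) by (rule imageI)
  then show ?thesis by (simp add: a_kernel_iff)
qed

lemma resolution_aug_bd:
  assumes "projective_resolution R S U" "x \<in> carrier (obj S (Suc 0))"
  shows "aug S (bd S 0 x) = \<zero>\<^bsub>U\<^esub>"
proof -
  have "bd S 0 x \<in> a_kernel (obj S 0) U (aug S)"
    unfolding resolution_aug_exact[OF assms(1), symmetric] using assms(2) by (rule imageI)
  then show ?thesis by (simp add: a_kernel_iff)
qed

text \<open>\<open>Ext\<^bsup>m+1\<^esup>(U, V) = 0\<close> for the module \<open>U\<close> resolved by \<open>S\<close>.\<close>

definition ext_vanishes ::
  "('a, 'z) ring_scheme \<Rightarrow> ('a, 'x, 'u) aug_complex \<Rightarrow> nat \<Rightarrow> ('a, 'v) module \<Rightarrow> bool" where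
  "ext_vanishes R S m V \<longleftrightarrow>
    (\<forall>f\<in>mod_hom R (obj S (Suc m)) V.
      (\<forall>x\<in>carrier (obj S (Suc (Suc m))). f (bd S (Suc m) x) = \<zero>\<^bsub>V\<^esub>) \<longrightarrow>
      (\<exists>g\<in>mod_hom R (obj S m) V. \<forall>x\<in>carrier (obj S (Suc m)). f x = g (bd S m x)))"

lemma ext_vanishesI:
  assumes "\<And>f. \<lbrakk>f \<in> mod_hom R (obj S (Suc m)) V;
      \<And>x. x \<in> carrier (obj S (Suc (Suc m))) \<Longrightarrow> f (bd S (Suc m) x) = \<zero>\<^bsub>V\<^esub>\<rbrakk> \<Longrightarrow>
      \<exists>g\<in>mod_hom R (obj S m) V. \<forall>x\<in>carrier (obj S (Suc m)). f x = g (bd S m x)"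
  shows "ext_vanishes R S m V"
  using assms by (simp add: ext_vanishes_def)

lemma ext_vanishesD:
  assumes "ext_vanishes R S m V" "f \<in> mod_hom R (obj S (Suc m)) V"
    and "\<And>x. x \<in> carrier (obj S (Suc (Suc m))) \<Longrightarrow> f (bd S (Suc m) x) = \<zero>\<^bsub>V\<^esub>"
  shows "\<exists>g\<in>mod_hom R (obj S m) V. \<forall>x\<in>carrier (obj S (Suc m)). f x = g (bd S m x)"
  using assms by (simp add: ext_vanishes_def)

section \<open>Vanishing for injective modules and dimension shifting\<close>

lemma mod_hom_factor:
  assumes "left_module R M" "left_module R N" "left_module R I"
    and p: "p \<in> mod_hom R M N" and f: "f \<in> mod_hom R M I"
    and ker: "\<And>x. \<lbrakk>x \<in> carrier M; p x = \<zero>\<^bsub>N\<^esub>\<rbrakk> \<Longrightarrow> f x = \<zero>\<^bsub>I\<^esub>"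
  shows "\<exists>h\<in>mod_hom R (N\<lparr>carrier := p ` carrier M\<rparr>) I. \<forall>x\<in>carrier M. h (p x) = f x"
proof -
  interpret M: left_module R M by fact
  interpret N: left_module R N by fact
  interpret I: left_module R I by fact
  \<comment> \<open>An arbitrary set-theoretic section of \<open>p\<close> serves: two preimages
    differ by an element of the kernel of \<open>p\<close>, on which \<open>f\<close>
    vanishes.\<close>
  define h where "h z = f (inv_into (carrier M) p z)" for z
  have eq: "h (p x) = f x" if x: "x \<in> carrier M" for x
  proof -
    let ?y = "inv_into (carrier M) p (p x)"
    have y: "?y \<in> carrier M" "p ?y = p x"
      using x by (auto intro: inv_into_into f_inv_into_f)
    then have "p (?y \<ominus>\<^bsub>M\<^esub> x) = \<zero>\<^bsub>N\<^esub>"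
      using x mod_hom_closed[OF p x] mod_hom_minus[OF assms(1,2) p] by (simp add: N.minus_eq_zero_iff)
    then have "f ?y \<ominus>\<^bsub>I\<^esub> f x = \<zero>\<^bsub>I\<^esub>"
      using ker[of "?y \<ominus>\<^bsub>M\<^esub> x"] x y(1) mod_hom_minus[OF assms(1,3) f] by simp
    then show ?thesis
      using mod_hom_closed[OF f] x y(1) by (simp add: h_def I.minus_eq_zero_iff)
  qed
  have "h \<in> mod_hom R (N\<lparr>carrier := p ` carrier M\<rparr>) I"
  proof (rule mod_homI)
    fix z assume "z \<in> carrier (N\<lparr>carrier := p ` carrier M\<rparr>)"
    then show "h z \<in> carrier I" using eq mod_hom_closed[OF f] by auto
  next
    fix z w assume "z \<in> carrier (N\<lparr>carrier := p ` carrier M\<rparr>)" "w \<in> carrier (N\<lparr>carrier := p ` carrier M\<rparr>)"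
    then obtain x y where xy: "x \<in> carrier M" "y \<in> carrier M" "z = p x" "w = p y" by auto
    then have "z \<oplus>\<^bsub>N\<^esub> w = p (x \<oplus>\<^bsub>M\<^esub> y)" by (simp add: mod_hom_add[OF p])
    then show "h (z \<oplus>\<^bsub>N\<lparr>carrier := p ` carrier M\<rparr>\<^esub> w) = h z \<oplus>\<^bsub>I\<^esub> h w"
      using xy by (simp add: eq mod_hom_add[OF f])
  next
    fix a z assume "a \<in> carrier R" "z \<in> carrier (N\<lparr>carrier := p ` carrier M\<rparr>)"
    then obtain x where x: "a \<in> carrier R" "x \<in> carrier M" "z = p x" by auto
    then have "a \<odot>\<^bsub>N\<^esub> z = p (a \<odot>\<^bsub>M\<^esub> x)" by (simp add: mod_hom_smult[OF p])
    then show "h (a \<odot>\<^bsub>N\<lparr>carrier := p ` carrier M\<rparr>\<^esub> z) = a \<odot>\<^bsub>I\<^esub> h z"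
      using x by (simp add: eq mod_hom_smult[OF f] M.smult_closed)
  qed
  then show ?thesis using eq by blast
qed

text \<open>By exactness a cocycle vanishes on the kernel of \<open>bd S m\<close>, hence factors
  through the image of \<open>bd S m\<close>. That image is a submodule of \<open>obj S m\<close>,
  and injectivity extends the factor to the whole term.\<close>

lemma ext_vanishes_injective:
  assumes S: "projective_resolution R S U" and "baer_injective R I"
  shows "ext_vanishes R S m I"
proof (rule ext_vanishesI)
  fix f assume f: "f \<in> mod_hom R (obj S (Suc m)) I"
    and cocycle: "\<And>x. x \<in> carrier (obj S (Suc (Suc m))) \<Longrightarrow> f (bd S (Suc m) x) = \<zero>\<^bsub>I\<^esub>"
  let ?H = "bd S m ` carrier (obj S (Suc m))"
  note L = resolution_left_module[OF S]
  have "f x = \<zero>\<^bsub>I\<^esub>" if "x \<in> carrier (obj S (Suc m))" "bd S m x = \<zero>\<^bsub>obj S m\<^esub>" for x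
  proof -
    have "x \<in> bd S (Suc m) ` carrier (obj S (Suc (Suc m)))"
      using that by (simp add: resolution_exact[OF S] a_kernel_iff)
    then show ?thesis using cocycle by auto
  qed
  then obtain h where h: "h \<in> mod_hom R ((obj S m)\<lparr>carrier := ?H\<rparr>) I"
      "\<forall>x\<in>carrier (obj S (Suc m)). h (bd S m x) = f x"
    using mod_hom_factor[OF L L baer_injective_left_module[OF assms(2)] resolution_bd_hom[OF S] f] by blast
  have "submodule ?H R (obj S m)"
    by (rule mod_hom_image_submodule[OF L L resolution_bd_hom[OF S]])
  from baer_injective_extend[OF assms(2) L this h(1)]
  obtain g where "g \<in> mod_hom R (obj S m) I" "\<forall>x\<in>?H. g x = h x" by blast
  then show "\<exists>g\<in>mod_hom R (obj S m) I. \<forall>x\<in>carrier (obj S (Suc m)). f x = g (bd S m x)"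
    using h(2) by (intro bexI[of _ g]) auto
qed

text \<open>For a short exact sequence from \<open>C\<close> through \<open>E\<close> to
  \<open>D\<close> with \<open>E\<close> injective, vanishing for \<open>D\<close> passes to
  \<open>C\<close> one degree higher. The cocycle becomes the coboundary of some \<open>h\<close>
  with values in \<open>E\<close>, and \<open>\<delta>\<close> after \<open>h\<close> is a cocycle
  with values in \<open>D\<close>.\<close>

lemma ext_vanishes_dimension_shift:
  assumes S: "projective_resolution R S U" and E: "baer_injective R E"
    and C: "left_module R C" and D: "left_module R D"
    and \<iota>: "\<iota> \<in> mod_hom R C E" "inj_on \<iota> (carrier C)"
    and \<delta>: "\<delta> \<in> mod_hom R E D" "\<delta> ` carrier E = carrier D"
    and exact: "\<iota> ` carrier C = a_kernel E D \<delta>"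
    and vanish: "ext_vanishes R S m D"
  shows "ext_vanishes R S (Suc m) C"
proof (rule ext_vanishesI)
  have LE: "left_module R E" by (rule baer_injective_left_module[OF E])
  interpret C: left_module R C by (rule C)
  interpret D: left_module R D by (rule D)
  interpret E: left_module R E by (rule LE)
  note L = resolution_left_module[OF S] and bd = resolution_bd_hom[OF S]
  note bd_closed = resolution_bd_closed[OF S]
  fix f assume f: "f \<in> mod_hom R (obj S (Suc (Suc m))) C"
    and cocycle: "\<And>x. x \<in> carrier (obj S (Suc (Suc (Suc m)))) \<Longrightarrow> f (bd S (Suc (Suc m)) x) = \<zero>\<^bsub>C\<^esub>"
  have "\<iota> (f (bd S (Suc (Suc m)) x)) = \<zero>\<^bsub>E\<^esub>" if "x \<in> carrier (obj S (Suc (Suc (Suc m))))" for x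
    using cocycle[OF that] mod_hom_zero[OF C LE \<iota>(1)] by simp
  from ext_vanishesD[OF ext_vanishes_injective[OF S E] mod_hom_comp[OF f \<iota>(1)] this]
  obtain h where h: "h \<in> mod_hom R (obj S (Suc m)) E"
      "\<forall>x\<in>carrier (obj S (Suc (Suc m))). \<iota> (f x) = h (bd S (Suc m) x)" by blast
  have "\<delta> (h (bd S (Suc m) x)) = \<zero>\<^bsub>D\<^esub>" if "x \<in> carrier (obj S (Suc (Suc m)))" for x
  proof -
    have "\<iota> (f x) \<in> a_kernel E D \<delta>" using exact mod_hom_closed[OF f that] by blast
    then show ?thesis using h(2) that by (simp add: a_kernel_iff)
  qed
  from ext_vanishesD[OF vanish mod_hom_comp[OF h(1) \<delta>(1)] this]
  obtain g where g: "g \<in> mod_hom R (obj S m) D"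
      "\<forall>x\<in>carrier (obj S (Suc m)). \<delta> (h x) = g (bd S m x)" by blast
  have "g x \<in> \<delta> ` carrier E" if "x \<in> carrier (obj S m)" for x
    unfolding \<delta>(2) by (rule mod_hom_closed[OF g(1) that])
  from projective_lift[OF resolution_projective[OF S] LE D \<delta>(1) g(1) this]
  obtain u where u: "u \<in> mod_hom R (obj S m) E" "\<And>x. x \<in> carrier (obj S m) \<Longrightarrow> \<delta> (u x) = g x"
    by blast
  \<comment> \<open>Here \<open>u\<close> lifts \<open>g\<close> through \<open>\<delta>\<close>.
    The correction by \<open>u\<close> after the boundary is invisible on boundaries, but moves the
    values of \<open>h\<close> into the kernel of \<open>\<delta>\<close>.\<close>
  let ?k = "\<lambda>x. h x \<ominus>\<^bsub>E\<^esub> u (bd S m x)"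
  have k: "?k \<in> mod_hom R (obj S (Suc m)) E"
    by (rule mod_hom_minus_map[OF LE h(1) mod_hom_comp[OF bd u(1)]])
  have "?k x \<in> \<iota> ` carrier C" if "x \<in> carrier (obj S (Suc m))" for x
  proof -
    have hx: "h x \<in> carrier E" and ux: "u (bd S m x) \<in> carrier E"
      by (rule mod_hom_closed[OF h(1) that], rule mod_hom_closed[OF u(1) bd_closed[OF that]])
    then have "\<delta> (?k x) = \<delta> (h x) \<ominus>\<^bsub>D\<^esub> \<delta> (u (bd S m x))"
      by (rule mod_hom_minus[OF LE D \<delta>(1)])
    also have "\<dots> = \<zero>\<^bsub>D\<^esub>"
      using g(2) u(2)[OF bd_closed[OF that]] that hx mod_hom_closed[OF \<delta>(1) hx] by (simp add: D.minus_eq_zero_iff)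
    finally show ?thesis using hx ux by (simp add: exact a_kernel_iff)
  qed
  \<comment> \<open>Although \<open>\<iota>\<close> is injective, projectivity is used to pull the
    map back along it; this yields a homomorphism without constructing an inverse of
    \<open>\<iota>\<close>.\<close>
  from projective_lift[OF resolution_projective[OF S] C LE \<iota>(1) k this]
  obtain k where k': "k \<in> mod_hom R (obj S (Suc m)) C" "\<And>x. x \<in> carrier (obj S (Suc m)) \<Longrightarrow> \<iota> (k x) = ?k x"
    by blast
  have "f x = k (bd S (Suc m) x)" if x: "x \<in> carrier (obj S (Suc (Suc m)))" for x
  proof -
    have hx: "h (bd S (Suc m) x) \<in> carrier E" by (rule mod_hom_closed[OF h(1) bd_closed[OF x]])
    have "\<iota> (k (bd S (Suc m) x)) = h (bd S (Suc m) x) \<ominus>\<^bsub>E\<^esub> u \<zero>\<^bsub>obj S m\<^esub>"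
      using k'(2)[OF bd_closed[OF x]] resolution_bd_bd[OF S x] by simp
    also have "\<dots> = h (bd S (Suc m) x)"
      using hx mod_hom_zero[OF L LE u(1)] by (simp add: a_minus_def)
    also have "\<dots> = \<iota> (f x)" using h(2) x by simp
    finally show ?thesis
      using inj_onD[OF \<iota>(2)] mod_hom_closed[OF f x] mod_hom_closed[OF k'(1) bd_closed[OF x]] by metis
  qed
  then show "\<exists>g\<in>mod_hom R (obj S (Suc m)) C. \<forall>x\<in>carrier (obj S (Suc (Suc m))). f x = g (bd S (Suc m) x)"
    using k'(1) by blast
qed

text \<open>The inverse of \<open>\<iota>\<close> is replaced by lifting along
  \<open>\<iota>\<close> from the projective terms of \<open>S\<close>.\<close>

lemma ext_vanishes_iso:
  assumes S: "projective_resolution R S U" and V: "left_module R V" and W: "left_module R W"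
    and \<iota>: "\<iota> \<in> mod_hom R V W" "inj_on \<iota> (carrier V)" "\<iota> ` carrier V = carrier W"
    and vanish: "ext_vanishes R S m W"
  shows "ext_vanishes R S m V"
proof (rule ext_vanishesI)
  fix f assume f: "f \<in> mod_hom R (obj S (Suc m)) V"
    and cocycle: "\<And>x. x \<in> carrier (obj S (Suc (Suc m))) \<Longrightarrow> f (bd S (Suc m) x) = \<zero>\<^bsub>V\<^esub>"
  have "\<iota> (f (bd S (Suc m) x)) = \<zero>\<^bsub>W\<^esub>" if "x \<in> carrier (obj S (Suc (Suc m)))" for x
    using cocycle[OF that] mod_hom_zero[OF V W \<iota>(1)] by simp
  from ext_vanishesD[OF vanish mod_hom_comp[OF f \<iota>(1)] this]
  obtain g where g: "g \<in> mod_hom R (obj S m) W"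
      "\<forall>x\<in>carrier (obj S (Suc m)). \<iota> (f x) = g (bd S m x)" by blast
  have "g x \<in> \<iota> ` carrier V" if "x \<in> carrier (obj S m)" for x
    unfolding \<iota>(3) by (rule mod_hom_closed[OF g(1) that])
  from projective_lift[OF resolution_projective[OF S] V W \<iota>(1) g(1) this]
  obtain k where k: "k \<in> mod_hom R (obj S m) V" "\<And>x. x \<in> carrier (obj S m) \<Longrightarrow> \<iota> (k x) = g x"
    by blast
  have "f x = k (bd S m x)" if x: "x \<in> carrier (obj S (Suc m))" for x
  proof (rule inj_onD[OF \<iota>(2)])
    show "\<iota> (f x) = \<iota> (k (bd S m x))"
      using g(2) x k(2)[OF resolution_bd_closed[OF S x]] by simp
  qed (use mod_hom_closed[OF f x] mod_hom_closed[OF k(1) resolution_bd_closed[OF S x]] in auto)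
  then show "\<exists>g\<in>mod_hom R (obj S m) V. \<forall>x\<in>carrier (obj S (Suc m)). f x = g (bd S m x)"
    using k(1) by blast
qed

text \<open>The cocycle is carried into \<open>F\<close> by \<open>s\<close>, bounded there, and the
  bounding map is carried back by \<open>p\<close>.\<close>

lemma ext_vanishes_retract:
  assumes S: "projective_resolution R S U" and Q: "left_module R Q" and F: "left_module R F"
    and s: "s \<in> mod_hom R Q F" and p: "p \<in> mod_hom R F Q"
    and ps: "\<And>x. x \<in> carrier Q \<Longrightarrow> p (s x) = x"
    and vanish: "ext_vanishes R S m F"
  shows "ext_vanishes R S m Q"
proof (rule ext_vanishesI)
  fix f assume f: "f \<in> mod_hom R (obj S (Suc m)) Q"
    and cocycle: "\<And>x. x \<in> carrier (obj S (Suc (Suc m))) \<Longrightarrow> f (bd S (Suc m) x) = \<zero>\<^bsub>Q\<^esub>"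
  have "s (f (bd S (Suc m) x)) = \<zero>\<^bsub>F\<^esub>" if "x \<in> carrier (obj S (Suc (Suc m)))" for x
    using cocycle[OF that] mod_hom_zero[OF Q F s] by simp
  from ext_vanishesD[OF vanish mod_hom_comp[OF f s] this]
  obtain g where g: "g \<in> mod_hom R (obj S m) F"
      "\<forall>x\<in>carrier (obj S (Suc m)). s (f x) = g (bd S m x)" by blast
  have "f x = p (g (bd S m x))" if x: "x \<in> carrier (obj S (Suc m))" for x
    using bspec[OF g(2) x] ps[OF mod_hom_closed[OF f x]] by simp
  then show "\<exists>g\<in>mod_hom R (obj S m) Q. \<forall>x\<in>carrier (obj S (Suc m)). f x = g (bd S m x)"
    using mod_hom_comp[OF g(1) p] by (intro bexI[of _ "\<lambda>x. p (g x)"]) simp_all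
qed

section \<open>Direct sums of copies of an injective resolution\<close>

lemma direct_power_map_image:
  assumes "left_module R M" "left_module R N" "h \<in> mod_hom R M N"
  shows "(\<lambda>f x. h (f x)) ` carrier (direct_power M) =
    {f \<in> carrier (direct_power N). \<forall>x. f x \<in> h ` carrier M}"
proof
  show "(\<lambda>f x. h (f x)) ` carrier (direct_power M) \<subseteq> {f \<in> carrier (direct_power N). \<forall>x. f x \<in> h ` carrier M}"
  proof
    fix f' assume "f' \<in> (\<lambda>f x. h (f x)) ` carrier (direct_power M)"
    then obtain f where f: "f \<in> carrier (direct_power M)" "f' = (\<lambda>x. h (f x))" by auto
    then show "f' \<in> {f \<in> carrier (direct_power N). \<forall>x. f x \<in> h ` carrier M}"
      using mod_hom_closed[OF direct_power_map_hom[OF assms] f(1)] by (simp add: direct_power_carrier)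
  qed
next
  interpret M: left_module R M by fact
  show "{f \<in> carrier (direct_power N). \<forall>x. f x \<in> h ` carrier M} \<subseteq> (\<lambda>f x. h (f x)) ` carrier (direct_power M)"
  proof
    fix f assume "f \<in> {f \<in> carrier (direct_power N). \<forall>x. f x \<in> h ` carrier M}"
    then have f: "f \<in> carrier (direct_power N)" "\<And>x. f x \<in> h ` carrier M" by auto
    \<comment> \<open>Vanishing coordinates are lifted to zero explicitly, since an arbitrary choice
      of preimages could destroy finite support.\<close>
    let ?g = "\<lambda>x. if f x = \<zero>\<^bsub>N\<^esub> then \<zero>\<^bsub>M\<^esub> else inv_into (carrier M) h (f x)"
    have "{x. ?g x \<noteq> \<zero>\<^bsub>M\<^esub>} \<subseteq> {x. f x \<noteq> \<zero>\<^bsub>N\<^esub>}" by auto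
    moreover have "finite {x. f x \<noteq> \<zero>\<^bsub>N\<^esub>}" using f(1) by (simp add: direct_power_carrier)
    ultimately have "?g \<in> carrier (direct_power M)"
      using f(2) unfolding direct_power_carrier by (auto intro: inv_into_into finite_subset)
    moreover have "f = (\<lambda>x. h (?g x))"
      using mod_hom_zero[OF assms] f(2) by (auto simp: fun_eq_iff f_inv_into_f)
    ultimately show "f \<in> (\<lambda>f x. h (f x)) ` carrier (direct_power M)"
      by - (rule rev_image_eqI)
  qed
qed

text \<open>The kernels \<open>C j\<close> cut the injective resolution of the ring into short exact
  sequences. Taking direct sums of copies keeps these exact and, by Noetherianity, keeps their
  middle terms injective. Dimension shifting then runs from the injective end of the resolution down
  to a free module, of which \<open>Q\<close> is a retract.\<close>

theorem (in fin_dim_algebra) ext_vanishes_projective: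
  fixes S :: "('a, 'x, 'u) aug_complex" and Q :: "('a, 'q) module"
  assumes S: "projective_resolution A S U" and Q: "projective_module A Q"
    and id: "injective_dimension_le A (regular_module A) d" and "d \<le> m"
  shows "ext_vanishes A S m Q"
proof -
  obtain I :: "nat \<Rightarrow> ('a, nat \<Rightarrow> 'a set) module" and \<delta> \<eta>
    where res: "injective_resolution A (regular_module A) I \<delta> \<eta>"
      and zero: "\<And>j. j > d \<Longrightarrow> carrier (I j) = {\<zero>\<^bsub>I j\<^esub>}"
    using id unfolding injective_dimension_le_def by blast
  have I: "baer_injective A (I j)" for j
    using res by (simp add: injective_resolution_def injective_imp_baer_injective)
  note LI = baer_injective_left_module[OF I]
  have \<delta>: "\<delta> j \<in> mod_hom A (I j) (I (Suc j))" for j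
    using res by (simp add: injective_resolution_def)
  have exact: "\<delta> j ` carrier (I j) = a_kernel (I (Suc j)) (I (Suc (Suc j))) (\<delta> (Suc j))" for j
    using res by (simp add: injective_resolution_def)
  have \<eta>: "\<eta> \<in> mod_hom A (regular_module A) (I 0)" "inj_on \<eta> (carrier A)"
      "\<eta> ` carrier A = a_kernel (I 0) (I (Suc 0)) (\<delta> 0)"
    using res by (simp_all add: injective_resolution_def)
  define C where "C j = (I j)\<lparr>carrier := a_kernel (I j) (I (Suc j)) (\<delta> j)\<rparr>" for j
  have ker: "submodule (a_kernel (I j) (I (Suc j)) (\<delta> j)) A (I j)" for j
    by (rule mod_hom_kernel_submodule[OF LI LI \<delta>])
  have LC: "left_module A (C j)" for j
    unfolding C_def by (rule left_module_submodule[OF LI ker])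
  have C_carr: "carrier (C j) = a_kernel (I j) (I (Suc j)) (\<delta> j)" and C_zero: "\<zero>\<^bsub>C j\<^esub> = \<zero>\<^bsub>I j\<^esub>" for j
    by (simp_all add: C_def)
  have LA: "left_module A (regular_module A)" by (rule left_module_regular) (rule A.ring_axioms)
  let ?P = "direct_power :: _ \<Rightarrow> ('a, 'q \<Rightarrow> nat \<Rightarrow> 'a set) module"
  have \<delta>C: "\<delta> j \<in> mod_hom A (I j) (C (Suc j))" for j
    unfolding C_def by (rule mod_hom_into_subset[OF \<delta>]) (use exact in blast)
  \<comment> \<open>The next term of the resolution is zero, so the last kernel is all of
    \<open>I d\<close>, an injective module.\<close>
  have top: "C d = I d"
  proof -
    have "a_kernel (I d) (I (Suc d)) (\<delta> d) = carrier (I d)"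
      using mod_hom_closed[OF \<delta>, of _ d] zero[of "Suc d"] by (auto simp: a_kernel_iff)
    then show ?thesis by (simp add: C_def)
  qed
  \<comment> \<open>At \<open>j = d\<close> every \<open>m\<close> is allowed; each step down in
    \<open>j\<close> costs one degree, so \<open>j = 0\<close> is reached with
    \<open>d \<le> m\<close>.\<close>
  have vanish: "ext_vanishes A S m (?P (C j))" if "j \<le> d" "d \<le> m + j" for j m
    using that
  proof (induction j arbitrary: m rule: inc_induct)
    case base
    show ?case
      unfolding top
      by (rule ext_vanishes_injective[OF S baer_injective_direct_power[OF algebra_left_noetherian I]])
  next
    case (step j)
    show ?case
    proof (cases m)
      \<comment> \<open>With \<open>m = 0\<close> the bound \<open>d \<le> m + j\<close> contradicts
        \<open>j < d\<close>.\<close>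
      case 0
      then show ?thesis using step by simp
    next
      case (Suc m')
      have "ext_vanishes A S (Suc m') (?P (C j))"
      proof (rule ext_vanishes_dimension_shift[OF S baer_injective_direct_power[OF algebra_left_noetherian I, of j]
            left_module_direct_power[OF LC] left_module_direct_power[OF LC, of "Suc j"]])
        show "(\<lambda>f. f) \<in> mod_hom A (?P (C j)) (?P (I j))"
          by (rule direct_power_map_hom[OF LC LI, of "\<lambda>x. x"])
            (unfold C_def, rule mod_hom_on_subset[OF mod_hom_ident submodule_subset[OF ker]])
        show \<delta>': "(\<lambda>f x. \<delta> j (f x)) \<in> mod_hom A (?P (I j)) (?P (C (Suc j)))"
          by (rule direct_power_map_hom[OF LI LC \<delta>C])
        show "(\<lambda>f x. \<delta> j (f x)) ` carrier (?P (I j)) = carrier (?P (C (Suc j)))"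
          unfolding direct_power_map_image[OF LI LC \<delta>C] exact
          by (auto simp: direct_power_carrier C_carr)
        show "(\<lambda>f. f) ` carrier (?P (C j)) = a_kernel (?P (I j)) (?P (C (Suc j))) (\<lambda>f x. \<delta> j (f x))"
          by (auto simp: a_kernel_iff direct_power_carrier C_carr C_zero fun_eq_iff)
        show "ext_vanishes A S m' (?P (C (Suc j)))"
          using step Suc by simp
      qed simp
      then show ?thesis using Suc by simp
    qed
  qed
  have "ext_vanishes A S m (direct_power (regular_module A) :: ('a, 'q \<Rightarrow> 'a) module)"
  proof (rule ext_vanishes_iso[OF S left_module_direct_power[OF LA] left_module_direct_power[OF LC]])
    have \<eta>C: "\<eta> \<in> mod_hom A (regular_module A) (C 0)"
      unfolding C_def by (rule mod_hom_into_subset[OF \<eta>(1)]) (use \<eta>(3) in auto)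
    show "(\<lambda>f x. \<eta> (f x)) \<in> mod_hom A (direct_power (regular_module A)) (?P (C 0))"
      by (rule direct_power_map_hom[OF LA LC \<eta>C])
    show "inj_on (\<lambda>f x. \<eta> (f x)) (carrier (direct_power (regular_module A)))"
      using \<eta>(2) by (auto simp: inj_on_def direct_power_carrier fun_eq_iff)
    show "(\<lambda>f x. \<eta> (f x)) ` carrier (direct_power (regular_module A)) = carrier (?P (C 0))"
      unfolding direct_power_map_image[OF LA LC \<eta>C] regular_module_simps \<eta>(3)
      by (auto simp: direct_power_carrier C_carr)
    show "ext_vanishes A S m (?P (C 0))"
      by (rule vanish) (use \<open>d \<le> m\<close> in auto)
  qed
  note free = this
  obtain s where s: "s \<in> mod_hom A Q (direct_power (regular_module A) :: ('a, 'q \<Rightarrow> 'a) module)"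
    and ps: "\<forall>x\<in>carrier Q. lin_comb A Q (\<lambda>x. if x \<in> carrier Q then x else \<zero>\<^bsub>Q\<^esub>) (s x) = x"
    by (rule bexE[OF projective_coordinates[OF Q]])
  have LQ: "left_module A Q" by (rule projective_left_module[OF Q])
  have p: "lin_comb A Q (\<lambda>x. if x \<in> carrier Q then x else \<zero>\<^bsub>Q\<^esub>) \<in>
      mod_hom A (direct_power (regular_module A)) Q"
  proof (rule lin_comb_hom[OF LQ])
    interpret Q: left_module A Q by (rule LQ)
    show "(if x \<in> carrier Q then x else \<zero>\<^bsub>Q\<^esub>) \<in> carrier Q" for x by simp
  qed
  show ?thesis
    by (rule ext_vanishes_retract[OF S LQ left_module_direct_power[OF LA] s p bspec[OF ps] free])
qed


section \<open>Chain maps between projective resolutions\<close>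

lemma resolution_lift_aug:
  assumes "projective_resolution R E V" "left_module R V" "projective_module R P" "f \<in> mod_hom R P V"
  shows "\<exists>h\<in>mod_hom R P (obj E 0). \<forall>x\<in>carrier P. aug E (h x) = f x"
proof (rule projective_lift[OF assms(3) resolution_left_module[OF assms(1)] assms(2) resolution_aug_hom[OF assms(1)] assms(4)])
  show "f x \<in> aug E ` carrier (obj E 0)" if "x \<in> carrier P" for x
    unfolding resolution_aug_surj[OF assms(1)] by (rule mod_hom_closed[OF assms(4) that])
qed

text \<open>Exactness at \<open>obj E 0\<close> is expressed through the augmentation, not through a
  boundary map, so lifting along \<open>bd E 0\<close> is separate from the higher degrees.\<close>

lemma resolution_lift_bd_0:
  assumes "projective_resolution R E V" "projective_module R P" "g \<in> mod_hom R P (obj E 0)"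
    and "\<And>x. x \<in> carrier P \<Longrightarrow> aug E (g x) = \<zero>\<^bsub>V\<^esub>"
  shows "\<exists>h\<in>mod_hom R P (obj E (Suc 0)). \<forall>x\<in>carrier P. bd E 0 (h x) = g x"
proof (rule projective_lift[OF assms(2) resolution_left_module[OF assms(1)] resolution_left_module[OF assms(1)]
      resolution_bd_hom[OF assms(1)] assms(3)])
  show "g x \<in> bd E 0 ` carrier (obj E (Suc 0))" if "x \<in> carrier P" for x
    unfolding resolution_aug_exact[OF assms(1)]
    using assms(4)[OF that] mod_hom_closed[OF assms(3) that] by (simp add: a_kernel_iff)
qed

lemma resolution_lift_bd:
  assumes "projective_resolution R E V" "projective_module R P" "g \<in> mod_hom R P (obj E (Suc j))"
    and "\<And>x. x \<in> carrier P \<Longrightarrow> bd E j (g x) = \<zero>\<^bsub>obj E j\<^esub>"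
  shows "\<exists>h\<in>mod_hom R P (obj E (Suc (Suc j))). \<forall>x\<in>carrier P. bd E (Suc j) (h x) = g x"
proof (rule projective_lift[OF assms(2) resolution_left_module[OF assms(1)] resolution_left_module[OF assms(1)]
      resolution_bd_hom[OF assms(1)] assms(3)])
  show "g x \<in> bd E (Suc j) ` carrier (obj E (Suc (Suc j)))" if "x \<in> carrier P" for x
    unfolding resolution_exact[OF assms(1)]
    using assms(4)[OF that] mod_hom_closed[OF assms(3) that] by (simp add: a_kernel_iff)
qed

section \<open>Chain maps over a homomorphism\<close>

lemma chain_lift_hom: "\<lbrakk>chain_lift R S m f E l \<phi>; j < l\<rbrakk> \<Longrightarrow> \<phi> j \<in> mod_hom R (obj S (m + j)) (obj E j)"
  by (simp add: chain_lift_def)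

lemma chain_lift_aug: "\<lbrakk>chain_lift R S m f E l \<phi>; x \<in> carrier (obj S m)\<rbrakk> \<Longrightarrow> aug E (\<phi> 0 x) = f x"
  by (simp add: chain_lift_def)

lemma chain_lift_bd:
  "\<lbrakk>chain_lift R S m f E l \<phi>; Suc j < l; x \<in> carrier (obj S (Suc (m + j)))\<rbrakk> \<Longrightarrow>
    bd E j (\<phi> (Suc j) x) = \<phi> j (bd S (m + j) x)"
  by (simp add: chain_lift_def)

lemma chain_liftI:
  assumes "\<And>j. j < l \<Longrightarrow> \<phi> j \<in> mod_hom R (obj S (m + j)) (obj E j)"
    and "\<And>x. x \<in> carrier (obj S m) \<Longrightarrow> aug E (\<phi> 0 x) = f x"
    and "\<And>j x. \<lbrakk>Suc j < l; x \<in> carrier (obj S (Suc (m + j)))\<rbrakk> \<Longrightarrow>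
      bd E j (\<phi> (Suc j) x) = \<phi> j (bd S (m + j) x)"
  shows "chain_lift R S m f E l \<phi>"
  using assms by (simp add: chain_lift_def)

text \<open>Components are chosen one after the other by lifting along the exact complex
  \<open>E\<close>. A single sequence serves for all lengths \<open>l\<close> at once.\<close>

lemma chain_lift_exists:
  assumes S: "projective_resolution R S U" and E: "projective_resolution R E V" and V: "left_module R V"
    and f: "f \<in> mod_hom R (obj S m) V"
    and cocycle: "\<And>x. x \<in> carrier (obj S (Suc m)) \<Longrightarrow> f (bd S m x) = \<zero>\<^bsub>V\<^esub>"
  shows "\<exists>\<phi>. \<forall>l. chain_lift R S m f E l \<phi>"
proof -
  \<comment> \<open>Besides being a homomorphism, a component has to send boundaries to cycles,
    since otherwise the next component could not be lifted; for degree 0 this follows from the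
    cocycle condition on \<open>f\<close>.\<close>
  define P where "P j \<phi> \<longleftrightarrow> \<phi> \<in> mod_hom R (obj S (m + j)) (obj E j) \<and>
      (j = 0 \<longrightarrow> (\<forall>x\<in>carrier (obj S m). aug E (\<phi> x) = f x)) \<and>
      (\<forall>i. j = Suc i \<longrightarrow> (\<forall>x\<in>carrier (obj S (Suc (m + j))). bd E i (\<phi> (bd S (m + j) x)) = \<zero>\<^bsub>obj E i\<^esub>))"
    for j \<phi>
  define Q where "Q j \<phi> \<phi>' \<longleftrightarrow> (\<forall>x\<in>carrier (obj S (Suc (m + j))). bd E j (\<phi>' x) = \<phi> (bd S (m + j) x))"
    for j \<phi> \<phi>'
  note L = resolution_left_module[OF S] and LE = resolution_left_module[OF E]
  have "\<exists>\<phi>. P 0 \<phi>"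
    using resolution_lift_aug[OF E V resolution_projective[OF S] f] by (auto simp: P_def)
  moreover have "\<exists>\<phi>'. P (Suc j) \<phi>' \<and> Q j \<phi> \<phi>'" if P: "P j \<phi>" for j \<phi>
  proof -
    have \<phi>: "\<phi> \<in> mod_hom R (obj S (m + j)) (obj E j)" using P by (simp add: P_def)
    let ?g = "\<lambda>x. \<phi> (bd S (m + j) x)"
    have g: "?g \<in> mod_hom R (obj S (Suc (m + j))) (obj E j)"
      by (rule mod_hom_comp[OF resolution_bd_hom[OF S] \<phi>])
    have "\<exists>h\<in>mod_hom R (obj S (Suc (m + j))) (obj E (Suc j)). \<forall>x\<in>carrier (obj S (Suc (m + j))). bd E j (h x) = ?g x"
    proof (cases j)
      case 0
      have "aug E (?g x) = \<zero>\<^bsub>V\<^esub>" if "x \<in> carrier (obj S (Suc m))" for x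
        using P 0 cocycle[OF that] resolution_bd_closed[OF S that] by (simp add: P_def)
      then show ?thesis
        using resolution_lift_bd_0[OF E resolution_projective[OF S, of "Suc m"], of ?g] g 0 by simp
    next
      case (Suc i)
      have "bd E i (?g x) = \<zero>\<^bsub>obj E i\<^esub>" if "x \<in> carrier (obj S (Suc (m + j)))" for x
        using P Suc that by (simp add: P_def)
      then show ?thesis
        using resolution_lift_bd[OF E resolution_projective[OF S, of "Suc (m + j)"], of ?g i] g Suc by simp
    qed
    then obtain h where h: "h \<in> mod_hom R (obj S (Suc (m + j))) (obj E (Suc j))"
      "\<forall>x\<in>carrier (obj S (Suc (m + j))). bd E j (h x) = ?g x" by (elim bexE)
    have "bd E j (h (bd S (Suc (m + j)) x)) = \<zero>\<^bsub>obj E j\<^esub>" if x: "x \<in> carrier (obj S (Suc (Suc (m + j))))" for x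
    proof -
      have "bd E j (h (bd S (Suc (m + j)) x)) = \<phi> (bd S (m + j) (bd S (Suc (m + j)) x))"
        using h(2) resolution_bd_closed[OF S x] by simp
      also have "\<dots> = \<zero>\<^bsub>obj E j\<^esub>"
        unfolding resolution_bd_bd[OF S x] by (rule mod_hom_zero[OF L LE \<phi>])
      finally show ?thesis .
    qed
    then have "P (Suc j) h \<and> Q j \<phi> h"
      using h by (simp add: P_def Q_def)
    then show ?thesis by (rule exI[of _ h])
  qed
  ultimately have "\<exists>\<phi>. \<forall>j. P j (\<phi> j) \<and> Q j (\<phi> j) (\<phi> (Suc j))"
    by (rule dependent_nat_choice)
  then obtain \<phi> where "\<forall>j. P j (\<phi> j) \<and> Q j (\<phi> j) (\<phi> (Suc j))" ..
  then have "chain_lift R S m f E l \<phi>" for l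
    by (intro chain_liftI) (simp_all add: P_def Q_def)
  then show ?thesis by blast
qed

lemma chain_lift_add:
  assumes V: "left_module R V" and E: "projective_resolution R E V"
    and \<phi>: "chain_lift R S m f E l \<phi>" and \<phi>': "chain_lift R S m f' E l \<phi>'" and "0 < l"
    and S: "projective_resolution R S U"
  shows "chain_lift R S m (\<lambda>x. f x \<oplus>\<^bsub>V\<^esub> f' x) E l (\<lambda>j x. \<phi> j x \<oplus>\<^bsub>obj E j\<^esub> \<phi>' j x)"
proof (rule chain_liftI)
  note LE = resolution_left_module[OF E]
  note c = mod_hom_closed[OF chain_lift_hom[OF \<phi>]] and c' = mod_hom_closed[OF chain_lift_hom[OF \<phi>']]
  show "(\<lambda>x. \<phi> j x \<oplus>\<^bsub>obj E j\<^esub> \<phi>' j x) \<in> mod_hom R (obj S (m + j)) (obj E j)" if "j < l" for j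
    by (rule mod_hom_add_map[OF LE chain_lift_hom[OF \<phi> that] chain_lift_hom[OF \<phi>' that]])
  show "aug E (\<phi> 0 x \<oplus>\<^bsub>obj E 0\<^esub> \<phi>' 0 x) = f x \<oplus>\<^bsub>V\<^esub> f' x" if "x \<in> carrier (obj S m)" for x
    using that \<open>0 < l\<close> c[of 0 x] c'[of 0 x]
    by (simp add: mod_hom_add[OF resolution_aug_hom[OF E]] chain_lift_aug[OF \<phi>] chain_lift_aug[OF \<phi>'])
  show "bd E j (\<phi> (Suc j) x \<oplus>\<^bsub>obj E (Suc j)\<^esub> \<phi>' (Suc j) x) =
      \<phi> j (bd S (m + j) x) \<oplus>\<^bsub>obj E j\<^esub> \<phi>' j (bd S (m + j) x)"
    if "Suc j < l" "x \<in> carrier (obj S (Suc (m + j)))" for j x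
    using that c[of "Suc j" x] c'[of "Suc j" x]
    by (simp add: mod_hom_add[OF resolution_bd_hom[OF E]] chain_lift_bd[OF \<phi>] chain_lift_bd[OF \<phi>'])
qed

lemma chain_lift_minus:
  assumes V: "left_module R V" and E: "projective_resolution R E V"
    and \<phi>: "chain_lift R S m f E l \<phi>" and \<phi>': "chain_lift R S m f' E l \<phi>'" and "0 < l"
  shows "chain_lift R S m (\<lambda>x. f x \<ominus>\<^bsub>V\<^esub> f' x) E l (\<lambda>j x. \<phi> j x \<ominus>\<^bsub>obj E j\<^esub> \<phi>' j x)"
proof (rule chain_liftI)
  note LE = resolution_left_module[OF E]
  note c = mod_hom_closed[OF chain_lift_hom[OF \<phi>]] and c' = mod_hom_closed[OF chain_lift_hom[OF \<phi>']]
  show "(\<lambda>x. \<phi> j x \<ominus>\<^bsub>obj E j\<^esub> \<phi>' j x) \<in> mod_hom R (obj S (m + j)) (obj E j)" if "j < l" for j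
    by (rule mod_hom_minus_map[OF LE chain_lift_hom[OF \<phi> that] chain_lift_hom[OF \<phi>' that]])
  show "aug E (\<phi> 0 x \<ominus>\<^bsub>obj E 0\<^esub> \<phi>' 0 x) = f x \<ominus>\<^bsub>V\<^esub> f' x" if "x \<in> carrier (obj S m)" for x
    using that \<open>0 < l\<close> c[of 0 x] c'[of 0 x]
    by (simp add: mod_hom_minus[OF LE V resolution_aug_hom[OF E]] chain_lift_aug[OF \<phi>] chain_lift_aug[OF \<phi>'])
  show "bd E j (\<phi> (Suc j) x \<ominus>\<^bsub>obj E (Suc j)\<^esub> \<phi>' (Suc j) x) =
      \<phi> j (bd S (m + j) x) \<ominus>\<^bsub>obj E j\<^esub> \<phi>' j (bd S (m + j) x)"
    if "Suc j < l" "x \<in> carrier (obj S (Suc (m + j)))" for j x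
    using that c[of "Suc j" x] c'[of "Suc j" x]
    by (simp add: mod_hom_minus[OF LE LE resolution_bd_hom[OF E]] chain_lift_bd[OF \<phi>] chain_lift_bd[OF \<phi>'])
qed

lemma chain_lift_comp:
  assumes \<psi>: "chain_lift R S m f Y l \<psi>" and \<chi>: "chain_lift R Y 0 (aug Y) Z l \<chi>" and "0 < l"
  shows "chain_lift R S m f Z l (\<lambda>j x. \<chi> j (\<psi> j x))"
proof (rule chain_liftI)
  note c = mod_hom_closed[OF chain_lift_hom[OF \<psi>]]
  show "(\<lambda>x. \<chi> j (\<psi> j x)) \<in> mod_hom R (obj S (m + j)) (obj Z j)" if "j < l" for j
    by (rule mod_hom_comp[OF chain_lift_hom[OF \<psi> that]]) (use chain_lift_hom[OF \<chi> that] in simp)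
  show "aug Z (\<chi> 0 (\<psi> 0 x)) = f x" if "x \<in> carrier (obj S m)" for x
    using chain_lift_aug[OF \<chi>, of "\<psi> 0 x"] chain_lift_aug[OF \<psi> that] c[of 0 x] that \<open>0 < l\<close> by simp
  show "bd Z j (\<chi> (Suc j) (\<psi> (Suc j) x)) = \<chi> j (\<psi> j (bd S (m + j) x))"
    if "Suc j < l" "x \<in> carrier (obj S (Suc (m + j)))" for j x
    using chain_lift_bd[OF \<chi> that(1), of "\<psi> (Suc j) x"] chain_lift_bd[OF \<psi> that] c[of "Suc j" x] that by simp
qed

lemma chain_lift_ident: "projective_resolution R Y M \<Longrightarrow> chain_lift R Y 0 (aug Y) Y l (\<lambda>j x. x)"
  by (rule chain_liftI) (simp_all add: mod_hom_ident)

text \<open>A chain map over zero has a contracting homotopy, built by lifting. Only two consecutive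
  components \<open>s\<close> and \<open>t\<close> in one positive degree are returned, because a
  cocycle is compared in a single degree.\<close>

lemma chain_lift_null_homotopic:
  assumes S: "projective_resolution R S U" and E: "projective_resolution R E V" and V: "left_module R V"
    and \<phi>: "chain_lift R S 0 f E l \<phi>" and f: "\<And>x. x \<in> carrier (obj S 0) \<Longrightarrow> f x = \<zero>\<^bsub>V\<^esub>"
    and "Suc j < l"
  shows "\<exists>s\<in>mod_hom R (obj S (Suc j)) (obj E (Suc (Suc j))). \<exists>t\<in>mod_hom R (obj S j) (obj E (Suc j)).
    \<forall>x\<in>carrier (obj S (Suc j)). \<phi> (Suc j) x = bd E (Suc j) (s x) \<oplus>\<^bsub>obj E (Suc j)\<^esub> t (bd S j x)"
proof -
  note L = resolution_left_module[OF S] and LE = resolution_left_module[OF E]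
  note \<phi>_hom = chain_lift_hom[OF \<phi>, simplified] and \<phi>_bd = chain_lift_bd[OF \<phi>, simplified]
  have step: "\<exists>s\<in>mod_hom R (obj S (Suc j)) (obj E (Suc (Suc j))).
      \<forall>x\<in>carrier (obj S (Suc j)). \<phi> (Suc j) x = bd E (Suc j) (s x) \<oplus>\<^bsub>obj E (Suc j)\<^esub> t (bd S j x)"
    if "Suc j < l" and t: "t \<in> mod_hom R (obj S j) (obj E (Suc j))"
      and eq: "\<And>x. x \<in> carrier (obj S (Suc j)) \<Longrightarrow> \<phi> j (bd S j x) = bd E j (t (bd S j x))" for t j
  proof -
    interpret E0: left_module R "obj E j" by (rule LE)
    interpret E1: left_module R "obj E (Suc j)" by (rule LE)
    let ?g = "\<lambda>x. \<phi> (Suc j) x \<ominus>\<^bsub>obj E (Suc j)\<^esub> t (bd S j x)"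
    have t_bd: "(\<lambda>x. t (bd S j x)) \<in> mod_hom R (obj S (Suc j)) (obj E (Suc j))"
      by (rule mod_hom_comp[OF resolution_bd_hom[OF S] t])
    have g: "?g \<in> mod_hom R (obj S (Suc j)) (obj E (Suc j))"
      by (rule mod_hom_minus_map[OF LE \<phi>_hom[OF \<open>Suc j < l\<close>] t_bd])
    have "bd E j (?g x) = \<zero>\<^bsub>obj E j\<^esub>" if x: "x \<in> carrier (obj S (Suc j))" for x
    proof -
      have 1: "\<phi> (Suc j) x \<in> carrier (obj E (Suc j))" and 2: "t (bd S j x) \<in> carrier (obj E (Suc j))"
        by (rule mod_hom_closed[OF \<phi>_hom[OF \<open>Suc j < l\<close>] x], rule mod_hom_closed[OF t_bd x])
      have "bd E j (?g x) = bd E j (\<phi> (Suc j) x) \<ominus>\<^bsub>obj E j\<^esub> bd E j (t (bd S j x))"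
        by (rule mod_hom_minus[OF LE LE resolution_bd_hom[OF E] 1 2])
      also have "\<dots> = \<zero>\<^bsub>obj E j\<^esub>"
        using \<phi>_bd[OF \<open>Suc j < l\<close> x] eq[OF x] resolution_bd_closed[OF E 2] by (simp add: E0.minus_eq_zero_iff)
      finally show ?thesis .
    qed
    from resolution_lift_bd[OF E resolution_projective[OF S] g this]
    obtain s where s: "s \<in> mod_hom R (obj S (Suc j)) (obj E (Suc (Suc j)))"
      "\<forall>x\<in>carrier (obj S (Suc j)). bd E (Suc j) (s x) = ?g x" by blast
    have "\<phi> (Suc j) x = bd E (Suc j) (s x) \<oplus>\<^bsub>obj E (Suc j)\<^esub> t (bd S j x)" if x: "x \<in> carrier (obj S (Suc j))" for x
      using bspec[OF s(2) x] mod_hom_closed[OF \<phi>_hom[OF \<open>Suc j < l\<close>] x] mod_hom_closed[OF t_bd x]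
      by (simp add: E1.minus_add_cancel)
    then show ?thesis using s(1) by (intro bexI[of _ s]) auto
  qed
  \<comment> \<open>It suffices to carry the homotopy equation on boundaries: there the contribution
    of the preceding component contains two successive boundary maps and vanishes, so only the
    newest component has to be remembered.\<close>
  have "\<exists>t\<in>mod_hom R (obj S j) (obj E (Suc j)).
      \<forall>x\<in>carrier (obj S (Suc j)). \<phi> j (bd S j x) = bd E j (t (bd S j x))"
    using \<open>Suc j < l\<close>
  proof (induction j)
    case 0
    have "aug E (\<phi> 0 x) = \<zero>\<^bsub>V\<^esub>" if "x \<in> carrier (obj S 0)" for x
      using chain_lift_aug[OF \<phi> that] f[OF that] by simp
    from resolution_lift_bd_0[OF E resolution_projective[OF S] \<phi>_hom this] 0
    obtain t where t: "t \<in> mod_hom R (obj S 0) (obj E (Suc 0))"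
      "\<forall>x\<in>carrier (obj S 0). bd E 0 (t x) = \<phi> 0 x" by auto
    then show ?case
      using resolution_bd_closed[OF S, of _ 0] by (intro bexI[of _ t]) simp_all
  next
    case (Suc j)
    then obtain t where t: "t \<in> mod_hom R (obj S j) (obj E (Suc j))"
      "\<forall>x\<in>carrier (obj S (Suc j)). \<phi> j (bd S j x) = bd E j (t (bd S j x))" by auto
    have "Suc j < l" using Suc.prems by simp
    from step[OF this t(1) bspec[OF t(2)]]
    obtain s where s: "s \<in> mod_hom R (obj S (Suc j)) (obj E (Suc (Suc j)))"
      "\<forall>x\<in>carrier (obj S (Suc j)). \<phi> (Suc j) x = bd E (Suc j) (s x) \<oplus>\<^bsub>obj E (Suc j)\<^esub> t (bd S j x)"
      by blast
    interpret E1: left_module R "obj E (Suc j)" by (rule LE)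
    have "\<phi> (Suc j) (bd S (Suc j) x) = bd E (Suc j) (s (bd S (Suc j) x))"
      if x: "x \<in> carrier (obj S (Suc (Suc j)))" for x
    proof -
      note bx = resolution_bd_closed[OF S x]
      have "\<phi> (Suc j) (bd S (Suc j) x) =
          bd E (Suc j) (s (bd S (Suc j) x)) \<oplus>\<^bsub>obj E (Suc j)\<^esub> t \<zero>\<^bsub>obj S j\<^esub>"
        using bspec[OF s(2) bx] resolution_bd_bd[OF S x] by simp
      also have "\<dots> = bd E (Suc j) (s (bd S (Suc j) x))"
        using mod_hom_zero[OF L LE t(1)] resolution_bd_closed[OF E mod_hom_closed[OF s(1) bx]] by simp
      finally show ?thesis .
    qed
    then show ?case using s(1) by (intro bexI[of _ s]) auto
  qed
  then obtain t where t: "t \<in> mod_hom R (obj S j) (obj E (Suc j))"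
    "\<forall>x\<in>carrier (obj S (Suc j)). \<phi> j (bd S j x) = bd E j (t (bd S j x))" by (elim bexE)
  from step[OF \<open>Suc j < l\<close> t(1) bspec[OF t(2)]] t(1) show ?thesis by blast
qed


section \<open>The comparison theorem\<close>

text \<open>In contrast to \<open>cocycles\<close>, values outside the carrier are left free, so
  composites of homomorphisms qualify without being restricted first.\<close>

definition is_cocycle ::
  "('a, 'z) ring_scheme \<Rightarrow> ('a, 'x, 'u) aug_complex \<Rightarrow> nat \<Rightarrow> ('a, 'v) module \<Rightarrow> ('x \<Rightarrow> 'v) \<Rightarrow> bool" where
  "is_cocycle R S n V f \<longleftrightarrow>
    f \<in> mod_hom R (obj S n) V \<and> (\<forall>x\<in>carrier (obj S (Suc n)). f (bd S n x) = \<zero>\<^bsub>V\<^esub>)"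

text \<open>Coboundaries in degree \<open>m + 1\<close>, up to their values outside the carrier.\<close>

definition is_coboundary ::
  "('a, 'z) ring_scheme \<Rightarrow> ('a, 'x, 'u) aug_complex \<Rightarrow> nat \<Rightarrow> ('a, 'v) module \<Rightarrow> ('x \<Rightarrow> 'v) \<Rightarrow> bool" where
  "is_coboundary R S m V f \<longleftrightarrow>
    (\<exists>g\<in>mod_hom R (obj S m) V. \<forall>x\<in>carrier (obj S (Suc m)). f x = g (bd S m x))"

lemma is_cocycle_hom: "is_cocycle R S n V f \<Longrightarrow> f \<in> mod_hom R (obj S n) V"
  by (simp add: is_cocycle_def)

lemma is_cocycle_bd: "\<lbrakk>is_cocycle R S n V f; x \<in> carrier (obj S (Suc n))\<rbrakk> \<Longrightarrow> f (bd S n x) = \<zero>\<^bsub>V\<^esub>"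
  by (simp add: is_cocycle_def)

lemma is_coboundary_cong:
  "\<lbrakk>is_coboundary R S m V f; \<And>x. x \<in> carrier (obj S (Suc m)) \<Longrightarrow> f x = f' x\<rbrakk> \<Longrightarrow> is_coboundary R S m V f'"
  by (simp add: is_coboundary_def)

lemma is_coboundaryI:
  "\<lbrakk>g \<in> mod_hom R (obj S m) V; \<And>x. x \<in> carrier (obj S (Suc m)) \<Longrightarrow> f x = g (bd S m x)\<rbrakk> \<Longrightarrow>
    is_coboundary R S m V f"
  unfolding is_coboundary_def by (rule bexI[of _ g]) auto

lemma is_coboundary_add:
  assumes "left_module R V" "is_coboundary R S m V f" "is_coboundary R S m V f'"
  shows "is_coboundary R S m V (\<lambda>x. f x \<oplus>\<^bsub>V\<^esub> f' x)"
proof -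
  obtain g g' where g: "g \<in> mod_hom R (obj S m) V" "\<forall>x\<in>carrier (obj S (Suc m)). f x = g (bd S m x)"
    "g' \<in> mod_hom R (obj S m) V" "\<forall>x\<in>carrier (obj S (Suc m)). f' x = g' (bd S m x)"
    using assms(2,3) unfolding is_coboundary_def by blast
  show ?thesis
    by (rule is_coboundaryI[OF mod_hom_add_map[OF assms(1) g(1,3)]]) (simp add: g(2,4))
qed

lemma is_coboundary_minus:
  assumes "left_module R V" "is_coboundary R S m V f" "is_coboundary R S m V f'"
  shows "is_coboundary R S m V (\<lambda>x. f x \<ominus>\<^bsub>V\<^esub> f' x)"
proof -
  obtain g g' where g: "g \<in> mod_hom R (obj S m) V" "\<forall>x\<in>carrier (obj S (Suc m)). f x = g (bd S m x)"
    "g' \<in> mod_hom R (obj S m) V" "\<forall>x\<in>carrier (obj S (Suc m)). f' x = g' (bd S m x)"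
    using assms(2,3) unfolding is_coboundary_def by blast
  show ?thesis
    by (rule is_coboundaryI[OF mod_hom_minus_map[OF assms(1) g(1,3)]]) (simp add: g(2,4))
qed

text \<open>A cocycle cohomologous to a coboundary is a coboundary. The closure assumptions are
  there because subtraction cancels only inside the carrier of \<open>V\<close>.\<close>

lemma is_coboundary_trans:
  assumes V: "left_module R V"
    and f: "\<And>x. x \<in> carrier (obj S (Suc m)) \<Longrightarrow> f x \<in> carrier V"
    and f': "\<And>x. x \<in> carrier (obj S (Suc m)) \<Longrightarrow> f' x \<in> carrier V"
    and "is_coboundary R S m V f'" "is_coboundary R S m V (\<lambda>x. f x \<ominus>\<^bsub>V\<^esub> f' x)"
  shows "is_coboundary R S m V f"
proof -
  interpret V: left_module R V by (rule V)
  have "is_coboundary R S m V (\<lambda>x. (f x \<ominus>\<^bsub>V\<^esub> f' x) \<oplus>\<^bsub>V\<^esub> f' x)"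
    by (rule is_coboundary_add[OF V assms(5,4)])
  moreover have "(f x \<ominus>\<^bsub>V\<^esub> f' x) \<oplus>\<^bsub>V\<^esub> f' x = f x" if "x \<in> carrier (obj S (Suc m))" for x
    using f[OF that] f'[OF that] by (rule V.minus_add_cancel)
  ultimately show ?thesis by (rule is_coboundary_cong)
qed

lemma is_coboundary_minus_commute:
  assumes V: "left_module R V"
    and f: "\<And>x. x \<in> carrier (obj S (Suc m)) \<Longrightarrow> f x \<in> carrier V"
    and f': "\<And>x. x \<in> carrier (obj S (Suc m)) \<Longrightarrow> f' x \<in> carrier V"
    and "is_coboundary R S m V (\<lambda>x. f x \<ominus>\<^bsub>V\<^esub> f' x)"
  shows "is_coboundary R S m V (\<lambda>x. f' x \<ominus>\<^bsub>V\<^esub> f x)"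
proof -
  interpret V: left_module R V by (rule V)
  have "is_coboundary R S m V (\<lambda>x. \<zero>\<^bsub>V\<^esub>)"
    by (rule is_coboundaryI[OF mod_hom_zero_map[OF V]]) simp
  from is_coboundary_minus[OF V this assms(4)]
  have "is_coboundary R S m V (\<lambda>x. \<zero>\<^bsub>V\<^esub> \<ominus>\<^bsub>V\<^esub> (f x \<ominus>\<^bsub>V\<^esub> f' x))" .
  moreover have "\<zero>\<^bsub>V\<^esub> \<ominus>\<^bsub>V\<^esub> (f x \<ominus>\<^bsub>V\<^esub> f' x) = f' x \<ominus>\<^bsub>V\<^esub> f x" if "x \<in> carrier (obj S (Suc m))" for x
    using f[OF that] f'[OF that] by (simp add: a_minus_def V.minus_add V.a_comm)
  ultimately show ?thesis by (rule is_coboundary_cong)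
qed

text \<open>The chain map stops in degree \<open>Suc j\<close>, so there is no next component
  through which boundaries could be pushed. Exactness of \<open>E\<close> stands in: the image of a
  boundary is a cycle, hence itself a boundary, and \<open>h\<close> kills it.\<close>

lemma is_cocycle_chain_lift:
  assumes S: "projective_resolution R S U" and E: "projective_resolution R E V"
    and \<phi>: "chain_lift R S m f E (Suc (Suc j)) \<phi>" and h: "is_cocycle R E (Suc j) W h"
  shows "is_cocycle R S (Suc (m + j)) W (\<lambda>x. h (\<phi> (Suc j) x))"
  unfolding is_cocycle_def
proof (intro conjI ballI)
  have \<phi>1: "\<phi> (Suc j) \<in> mod_hom R (obj S (Suc (m + j))) (obj E (Suc j))"
    using chain_lift_hom[OF \<phi>, of "Suc j"] by simp
  have \<phi>0: "\<phi> j \<in> mod_hom R (obj S (m + j)) (obj E j)"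
    using chain_lift_hom[OF \<phi>, of j] by simp
  show "(\<lambda>x. h (\<phi> (Suc j) x)) \<in> mod_hom R (obj S (Suc (m + j))) W"
    by (rule mod_hom_comp[OF \<phi>1 is_cocycle_hom[OF h]])
  fix x assume x: "x \<in> carrier (obj S (Suc (Suc (m + j))))"
  note bx = resolution_bd_closed[OF S x]
  let ?y = "\<phi> (Suc j) (bd S (Suc (m + j)) x)"
  have "bd E j ?y = \<phi> j (bd S (m + j) (bd S (Suc (m + j)) x))"
    by (rule chain_lift_bd[OF \<phi> _ bx]) simp
  also have "\<dots> = \<zero>\<^bsub>obj E j\<^esub>"
    unfolding resolution_bd_bd[OF S x]
    by (rule mod_hom_zero[OF resolution_left_module[OF S] resolution_left_module[OF E] \<phi>0])
  finally have "?y \<in> bd E (Suc j) ` carrier (obj E (Suc (Suc j)))"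
    unfolding resolution_exact[OF E] a_kernel_iff using mod_hom_closed[OF \<phi>1 bx] by simp
  then obtain w where w: "w \<in> carrier (obj E (Suc (Suc j)))" "?y = bd E (Suc j) w" by (elim imageE)
  show "h ?y = \<zero>\<^bsub>W\<^esub>" unfolding w(2) by (rule is_cocycle_bd[OF h w(1)])
qed

lemma is_coboundary_chain_lift:
  assumes \<phi>: "chain_lift R S m f E (Suc (Suc j)) \<phi>" and h: "is_coboundary R E j W h"
  shows "is_coboundary R S (m + j) W (\<lambda>x. h (\<phi> (Suc j) x))"
proof -
  obtain u where u: "u \<in> mod_hom R (obj E j) W" "\<forall>x\<in>carrier (obj E (Suc j)). h x = u (bd E j x)"
    using h unfolding is_coboundary_def by blast
  have \<phi>1: "\<phi> (Suc j) \<in> mod_hom R (obj S (Suc (m + j))) (obj E (Suc j))"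
    using chain_lift_hom[OF \<phi>, of "Suc j"] by simp
  have \<phi>0: "\<phi> j \<in> mod_hom R (obj S (m + j)) (obj E j)"
    using chain_lift_hom[OF \<phi>, of j] by simp
  show ?thesis
  proof (rule is_coboundaryI[OF mod_hom_comp[OF \<phi>0 u(1)]])
    fix x assume x: "x \<in> carrier (obj S (Suc (m + j)))"
    have "h (\<phi> (Suc j) x) = u (bd E j (\<phi> (Suc j) x))"
      using u(2) mod_hom_closed[OF \<phi>1 x] by simp
    also have "bd E j (\<phi> (Suc j) x) = \<phi> j (bd S (m + j) x)"
      by (rule chain_lift_bd[OF \<phi> _ x]) simp
    finally show "h (\<phi> (Suc j) x) = u (\<phi> j (bd S (m + j) x))" .
  qed
qed

text \<open>The difference of the two lifts lies over zero and is null-homotopic. Applied to the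
  homotopy equation, the cocycle \<open>h\<close> kills one of the two terms and turns the other
  into a coboundary.\<close>

lemma chain_lift_unique:
  assumes S: "projective_resolution R S U" and E: "projective_resolution R E V" and V: "left_module R V"
    and W: "left_module R W"
    and \<phi>: "chain_lift R S 0 f E (Suc (Suc j)) \<phi>" and \<phi>': "chain_lift R S 0 f E (Suc (Suc j)) \<phi>'"
    and h: "is_cocycle R E (Suc j) W h"
  shows "is_coboundary R S j W (\<lambda>x. h (\<phi> (Suc j) x) \<ominus>\<^bsub>W\<^esub> h (\<phi>' (Suc j) x))"
proof -
  interpret V: left_module R V by (rule V)
  interpret W: left_module R W by (rule W)
  note LE = resolution_left_module[OF E] and h_hom = is_cocycle_hom[OF h]
  note \<phi>1 = chain_lift_hom[OF \<phi>, of "Suc j", simplified] and \<phi>'1 = chain_lift_hom[OF \<phi>', of "Suc j", simplified]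
  have "f x \<in> carrier V" if "x \<in> carrier (obj S 0)" for x
    using chain_lift_aug[OF \<phi> that] chain_lift_hom[OF \<phi>, of 0] that
      mod_hom_closed[OF resolution_aug_hom[OF E], of "\<phi> 0 x"] mod_hom_closed[of "\<phi> 0" R "obj S 0" "obj E 0" x]
    by simp
  then have "f x \<ominus>\<^bsub>V\<^esub> f x = \<zero>\<^bsub>V\<^esub>" if "x \<in> carrier (obj S 0)" for x
    using that by (simp add: a_minus_def V.r_neg)
  from chain_lift_null_homotopic[OF S E V chain_lift_minus[OF V E \<phi> \<phi>'] this, of j]
  obtain s t where s: "s \<in> mod_hom R (obj S (Suc j)) (obj E (Suc (Suc j)))"
    and t: "t \<in> mod_hom R (obj S j) (obj E (Suc j))"
    and eq: "\<forall>x\<in>carrier (obj S (Suc j)).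
      \<phi> (Suc j) x \<ominus>\<^bsub>obj E (Suc j)\<^esub> \<phi>' (Suc j) x = bd E (Suc j) (s x) \<oplus>\<^bsub>obj E (Suc j)\<^esub> t (bd S j x)"
    by auto
  show ?thesis
  proof (rule is_coboundaryI[OF mod_hom_comp[OF t h_hom]])
    fix x assume x: "x \<in> carrier (obj S (Suc j))"
    have sx: "s x \<in> carrier (obj E (Suc (Suc j)))" by (rule mod_hom_closed[OF s x])
    have tx: "t (bd S j x) \<in> carrier (obj E (Suc j))"
      by (rule mod_hom_closed[OF t resolution_bd_closed[OF S x]])
    have "h (\<phi> (Suc j) x) \<ominus>\<^bsub>W\<^esub> h (\<phi>' (Suc j) x) = h (\<phi> (Suc j) x \<ominus>\<^bsub>obj E (Suc j)\<^esub> \<phi>' (Suc j) x)"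
      by (rule mod_hom_minus[OF LE W h_hom mod_hom_closed[OF \<phi>1 x] mod_hom_closed[OF \<phi>'1 x], symmetric])
    also have "\<dots> = h (bd E (Suc j) (s x)) \<oplus>\<^bsub>W\<^esub> h (t (bd S j x))"
      unfolding bspec[OF eq x] by (rule mod_hom_add[OF h_hom resolution_bd_closed[OF E sx] tx])
    also have "\<dots> = h (t (bd S j x))"
      using is_cocycle_bd[OF h sx] mod_hom_closed[OF h_hom tx] by simp
    finally show "h (\<phi> (Suc j) x) \<ominus>\<^bsub>W\<^esub> h (\<phi>' (Suc j) x) = h (t (bd S j x))" .
  qed
qed

section \<open>Cohomology computed from two resolutions of one module\<close>

lemma comparison_exists:
  assumes "projective_resolution R S M" "projective_resolution R E M" "left_module R M"
  shows "\<exists>\<phi>. \<forall>l. chain_lift R S 0 (aug S) E l \<phi>"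
  by (rule chain_lift_exists[OF assms resolution_aug_hom[OF assms(1)] resolution_aug_bd[OF assms(1)]])

text \<open>With \<open>\<chi>\<close> a comparison map back, the composite of \<open>\<chi>\<close>
  and \<open>\<psi>\<close> lies over the identity of \<open>M\<close>. So \<open>h\<close> is
  cohomologous to its pull-back along that composite, which is a coboundary because the pull-back
  along \<open>\<psi>\<close> is one.\<close>

lemma comparison_injective:
  assumes S: "projective_resolution R S M" and E: "projective_resolution R E M" and M: "left_module R M"
    and W: "left_module R W" and \<psi>: "chain_lift R S 0 (aug S) E (Suc (Suc m)) \<psi>"
    and h: "is_cocycle R E (Suc m) W h" and h\<psi>: "is_coboundary R S m W (\<lambda>x. h (\<psi> (Suc m) x))"
  shows "is_coboundary R E m W h"
proof -
  obtain \<chi> where "\<forall>l. chain_lift R E 0 (aug E) S l \<chi>"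
    using comparison_exists[OF E S M] by (elim exE)
  then have \<chi>: "chain_lift R E 0 (aug E) S (Suc (Suc m)) \<chi>" ..
  have \<psi>\<chi>: "chain_lift R E 0 (aug E) E (Suc (Suc m)) (\<lambda>j x. \<psi> j (\<chi> j x))"
    by (rule chain_lift_comp[OF \<chi> \<psi>]) simp
  have h_closed: "h x \<in> carrier W" if "x \<in> carrier (obj E (Suc m))" for x
    by (rule mod_hom_closed[OF is_cocycle_hom[OF h] that])
  have diff: "is_coboundary R E m W (\<lambda>x. h x \<ominus>\<^bsub>W\<^esub> h (\<psi> (Suc m) (\<chi> (Suc m) x)))"
    by (rule chain_lift_unique[OF E E M W chain_lift_ident[OF E] \<psi>\<chi> h])
  have comp: "is_coboundary R E m W (\<lambda>x. h (\<psi> (Suc m) (\<chi> (Suc m) x)))"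
    using is_coboundary_chain_lift[OF \<chi> h\<psi>] by simp
  have "h (\<psi> (Suc m) (\<chi> (Suc m) x)) \<in> carrier W" if "x \<in> carrier (obj E (Suc m))" for x
    by (rule h_closed[OF mod_hom_closed[OF chain_lift_hom[OF \<psi>\<chi>, of "Suc m", simplified] that]])
  from is_coboundary_trans[OF W h_closed this comp diff] show ?thesis .
qed

text \<open>The preimage is \<open>g\<close> pulled back along a comparison map
  \<open>\<chi>\<close> in the other direction; the other composite is then homotopic to the
  identity of \<open>S\<close>.\<close>

lemma comparison_surjective:
  assumes S: "projective_resolution R S M" and E: "projective_resolution R E M" and M: "left_module R M"
    and W: "left_module R W" and \<psi>: "chain_lift R S 0 (aug S) E (Suc (Suc m)) \<psi>"
    and g: "is_cocycle R S (Suc m) W g"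
  shows "\<exists>h. is_cocycle R E (Suc m) W h \<and> is_coboundary R S m W (\<lambda>x. g x \<ominus>\<^bsub>W\<^esub> h (\<psi> (Suc m) x))"
proof -
  obtain \<chi> where "\<forall>l. chain_lift R E 0 (aug E) S l \<chi>"
    using comparison_exists[OF E S M] by (elim exE)
  then have \<chi>: "chain_lift R E 0 (aug E) S (Suc (Suc m)) \<chi>" ..
  have \<chi>\<psi>: "chain_lift R S 0 (aug S) S (Suc (Suc m)) (\<lambda>j x. \<chi> j (\<psi> j x))"
    by (rule chain_lift_comp[OF \<psi> \<chi>]) simp
  show ?thesis
  proof (intro exI[of _ "\<lambda>x. g (\<chi> (Suc m) x)"] conjI)
    show "is_cocycle R E (Suc m) W (\<lambda>x. g (\<chi> (Suc m) x))"
      using is_cocycle_chain_lift[OF E S \<chi> g] by simp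
    show "is_coboundary R S m W (\<lambda>x. g x \<ominus>\<^bsub>W\<^esub> g (\<chi> (Suc m) (\<psi> (Suc m) x)))"
      by (rule chain_lift_unique[OF S S M W chain_lift_ident[OF S] \<chi>\<psi> g])
  qed
qed


section \<open>Isomorphisms between quotients induced by relations\<close>

lemma quotient_module_carrier:
  "c \<in> carrier (quotient_module G B) \<longleftrightarrow> (\<exists>x\<in>carrier G. c = B +>\<^bsub>G\<^esub> x)"
  by (auto simp: quotient_module_def A_RCOSETS_def')

lemma a_r_coset_iff:
  assumes "left_module K G" "submodule B K G" "x \<in> carrier G"
  shows "y \<in> B +>\<^bsub>G\<^esub> x \<longleftrightarrow> y \<in> carrier G \<and> y \<ominus>\<^bsub>G\<^esub> x \<in> B"
proof -
  interpret G: left_module K G by fact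
  have sub: "b \<in> carrier G" if "b \<in> B" for b using submodule_subset[OF assms(2)] that by auto
  show ?thesis
  proof
    assume "y \<in> B +>\<^bsub>G\<^esub> x"
    then obtain b where "b \<in> B" "y = b \<oplus>\<^bsub>G\<^esub> x" by (auto simp: a_r_coset_def')
    then show "y \<in> carrier G \<and> y \<ominus>\<^bsub>G\<^esub> x \<in> B" using sub assms(3) by (simp add: G.add_minus_cancel)
  next
    assume y: "y \<in> carrier G \<and> y \<ominus>\<^bsub>G\<^esub> x \<in> B"
    then have "y = (y \<ominus>\<^bsub>G\<^esub> x) \<oplus>\<^bsub>G\<^esub> x" using assms(3) by (simp add: G.minus_add_cancel)
    then show "y \<in> B +>\<^bsub>G\<^esub> x" using y by (auto simp: a_r_coset_def')
  qed
qed

lemma a_r_coset_eq_iff: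
  assumes "left_module K G" "submodule B K G" "x \<in> carrier G" "y \<in> carrier G"
  shows "B +>\<^bsub>G\<^esub> x = B +>\<^bsub>G\<^esub> y \<longleftrightarrow> x \<ominus>\<^bsub>G\<^esub> y \<in> B"
proof -
  interpret G: left_module K G by fact
  have diff: "z \<ominus>\<^bsub>G\<^esub> y = (z \<ominus>\<^bsub>G\<^esub> x) \<oplus>\<^bsub>G\<^esub> (x \<ominus>\<^bsub>G\<^esub> y)" if "z \<in> carrier G" for z
    using that assms(3,4) by (simp add: a_minus_def G.a_assoc G.r_neg1)
  have diff': "z \<ominus>\<^bsub>G\<^esub> x = (z \<ominus>\<^bsub>G\<^esub> y) \<ominus>\<^bsub>G\<^esub> (x \<ominus>\<^bsub>G\<^esub> y)" if "z \<in> carrier G" for z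
    using that assms(3,4) by (subst diff[OF that]) (simp add: G.add_minus_cancel)
  show ?thesis
  proof
    assume "B +>\<^bsub>G\<^esub> x = B +>\<^bsub>G\<^esub> y"
    moreover have "x \<in> B +>\<^bsub>G\<^esub> x"
      using assms(3) submodule_zero[OF assms(2)] by (simp add: a_r_coset_iff[OF assms(1-3)] a_minus_def G.r_neg)
    ultimately show "x \<ominus>\<^bsub>G\<^esub> y \<in> B" using a_r_coset_iff[OF assms(1,2,4)] by simp
  next
    assume xy: "x \<ominus>\<^bsub>G\<^esub> y \<in> B"
    have "z \<ominus>\<^bsub>G\<^esub> x \<in> B \<longleftrightarrow> z \<ominus>\<^bsub>G\<^esub> y \<in> B" if z: "z \<in> carrier G" for z
    proof
      show "z \<ominus>\<^bsub>G\<^esub> x \<in> B \<Longrightarrow> z \<ominus>\<^bsub>G\<^esub> y \<in> B"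
        unfolding diff[OF z] by (rule submodule_add[OF assms(2) _ xy])
      show "z \<ominus>\<^bsub>G\<^esub> y \<in> B \<Longrightarrow> z \<ominus>\<^bsub>G\<^esub> x \<in> B"
        unfolding diff'[OF z] by (rule submodule_minus[OF assms(2) _ xy])
    qed
    then show "B +>\<^bsub>G\<^esub> x = B +>\<^bsub>G\<^esub> y"
      by (auto simp: a_r_coset_iff[OF assms(1-3)] a_r_coset_iff[OF assms(1,2,4)])
  qed
qed

lemma a_r_coset_self:
  assumes "left_module K G" "submodule B K G" "x \<in> carrier G"
  shows "x \<in> B +>\<^bsub>G\<^esub> x"
proof -
  interpret G: left_module K G by fact
  show ?thesis
    using assms(3) submodule_zero[OF assms(2)] by (simp add: a_r_coset_iff[OF assms] a_minus_def G.r_neg)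
qed

lemma quotient_module_add:
  assumes "left_module K G" "submodule B K G" "x \<in> carrier G" "y \<in> carrier G"
  shows "(B +>\<^bsub>G\<^esub> x) \<oplus>\<^bsub>quotient_module G B\<^esub> (B +>\<^bsub>G\<^esub> y) = B +>\<^bsub>G\<^esub> (x \<oplus>\<^bsub>G\<^esub> y)"
proof -
  interpret G: left_module K G by fact
  have "additive_subgroup B G"
    using submodule.axioms(1)[OF assms(2)] by (rule additive_subgroup.intro)
  then interpret B: abelian_subgroup B G
    by (rule abelian_subgroupI3) (rule G.M.abelian_group_axioms)
  show ?thesis
    using B.a_rcos_sum[OF assms(3,4)] by (simp add: quotient_module_def)
qed

lemma quotient_module_smult:
  assumes "left_module K G" "submodule B K G" "x \<in> carrier G" "c \<in> carrier K"
  shows "c \<odot>\<^bsub>quotient_module G B\<^esub> (B +>\<^bsub>G\<^esub> x) = B +>\<^bsub>G\<^esub> (c \<odot>\<^bsub>G\<^esub> x)"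
proof -
  interpret G: left_module K G by fact
  \<comment> \<open>The scalar multiple of a coset is a union over its representatives, and all
    members of that union coincide.\<close>
  have "B +>\<^bsub>G\<^esub> (c \<odot>\<^bsub>G\<^esub> z) = B +>\<^bsub>G\<^esub> (c \<odot>\<^bsub>G\<^esub> x)" if "z \<in> B +>\<^bsub>G\<^esub> x" for z
  proof -
    have z: "z \<in> carrier G" "z \<ominus>\<^bsub>G\<^esub> x \<in> B" using that a_r_coset_iff[OF assms(1-3)] by auto
    have "c \<odot>\<^bsub>G\<^esub> z \<ominus>\<^bsub>G\<^esub> c \<odot>\<^bsub>G\<^esub> x \<in> B"
      using submodule_smult[OF assms(2,4) z(2)] z(1) assms(3,4) by (simp add: G.smult_minus_right)
    then show ?thesis
      using a_r_coset_eq_iff[OF assms(1,2)] z(1) assms(3,4) by (simp add: G.smult_closed)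
  qed
  then have "(\<Union>z\<in>B +>\<^bsub>G\<^esub> x. B +>\<^bsub>G\<^esub> (c \<odot>\<^bsub>G\<^esub> z)) = B +>\<^bsub>G\<^esub> (c \<odot>\<^bsub>G\<^esub> x)"
    by (intro UN_constant_eq[OF a_r_coset_self[OF assms(1-3)]] ballI)
  then show ?thesis by (simp add: quotient_module_def)
qed

lemma quotient_module_add_closed:
  assumes "left_module K G" "submodule B K G"
    and "c \<in> carrier (quotient_module G B)" "d \<in> carrier (quotient_module G B)"
  shows "c \<oplus>\<^bsub>quotient_module G B\<^esub> d \<in> carrier (quotient_module G B)"
proof -
  interpret G: left_module K G by fact
  obtain x y where "x \<in> carrier G" "y \<in> carrier G" "c = B +>\<^bsub>G\<^esub> x" "d = B +>\<^bsub>G\<^esub> y"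
    using assms(3,4) unfolding quotient_module_carrier by blast
  then show ?thesis
    using quotient_module_add[OF assms(1,2)] unfolding quotient_module_carrier
    by (intro bexI[of _ "x \<oplus>\<^bsub>G\<^esub> y"]) auto
qed

lemma quotient_module_smult_closed:
  assumes "left_module K G" "submodule B K G" "a \<in> carrier K" "c \<in> carrier (quotient_module G B)"
  shows "a \<odot>\<^bsub>quotient_module G B\<^esub> c \<in> carrier (quotient_module G B)"
proof -
  interpret G: left_module K G by fact
  obtain x where "x \<in> carrier G" "c = B +>\<^bsub>G\<^esub> x"
    using assms(4) unfolding quotient_module_carrier by blast
  then show ?thesis
    using quotient_module_smult[OF assms(1,2) _ assms(3)] assms(3) unfolding quotient_module_carrier
    by (intro bexI[of _ "a \<odot>\<^bsub>G\<^esub> x"]) (auto simp: G.smult_closed)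
qed

text \<open>The relation \<open>r\<close> describes the map on representatives; it need not be linear. It is contained in
  a linear relation \<open>r'\<close> that identifies the submodules divided out.\<close>

lemma relation_induces_iso:
  fixes G :: "('k, 'g) module" and H :: "('k, 'h) module"
  assumes G: "left_module K G" and H: "left_module K H" and B: "submodule B K G" and C: "submodule C K H"
    and total: "\<And>x. x \<in> carrier G \<Longrightarrow> \<exists>y\<in>carrier H. r x y"
    and sub: "\<And>x y. \<lbrakk>x \<in> carrier G; y \<in> carrier H; r x y\<rbrakk> \<Longrightarrow> r' x y"
    and add: "\<And>x y x' y'. \<lbrakk>x \<in> carrier G; y \<in> carrier H; x' \<in> carrier G; y' \<in> carrier H; r' x y; r' x' y'\<rbrakk>
      \<Longrightarrow> r' (x \<oplus>\<^bsub>G\<^esub> x') (y \<oplus>\<^bsub>H\<^esub> y')"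
    and smult: "\<And>a x y. \<lbrakk>a \<in> carrier K; x \<in> carrier G; y \<in> carrier H; r' x y\<rbrakk>
      \<Longrightarrow> r' (a \<odot>\<^bsub>G\<^esub> x) (a \<odot>\<^bsub>H\<^esub> y)"
    and iff: "\<And>x y. \<lbrakk>x \<in> carrier G; y \<in> carrier H; r' x y\<rbrakk> \<Longrightarrow> x \<in> B \<longleftrightarrow> y \<in> C"
    and surj: "\<And>y. y \<in> carrier H \<Longrightarrow> \<exists>x\<in>carrier G. r' x y"
  shows "(\<lambda>c. THE d. d \<in> carrier (quotient_module H C) \<and> (\<exists>f\<in>c. \<exists>g\<in>d. r f g))
    \<in> mod_iso K (quotient_module G B) (quotient_module H C)" (is "?F \<in> _")
proof -
  interpret G: left_module K G by (rule G)
  interpret H: left_module K H by (rule H)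
  \<comment> \<open>Linearity in the form of subtraction, so that both well-definedness and
    injectivity reduce to elements of the submodules.\<close>
  have minus: "r' (x \<ominus>\<^bsub>G\<^esub> x') (y \<ominus>\<^bsub>H\<^esub> y')"
    if "x \<in> carrier G" "y \<in> carrier H" "x' \<in> carrier G" "y' \<in> carrier H" "r' x y" "r' x' y'" for x y x' y'
  proof -
    have "r' ((\<ominus>\<^bsub>K\<^esub> \<one>\<^bsub>K\<^esub>) \<odot>\<^bsub>G\<^esub> x') ((\<ominus>\<^bsub>K\<^esub> \<one>\<^bsub>K\<^esub>) \<odot>\<^bsub>H\<^esub> y')"
      by (rule smult[OF _ that(3,4,6)]) simp
    then have "r' (\<ominus>\<^bsub>G\<^esub> x') (\<ominus>\<^bsub>H\<^esub> y')"
      unfolding G.smult_uminus_one[OF that(3)] H.smult_uminus_one[OF that(4)] .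
    then show ?thesis
      unfolding a_minus_def by (intro add that G.a_inv_closed H.a_inv_closed)
  qed
  \<comment> \<open>Existence comes from totality of \<open>r\<close>. For uniqueness, two related
    pairs over the same coset are subtracted: their first entries differ by an element of
    \<open>B\<close>, so by \<open>iff\<close> the second entries differ by an element of
    \<open>C\<close>.\<close>
  have map_coset: "?F (B +>\<^bsub>G\<^esub> x) = C +>\<^bsub>H\<^esub> y" if x: "x \<in> carrier G" and y: "y \<in> carrier H" and xy: "r' x y" for x y
  proof (rule the_equality)
    obtain z where z: "z \<in> carrier H" "r x z" using total[OF x] by blast
    have "x \<ominus>\<^bsub>G\<^esub> x \<in> B" using submodule_zero[OF B] x by (simp add: a_minus_def G.r_neg)
    then have "z \<ominus>\<^bsub>H\<^esub> y \<in> C"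
      using iff[OF G.minus_closed[OF x x] H.minus_closed[OF z(1) y] minus[OF x z(1) x y sub[OF x z] xy]] by simp
    then have "z \<in> C +>\<^bsub>H\<^esub> y" using z(1) by (simp add: a_r_coset_iff[OF H C y])
    then show "C +>\<^bsub>H\<^esub> y \<in> carrier (quotient_module H C) \<and> (\<exists>f\<in>B +>\<^bsub>G\<^esub> x. \<exists>g\<in>C +>\<^bsub>H\<^esub> y. r f g)"
      using y z(2) a_r_coset_self[OF G B x] unfolding quotient_module_carrier by blast
  next
    fix d assume "d \<in> carrier (quotient_module H C) \<and> (\<exists>f\<in>B +>\<^bsub>G\<^esub> x. \<exists>g\<in>d. r f g)"
    then obtain w f g where w: "w \<in> carrier H" "d = C +>\<^bsub>H\<^esub> w" and fg: "f \<in> B +>\<^bsub>G\<^esub> x" "g \<in> d" "r f g"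
      unfolding quotient_module_carrier by blast
    have f: "f \<in> carrier G" "f \<ominus>\<^bsub>G\<^esub> x \<in> B" using fg(1) a_r_coset_iff[OF G B x] by auto
    have g: "g \<in> carrier H" "g \<ominus>\<^bsub>H\<^esub> w \<in> C" using fg(2) a_r_coset_iff[OF H C w(1)] w(2) by auto
    have "g \<ominus>\<^bsub>H\<^esub> y \<in> C"
      using iff[OF G.minus_closed[OF f(1) x] H.minus_closed[OF g(1) y]
          minus[OF f(1) g(1) x y sub[OF f(1) g(1) fg(3)] xy]] f(2) by simp
    then show "d = C +>\<^bsub>H\<^esub> y"
      using a_r_coset_eq_iff[OF H C g(1) y] a_r_coset_eq_iff[OF H C g(1) w(1)] g(2) w(2) by simp
  qed
  have ex: "\<exists>y\<in>carrier H. r' x y" if "x \<in> carrier G" for x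
    using total[OF that] sub[OF that] by blast
  have cosets: "\<exists>x y. x \<in> carrier G \<and> y \<in> carrier H \<and> r' x y \<and> c = B +>\<^bsub>G\<^esub> x"
    if "c \<in> carrier (quotient_module G B)" for c
    using that ex unfolding quotient_module_carrier by blast
  have hom: "?F \<in> mod_hom K (quotient_module G B) (quotient_module H C)"
  proof (rule mod_homI)
    fix c assume "c \<in> carrier (quotient_module G B)"
    then obtain x y where xy: "x \<in> carrier G" "y \<in> carrier H" "r' x y" and c: "c = B +>\<^bsub>G\<^esub> x"
      using cosets by blast
    show "?F c \<in> carrier (quotient_module H C)"
      unfolding c map_coset[OF xy] by (rule iffD2[OF quotient_module_carrier]) (use xy(2) in blast)
  next
    fix c c' assume "c \<in> carrier (quotient_module G B)" "c' \<in> carrier (quotient_module G B)"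
    then obtain x y x' y' where xy: "x \<in> carrier G" "y \<in> carrier H" "r' x y" and c: "c = B +>\<^bsub>G\<^esub> x"
      and xy': "x' \<in> carrier G" "y' \<in> carrier H" "r' x' y'" and c': "c' = B +>\<^bsub>G\<^esub> x'"
      using cosets by metis
    have "?F (c \<oplus>\<^bsub>quotient_module G B\<^esub> c') = C +>\<^bsub>H\<^esub> (y \<oplus>\<^bsub>H\<^esub> y')"
      unfolding c c' quotient_module_add[OF G B xy(1) xy'(1)]
      by (intro map_coset add xy xy' G.a_closed H.a_closed)
    also have "\<dots> = ?F c \<oplus>\<^bsub>quotient_module H C\<^esub> ?F c'"
      unfolding c c' map_coset[OF xy] map_coset[OF xy'] by (rule quotient_module_add[OF H C xy(2) xy'(2), symmetric])
    finally show "?F (c \<oplus>\<^bsub>quotient_module G B\<^esub> c') = ?F c \<oplus>\<^bsub>quotient_module H C\<^esub> ?F c'" .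
  next
    fix a c assume a: "a \<in> carrier K" and "c \<in> carrier (quotient_module G B)"
    then obtain x y where xy: "x \<in> carrier G" "y \<in> carrier H" "r' x y" and c: "c = B +>\<^bsub>G\<^esub> x"
      using cosets by blast
    have "?F (a \<odot>\<^bsub>quotient_module G B\<^esub> c) = C +>\<^bsub>H\<^esub> (a \<odot>\<^bsub>H\<^esub> y)"
      unfolding c quotient_module_smult[OF G B xy(1) a]
      by (intro map_coset smult xy a G.smult_closed H.smult_closed)
    also have "\<dots> = a \<odot>\<^bsub>quotient_module H C\<^esub> ?F c"
      unfolding c map_coset[OF xy] by (rule quotient_module_smult[OF H C xy(2) a, symmetric])
    finally show "?F (a \<odot>\<^bsub>quotient_module G B\<^esub> c) = a \<odot>\<^bsub>quotient_module H C\<^esub> ?F c" .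
  qed
  \<comment> \<open>Here \<open>iff\<close> is read backwards: second entries that differ by an
    element of \<open>C\<close> force first entries that differ by an element of
    \<open>B\<close>.\<close>
  have "inj_on ?F (carrier (quotient_module G B))"
  proof (rule inj_onI)
    fix c c' assume cc': "c \<in> carrier (quotient_module G B)" "c' \<in> carrier (quotient_module G B)" and eq: "?F c = ?F c'"
    from cosets[OF cc'(1)] cosets[OF cc'(2)]
    obtain x y x' y' where xy: "x \<in> carrier G" "y \<in> carrier H" "r' x y" and c: "c = B +>\<^bsub>G\<^esub> x"
      and xy': "x' \<in> carrier G" "y' \<in> carrier H" "r' x' y'" and c': "c' = B +>\<^bsub>G\<^esub> x'"
      by blast
    have "y \<ominus>\<^bsub>H\<^esub> y' \<in> C"
      using eq unfolding c c' map_coset[OF xy] map_coset[OF xy'] a_r_coset_eq_iff[OF H C xy(2) xy'(2)] .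
    then have "x \<ominus>\<^bsub>G\<^esub> x' \<in> B"
      using iff[OF G.minus_closed[OF xy(1) xy'(1)] H.minus_closed[OF xy(2) xy'(2)]
          minus[OF xy(1,2) xy'(1,2) xy(3) xy'(3)]] by simp
    then show "c = c'" unfolding c c' a_r_coset_eq_iff[OF G B xy(1) xy'(1)] .
  qed
  moreover have "?F ` carrier (quotient_module G B) = carrier (quotient_module H C)"
  proof
    show "?F ` carrier (quotient_module G B) \<subseteq> carrier (quotient_module H C)"
      using mod_hom_closed[OF hom] by (rule image_subsetI)
    show "carrier (quotient_module H C) \<subseteq> ?F ` carrier (quotient_module G B)"
    proof
      fix d assume "d \<in> carrier (quotient_module H C)"
      then obtain y where y: "y \<in> carrier H" "d = C +>\<^bsub>H\<^esub> y" unfolding quotient_module_carrier by blast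
      obtain x where x: "x \<in> carrier G" "r' x y" using surj[OF y(1)] by blast
      have "B +>\<^bsub>G\<^esub> x \<in> carrier (quotient_module G B)" unfolding quotient_module_carrier using x(1) by blast
      then show "d \<in> ?F ` carrier (quotient_module G B)"
        unfolding y(2) map_coset[OF x(1) y(1) x(2), symmetric] by (rule imageI)
    qed
  qed
  ultimately show ?thesis using hom by (simp add: mod_iso_def bij_betw_def)
qed

text \<open>Linearity of the inverse is obtained by applying \<open>G\<close> to both sides. Closure
  of \<open>L\<close> under its operations is what lets the sum or multiple of preimages count as a
  preimage.\<close>

lemma mod_iso_inv_comp:
  assumes F: "F \<in> mod_iso K M N" and G: "G \<in> mod_iso K L N"
    and add: "\<And>x y. \<lbrakk>x \<in> carrier L; y \<in> carrier L\<rbrakk> \<Longrightarrow> x \<oplus>\<^bsub>L\<^esub> y \<in> carrier L"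
    and smult: "\<And>a x. \<lbrakk>a \<in> carrier K; x \<in> carrier L\<rbrakk> \<Longrightarrow> a \<odot>\<^bsub>L\<^esub> x \<in> carrier L"
  shows "(\<lambda>x. inv_into (carrier L) G (F x)) \<in> mod_iso K M L"
proof -
  let ?I = "inv_into (carrier L) G"
  have F_hom: "F \<in> mod_hom K M N" and F_bij: "bij_betw F (carrier M) (carrier N)"
    and G_hom: "G \<in> mod_hom K L N" and G_bij: "bij_betw G (carrier L) (carrier N)"
    using F G by (auto simp: mod_iso_def)
  have I_bij: "bij_betw ?I (carrier N) (carrier L)" by (rule bij_betw_inv_into[OF G_bij])
  have I_closed: "?I y \<in> carrier L" and GI: "G (?I y) = y" if "y \<in> carrier N" for y
    using bij_betwE[OF I_bij] bij_betw_inv_into_right[OF G_bij] that by auto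
  have IG: "?I (G x) = x" if "x \<in> carrier L" for x
    by (rule bij_betw_inv_into_left[OF G_bij that])
  have "?I \<in> mod_hom K N L"
  proof (rule mod_homI)
    fix x y assume xy: "x \<in> carrier N" "y \<in> carrier N"
    have "x \<oplus>\<^bsub>N\<^esub> y = G (?I x \<oplus>\<^bsub>L\<^esub> ?I y)"
      using xy by (simp add: mod_hom_add[OF G_hom] I_closed GI)
    then show "?I (x \<oplus>\<^bsub>N\<^esub> y) = ?I x \<oplus>\<^bsub>L\<^esub> ?I y"
      using xy by (simp add: IG add I_closed)
  next
    fix a x assume ax: "a \<in> carrier K" "x \<in> carrier N"
    have "a \<odot>\<^bsub>N\<^esub> x = G (a \<odot>\<^bsub>L\<^esub> ?I x)"
      using ax by (simp add: mod_hom_smult[OF G_hom] I_closed GI)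
    then show "?I (a \<odot>\<^bsub>N\<^esub> x) = a \<odot>\<^bsub>L\<^esub> ?I x"
      using ax by (simp add: IG smult I_closed)
  qed (rule I_closed)
  then have "(\<lambda>x. ?I (F x)) \<in> mod_hom K M L" by (rule mod_hom_comp[OF F_hom])
  moreover have "bij_betw (\<lambda>x. ?I (F x)) (carrier M) (carrier L)"
    using bij_betw_trans[OF F_bij I_bij] by (simp add: comp_def)
  ultimately show ?thesis by (simp add: mod_iso_def)
qed


section \<open>Hom and Ext as modules over the ground field\<close>

context fin_dim_algebra
begin

lemma scalar_closed: "c \<in> carrier K \<Longrightarrow> c \<odot>\<^bsub>A\<^esub> \<one>\<^bsub>A\<^esub> \<in> carrier A"
  by simp

text \<open>The two compatibility axioms move the scalar through either factor, so multiples of the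
  unit are central.\<close>

lemma scalar_commute:
  assumes "c \<in> carrier K" "a \<in> carrier A"
  shows "(c \<odot>\<^bsub>A\<^esub> \<one>\<^bsub>A\<^esub>) \<otimes>\<^bsub>A\<^esub> a = a \<otimes>\<^bsub>A\<^esub> (c \<odot>\<^bsub>A\<^esub> \<one>\<^bsub>A\<^esub>)"
  using smult_mult_left[of c "\<one>\<^bsub>A\<^esub>" a] smult_mult_right[of c a "\<one>\<^bsub>A\<^esub>"] assms by simp

lemma scalar_mult:
  assumes "c \<in> carrier K" "d \<in> carrier K"
  shows "(c \<otimes>\<^bsub>K\<^esub> d) \<odot>\<^bsub>A\<^esub> \<one>\<^bsub>A\<^esub> = (c \<odot>\<^bsub>A\<^esub> \<one>\<^bsub>A\<^esub>) \<otimes>\<^bsub>A\<^esub> (d \<odot>\<^bsub>A\<^esub> \<one>\<^bsub>A\<^esub>)"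
  using smult_mult_left[of c "\<one>\<^bsub>A\<^esub>" "d \<odot>\<^bsub>A\<^esub> \<one>\<^bsub>A\<^esub>"] assms by (simp add: smult_assoc1)

text \<open>Linearity over \<open>A\<close> survives because the acting element is central. An
  arbitrary element of \<open>A\<close> would not act this way, so Hom and Ext are modules over
  \<open>K\<close> only.\<close>

lemma mod_hom_scalar_map:
  assumes N: "left_module A N" and f: "f \<in> mod_hom A M N" and c: "c \<in> carrier K"
  shows "(\<lambda>x. (c \<odot>\<^bsub>A\<^esub> \<one>\<^bsub>A\<^esub>) \<odot>\<^bsub>N\<^esub> f x) \<in> mod_hom A M N"
proof -
  interpret N: left_module A N by (rule N)
  let ?z = "c \<odot>\<^bsub>A\<^esub> \<one>\<^bsub>A\<^esub>"
  have z: "?z \<in> carrier A" by (rule scalar_closed[OF c])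
  show ?thesis
  proof (rule mod_homI)
    fix x assume "x \<in> carrier M"
    then show "?z \<odot>\<^bsub>N\<^esub> f x \<in> carrier N" by (intro N.smult_closed z mod_hom_closed[OF f])
  next
    fix x y assume "x \<in> carrier M" "y \<in> carrier M"
    then show "?z \<odot>\<^bsub>N\<^esub> f (x \<oplus>\<^bsub>M\<^esub> y) = ?z \<odot>\<^bsub>N\<^esub> f x \<oplus>\<^bsub>N\<^esub> ?z \<odot>\<^bsub>N\<^esub> f y"
      by (simp add: mod_hom_add[OF f] N.smult_r_distr[OF z] mod_hom_closed[OF f])
  next
    fix a x assume a: "a \<in> carrier A" and x: "x \<in> carrier M"
    have fx: "f x \<in> carrier N" by (rule mod_hom_closed[OF f x])
    have "?z \<odot>\<^bsub>N\<^esub> f (a \<odot>\<^bsub>M\<^esub> x) = (?z \<otimes>\<^bsub>A\<^esub> a) \<odot>\<^bsub>N\<^esub> f x"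
      unfolding mod_hom_smult[OF f a x] by (rule N.smult_assoc[OF z a fx, symmetric])
    also have "\<dots> = a \<odot>\<^bsub>N\<^esub> (?z \<odot>\<^bsub>N\<^esub> f x)"
      unfolding scalar_commute[OF c a] by (rule N.smult_assoc[OF a z fx])
    finally show "?z \<odot>\<^bsub>N\<^esub> f (a \<odot>\<^bsub>M\<^esub> x) = a \<odot>\<^bsub>N\<^esub> (?z \<odot>\<^bsub>N\<^esub> f x)" .
  qed
qed

lemma Hom_module_simps [simp]:
  "\<zero>\<^bsub>Hom_module A M N\<^esub> = (\<lambda>x\<in>carrier M. \<zero>\<^bsub>N\<^esub>)"
  "f \<oplus>\<^bsub>Hom_module A M N\<^esub> g = (\<lambda>x\<in>carrier M. f x \<oplus>\<^bsub>N\<^esub> g x)"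
  "c \<odot>\<^bsub>Hom_module A M N\<^esub> f = (\<lambda>x\<in>carrier M. (c \<odot>\<^bsub>A\<^esub> \<one>\<^bsub>A\<^esub>) \<odot>\<^bsub>N\<^esub> f x)"
  by (simp_all add: Hom_module_def)

lemma Hom_module_carrier:
  "f \<in> carrier (Hom_module A M N) \<longleftrightarrow> f \<in> mod_hom A M N \<and> f \<in> extensional (carrier M)"
  by (simp add: Hom_module_def)

lemma restrict_in_Hom_module:
  assumes "left_module A M" "f \<in> mod_hom A M N"
  shows "restrict f (carrier M) \<in> carrier (Hom_module A M N)"
  unfolding Hom_module_carrier using mod_hom_restrict[OF assms] by simp

lemma left_module_Hom_module:
  fixes M :: "('a, 'm) module" and N :: "('a, 'n) module"
  assumes M: "left_module A M" and N: "left_module A N"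
  shows "left_module K (Hom_module A M N)"
proof -
  interpret N: left_module A N by (rule N)
  let ?H = "Hom_module A M N"
  have c: "f x \<in> carrier N" if "f \<in> carrier ?H" "x \<in> carrier M" for f x
    using that mod_hom_closed[of f A M N x] unfolding Hom_module_carrier by simp
  have eqI: "f = g" if "f \<in> extensional (carrier M)" "g \<in> extensional (carrier M)"
    "\<And>x. x \<in> carrier M \<Longrightarrow> f x = g x" for f g :: "'m \<Rightarrow> 'n"
    using that by (rule extensionalityI)
  have ext: "f \<in> extensional (carrier M)" if "f \<in> carrier ?H" for f
    using that unfolding Hom_module_carrier by simp
  note z = scalar_closed
  show ?thesis
  proof (intro left_module.intro left_module_axioms.intro abelian_groupI)
    show "ring K" by (rule K.ring_axioms)
  next
    fix f g assume "f \<in> carrier ?H" "g \<in> carrier ?H"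
    then show "f \<oplus>\<^bsub>?H\<^esub> g \<in> carrier ?H"
      unfolding Hom_module_simps by (intro restrict_in_Hom_module[OF M] mod_hom_add_map[OF N]) (simp_all add: Hom_module_carrier)
  next
    show "\<zero>\<^bsub>?H\<^esub> \<in> carrier ?H"
      unfolding Hom_module_simps by (rule restrict_in_Hom_module[OF M mod_hom_zero_map[OF N]])
  next
    fix f g h assume f: "f \<in> carrier ?H" "g \<in> carrier ?H" "h \<in> carrier ?H"
    show "f \<oplus>\<^bsub>?H\<^esub> g \<oplus>\<^bsub>?H\<^esub> h = f \<oplus>\<^bsub>?H\<^esub> (g \<oplus>\<^bsub>?H\<^esub> h)"
      by (rule eqI) (simp_all add: c[OF f(1)] c[OF f(2)] c[OF f(3)] N.a_assoc)
  next
    fix f g assume f: "f \<in> carrier ?H" "g \<in> carrier ?H"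
    show "f \<oplus>\<^bsub>?H\<^esub> g = g \<oplus>\<^bsub>?H\<^esub> f"
      by (rule eqI) (simp_all add: c[OF f(1)] c[OF f(2)] N.a_comm)
  next
    fix f assume f: "f \<in> carrier ?H"
    show "\<zero>\<^bsub>?H\<^esub> \<oplus>\<^bsub>?H\<^esub> f = f"
      by (rule eqI) (simp_all add: c[OF f] ext[OF f])
    let ?g = "\<lambda>x\<in>carrier M. \<zero>\<^bsub>N\<^esub> \<ominus>\<^bsub>N\<^esub> f x"
    have "?g \<in> carrier ?H"
      using f by (intro restrict_in_Hom_module[OF M] mod_hom_minus_map[OF N] mod_hom_zero_map[OF N]) (simp_all add: Hom_module_carrier)
    moreover have "?g \<oplus>\<^bsub>?H\<^esub> f = \<zero>\<^bsub>?H\<^esub>"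
      by (rule eqI) (simp_all add: c[OF f] N.minus_add_cancel)
    ultimately show "\<exists>g\<in>carrier ?H. g \<oplus>\<^bsub>?H\<^esub> f = \<zero>\<^bsub>?H\<^esub>" by (intro bexI[of _ ?g])
  next
    fix a f assume a: "a \<in> carrier K" and f: "f \<in> carrier ?H"
    show "a \<odot>\<^bsub>?H\<^esub> f \<in> carrier ?H"
      unfolding Hom_module_simps using f
      by (intro restrict_in_Hom_module[OF M] mod_hom_scalar_map[OF N _ a]) (simp add: Hom_module_carrier)
  next
    fix a b f assume a: "a \<in> carrier K" "b \<in> carrier K" and f: "f \<in> carrier ?H"
    show "(a \<oplus>\<^bsub>K\<^esub> b) \<odot>\<^bsub>?H\<^esub> f = a \<odot>\<^bsub>?H\<^esub> f \<oplus>\<^bsub>?H\<^esub> b \<odot>\<^bsub>?H\<^esub> f"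
      by (rule eqI) (simp_all add: a c[OF f] smult_l_distr N.smult_l_distr)
    show "(a \<otimes>\<^bsub>K\<^esub> b) \<odot>\<^bsub>?H\<^esub> f = a \<odot>\<^bsub>?H\<^esub> (b \<odot>\<^bsub>?H\<^esub> f)"
      by (rule eqI) (simp_all add: a c[OF f] scalar_mult N.smult_assoc)
  next
    fix a f g assume a: "a \<in> carrier K" and f: "f \<in> carrier ?H" "g \<in> carrier ?H"
    show "a \<odot>\<^bsub>?H\<^esub> (f \<oplus>\<^bsub>?H\<^esub> g) = a \<odot>\<^bsub>?H\<^esub> f \<oplus>\<^bsub>?H\<^esub> a \<odot>\<^bsub>?H\<^esub> g"
      by (rule eqI) (simp_all add: a c[OF f(1)] c[OF f(2)] N.smult_r_distr)
  next
    fix f assume f: "f \<in> carrier ?H"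
    show "\<one>\<^bsub>K\<^esub> \<odot>\<^bsub>?H\<^esub> f = f"
      by (rule eqI) (simp_all add: c[OF f] ext[OF f] N.smult_one)
  qed
qed

section \<open>Cocycles and coboundaries as submodules of Hom\<close>

lemma cocycles_iff:
  "f \<in> cocycles A S n V \<longleftrightarrow> is_cocycle A S n V f \<and> f \<in> extensional (carrier (obj S n))"
  by (auto simp: cocycles_def is_cocycle_def Hom_module_carrier)

lemma restrict_cocycle:
  assumes S: "projective_resolution A S U" and f: "is_cocycle A S n V f"
  shows "restrict f (carrier (obj S n)) \<in> cocycles A S n V"
  unfolding cocycles_iff is_cocycle_def
  using mod_hom_restrict[OF resolution_left_module[OF S] is_cocycle_hom[OF f]] is_cocycle_bd[OF f]
    resolution_bd_closed[OF S] by simp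

text \<open>A bounding map may be restricted to its carrier, because \<open>bd S m\<close> takes its
  values there; this reconciles the extensional maps of \<open>Hom_module\<close> with the
  unrestricted ones of \<open>is_coboundary\<close>.\<close>

lemma coboundaries_iff:
  assumes S: "projective_resolution A S U"
  shows "f \<in> coboundaries A S (Suc m) V \<longleftrightarrow>
    is_coboundary A S m V f \<and> f \<in> extensional (carrier (obj S (Suc m)))"
proof
  assume "f \<in> coboundaries A S (Suc m) V"
  then obtain g where "g \<in> mod_hom A (obj S m) V" "f = (\<lambda>x\<in>carrier (obj S (Suc m)). g (bd S m x))"
    by (auto simp: coboundaries_def Hom_module_carrier)
  then show "is_coboundary A S m V f \<and> f \<in> extensional (carrier (obj S (Suc m)))"
    by (auto intro: is_coboundaryI)
next
  assume f: "is_coboundary A S m V f \<and> f \<in> extensional (carrier (obj S (Suc m)))"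
  then obtain g where g: "g \<in> mod_hom A (obj S m) V" "\<forall>x\<in>carrier (obj S (Suc m)). f x = g (bd S m x)"
    by (auto simp: is_coboundary_def)
  let ?g = "restrict g (carrier (obj S m))"
  have "?g \<in> carrier (Hom_module A (obj S m) V)"
    by (rule restrict_in_Hom_module[OF resolution_left_module[OF S] g(1)])
  moreover have "f = (\<lambda>x\<in>carrier (obj S (Suc m)). ?g (bd S m x))"
    by (rule extensionalityI[of _ "carrier (obj S (Suc m))"])
      (use f g(2) resolution_bd_closed[OF S] in auto)
  ultimately show "f \<in> coboundaries A S (Suc m) V"
    unfolding coboundaries_def by (auto intro!: exI[of _ ?g])
qed

abbreviation cocycle_module ::
  "('a, 'x, 'u) aug_complex \<Rightarrow> nat \<Rightarrow> ('a, 'v) module \<Rightarrow> ('k, 'x \<Rightarrow> 'v) module" where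
  "cocycle_module S n V \<equiv> (Hom_module A (obj S n) V)\<lparr>carrier := cocycles A S n V\<rparr>"

lemma cocycles_submodule:
  assumes S: "projective_resolution A S U" and V: "left_module A V"
  shows "submodule (cocycles A S n V) K (Hom_module A (obj S n) V)"
proof -
  interpret H: left_module K "Hom_module A (obj S n) V"
    by (rule left_module_Hom_module[OF resolution_left_module[OF S] V])
  interpret V: left_module A V by (rule V)
  note bd = resolution_bd_closed[OF S, of _ n]
  show ?thesis
  proof (rule H.left_submoduleI)
    show "cocycles A S n V \<subseteq> carrier (Hom_module A (obj S n) V)"
      by (auto simp: cocycles_def)
    show "\<zero>\<^bsub>Hom_module A (obj S n) V\<^esub> \<in> cocycles A S n V"
      using H.zero_closed bd by (simp add: cocycles_def)
  next
    fix f g assume "f \<in> cocycles A S n V" "g \<in> cocycles A S n V"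
    then show "f \<oplus>\<^bsub>Hom_module A (obj S n) V\<^esub> g \<in> cocycles A S n V"
      using H.a_closed[of f g] bd by (simp add: cocycles_def)
  next
    fix c f assume "c \<in> carrier K" "f \<in> cocycles A S n V"
    then show "c \<odot>\<^bsub>Hom_module A (obj S n) V\<^esub> f \<in> cocycles A S n V"
      using H.smult_closed[of c f] bd V.smult_zero_right[OF scalar_closed] by (simp add: cocycles_def)
  qed
qed

lemma left_module_cocycle_module:
  assumes "projective_resolution A S U" "left_module A V"
  shows "left_module K (cocycle_module S n V)"
  by (intro left_module_submodule[OF left_module_Hom_module[OF resolution_left_module[OF assms(1)] assms(2)]]
      cocycles_submodule[OF assms])

lemma is_coboundary_scalar:
  assumes V: "left_module A V" and f: "is_coboundary A S m V f" and c: "c \<in> carrier K"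
  shows "is_coboundary A S m V (\<lambda>x. (c \<odot>\<^bsub>A\<^esub> \<one>\<^bsub>A\<^esub>) \<odot>\<^bsub>V\<^esub> f x)"
proof -
  obtain g where g: "g \<in> mod_hom A (obj S m) V" "\<forall>x\<in>carrier (obj S (Suc m)). f x = g (bd S m x)"
    using f by (auto simp: is_coboundary_def)
  show ?thesis
    by (rule is_coboundaryI[OF mod_hom_scalar_map[OF V g(1) c]]) (simp add: g(2))
qed

lemma coboundaries_subset_cocycles:
  assumes S: "projective_resolution A S U" and V: "left_module A V"
  shows "coboundaries A S (Suc m) V \<subseteq> cocycles A S (Suc m) V"
proof
  fix f assume "f \<in> coboundaries A S (Suc m) V"
  then have ext: "f \<in> extensional (carrier (obj S (Suc m)))" and "is_coboundary A S m V f"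
    by (simp_all add: coboundaries_iff[OF S])
  then obtain g where g: "g \<in> mod_hom A (obj S m) V" "\<forall>x\<in>carrier (obj S (Suc m)). f x = g (bd S m x)"
    by (auto simp: is_coboundary_def)
  note L = resolution_left_module[OF S]
  have "f \<in> mod_hom A (obj S (Suc m)) V"
    by (rule mod_hom_cong[OF L mod_hom_comp[OF resolution_bd_hom[OF S] g(1)]]) (simp add: g(2))
  moreover have "f (bd S (Suc m) x) = \<zero>\<^bsub>V\<^esub>" if x: "x \<in> carrier (obj S (Suc (Suc m)))" for x
    using bspec[OF g(2) resolution_bd_closed[OF S x]] resolution_bd_bd[OF S x] mod_hom_zero[OF L V g(1)] by simp
  ultimately show "f \<in> cocycles A S (Suc m) V"
    unfolding cocycles_iff is_cocycle_def using ext by simp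
qed

lemma coboundaries_submodule:
  assumes S: "projective_resolution A S U" and V: "left_module A V"
  shows "submodule (coboundaries A S (Suc m) V) K (cocycle_module S (Suc m) V)"
proof -
  interpret Z: left_module K "cocycle_module S (Suc m) V"
    by (rule left_module_cocycle_module[OF S V])
  show ?thesis
  proof (rule Z.left_submoduleI)
    show "coboundaries A S (Suc m) V \<subseteq> carrier (cocycle_module S (Suc m) V)"
      using coboundaries_subset_cocycles[OF S V] by simp
    have "is_coboundary A S m V (\<lambda>x\<in>carrier (obj S (Suc m)). \<zero>\<^bsub>V\<^esub>)"
      by (rule is_coboundaryI[OF mod_hom_zero_map[OF V]]) simp
    then show "\<zero>\<^bsub>cocycle_module S (Suc m) V\<^esub> \<in> coboundaries A S (Suc m) V"
      by (simp add: coboundaries_iff[OF S])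
  next
    fix f g assume "f \<in> coboundaries A S (Suc m) V" "g \<in> coboundaries A S (Suc m) V"
    then have "is_coboundary A S m V (\<lambda>x. f x \<oplus>\<^bsub>V\<^esub> g x)"
      by (intro is_coboundary_add[OF V]) (simp_all add: coboundaries_iff[OF S])
    then have "is_coboundary A S m V (\<lambda>x\<in>carrier (obj S (Suc m)). f x \<oplus>\<^bsub>V\<^esub> g x)"
      by (rule is_coboundary_cong) simp
    then show "f \<oplus>\<^bsub>cocycle_module S (Suc m) V\<^esub> g \<in> coboundaries A S (Suc m) V"
      by (simp add: coboundaries_iff[OF S])
  next
    fix c f assume c: "c \<in> carrier K" and f: "f \<in> coboundaries A S (Suc m) V"
    have "is_coboundary A S m V (\<lambda>x. (c \<odot>\<^bsub>A\<^esub> \<one>\<^bsub>A\<^esub>) \<odot>\<^bsub>V\<^esub> f x)"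
      by (rule is_coboundary_scalar[OF V _ c]) (use f in \<open>simp add: coboundaries_iff[OF S]\<close>)
    then have "is_coboundary A S m V (\<lambda>x\<in>carrier (obj S (Suc m)). (c \<odot>\<^bsub>A\<^esub> \<one>\<^bsub>A\<^esub>) \<odot>\<^bsub>V\<^esub> f x)"
      by (rule is_coboundary_cong) simp
    then show "c \<odot>\<^bsub>cocycle_module S (Suc m) V\<^esub> f \<in> coboundaries A S (Suc m) V"
      by (simp add: coboundaries_iff[OF S])
  qed
qed

end


section \<open>Composition with a truncated projective resolution\<close>

lemma syzygy_Suc: "syzygy E (Suc k) = (obj E k)\<lparr>carrier := bd E k ` carrier (obj E (Suc k))\<rparr>"
  by (simp add: syzygy_def)

lemma syzygy_submodule:
  "projective_resolution R E V \<Longrightarrow> submodule (bd E k ` carrier (obj E (Suc k))) R (obj E k)"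
  by (rule mod_hom_image_submodule[OF resolution_left_module resolution_left_module resolution_bd_hom])

lemma left_module_syzygy: "projective_resolution R E V \<Longrightarrow> left_module R (syzygy E (Suc k))"
  unfolding syzygy_Suc by (rule left_module_submodule[OF resolution_left_module syzygy_submodule])

lemma syzygy_0_eq_kernel:
  "projective_resolution R E V \<Longrightarrow>
    syzygy E (Suc 0) = (obj E 0)\<lparr>carrier := a_kernel (obj E 0) V (aug E)\<rparr>"
  by (simp add: syzygy_Suc resolution_aug_exact)

text \<open>Brings each piece of the truncation into the shape of a short exact sequence, with the
  kernel of a surjection onto the preceding syzygy, as the analysis of a single connecting map
  expects.\<close>

lemma syzygy_Suc_eq_kernel:
  "projective_resolution R E V \<Longrightarrow>
    syzygy E (Suc (Suc k)) = (obj E (Suc k))\<lparr>carrier := a_kernel (obj E (Suc k)) (syzygy E (Suc k)) (bd E k)\<rparr>"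
  by (simp add: syzygy_Suc[of E "Suc k"] resolution_exact a_kernel_def kernel_def syzygy_Suc)

lemma resolution_bd_hom_syzygy:
  assumes "projective_resolution R E V"
  shows "bd E k \<in> mod_hom R (obj E (Suc k)) (syzygy E (Suc k))"
  unfolding syzygy_Suc by (rule mod_hom_into_subset[OF resolution_bd_hom[OF assms]]) simp

text \<open>The connecting map \<open>Ext\<^bsup>m+1\<^esup>(U, V) \<rightarrow> Ext\<^bsup>m+2\<^esup>(U, Ker p)\<close> of \<open>p : Q \<rightarrow> V\<close> is injective if
  \<open>Ext\<^bsup>m+1\<^esup>(U, Q) = 0\<close>.\<close>

lemma connecting_coboundary_iff:
  assumes S: "projective_resolution R S U" and Q: "left_module R Q" and V: "left_module R V"
    and p: "p \<in> mod_hom R Q V" "p ` carrier Q = carrier V"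
    and \<phi>: "\<phi> \<in> mod_hom R (obj S (Suc m)) Q" and vanish: "ext_vanishes R S m Q"
  shows "is_coboundary R S m V (\<lambda>x. p (\<phi> x)) \<longleftrightarrow>
    is_coboundary R S (Suc m) (Q\<lparr>carrier := a_kernel Q V p\<rparr>) (\<lambda>x. \<phi> (bd S (Suc m) x))"
proof
  interpret Q: left_module R Q by (rule Q)
  interpret V: left_module R V by (rule V)
  note L = resolution_left_module[OF S] and bd = resolution_bd_hom[OF S]
  note \<phi>_closed = mod_hom_closed[OF \<phi>] and p_closed = mod_hom_closed[OF p(1)]
  {
    assume "is_coboundary R S m V (\<lambda>x. p (\<phi> x))"
    then obtain u where u: "u \<in> mod_hom R (obj S m) V" "\<forall>x\<in>carrier (obj S (Suc m)). p (\<phi> x) = u (bd S m x)"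
      by (auto simp: is_coboundary_def)
    have "u x \<in> p ` carrier Q" if "x \<in> carrier (obj S m)" for x
      unfolding p(2) by (rule mod_hom_closed[OF u(1) that])
    from projective_lift[OF resolution_projective[OF S] Q V p(1) u(1) this]
    obtain v where v: "v \<in> mod_hom R (obj S m) Q" "\<forall>x\<in>carrier (obj S m). p (v x) = u x" by blast
    have vb: "(\<lambda>x. v (bd S m x)) \<in> mod_hom R (obj S (Suc m)) Q" by (rule mod_hom_comp[OF bd v(1)])
    \<comment> \<open>The map \<open>v\<close> lifts \<open>u\<close> through \<open>p\<close>.
      Subtracting \<open>v\<close> after the boundary moves the values of \<open>\<phi>\<close> into
      the kernel of \<open>p\<close> and leaves \<open>\<phi>\<close> unchanged on
      boundaries.\<close>
    let ?w = "\<lambda>x. \<phi> x \<ominus>\<^bsub>Q\<^esub> v (bd S m x)"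
    have "?w \<in> mod_hom R (obj S (Suc m)) (Q\<lparr>carrier := a_kernel Q V p\<rparr>)"
    proof (rule mod_hom_into_subset[OF mod_hom_minus_map[OF Q \<phi> vb]])
      fix x assume x: "x \<in> carrier (obj S (Suc m))"
      note 1 = \<phi>_closed[OF x] and 2 = mod_hom_closed[OF vb x]
      have "p (?w x) = p (\<phi> x) \<ominus>\<^bsub>V\<^esub> p (v (bd S m x))" by (rule mod_hom_minus[OF Q V p(1) 1 2])
      also have "\<dots> = \<zero>\<^bsub>V\<^esub>"
        using u(2) v(2) x resolution_bd_closed[OF S x] p_closed[OF 1] p_closed[OF 2] by (simp add: V.minus_eq_zero_iff)
      finally show "?w x \<in> a_kernel Q V p" using 1 2 by (simp add: a_kernel_iff)
    qed
    then show "is_coboundary R S (Suc m) (Q\<lparr>carrier := a_kernel Q V p\<rparr>) (\<lambda>x. \<phi> (bd S (Suc m) x))"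
    proof (rule is_coboundaryI)
      fix x assume x: "x \<in> carrier (obj S (Suc (Suc m)))"
      show "\<phi> (bd S (Suc m) x) = \<phi> (bd S (Suc m) x) \<ominus>\<^bsub>Q\<^esub> v (bd S m (bd S (Suc m) x))"
        unfolding resolution_bd_bd[OF S x] mod_hom_zero[OF L Q v(1)]
        using \<phi>_closed[OF resolution_bd_closed[OF S x]] by (simp add: a_minus_def)
    qed
  next
    assume "is_coboundary R S (Suc m) (Q\<lparr>carrier := a_kernel Q V p\<rparr>) (\<lambda>x. \<phi> (bd S (Suc m) x))"
    then obtain w where w': "w \<in> mod_hom R (obj S (Suc m)) (Q\<lparr>carrier := a_kernel Q V p\<rparr>)"
      "\<forall>x\<in>carrier (obj S (Suc (Suc m))). \<phi> (bd S (Suc m) x) = w (bd S (Suc m) x)"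
      by (auto simp: is_coboundary_def)
    have w: "w \<in> mod_hom R (obj S (Suc m)) Q"
      by (rule mod_hom_from_subset[OF w'(1)]) (auto simp: a_kernel_iff)
    have pw: "p (w x) = \<zero>\<^bsub>V\<^esub>" if "x \<in> carrier (obj S (Suc m))" for x
      using mod_hom_closed[OF w'(1) that] by (simp add: a_kernel_iff)
    \<comment> \<open>So \<open>\<phi>\<close> minus \<open>w\<close> is a cocycle with values in
      \<open>Q\<close>, hence a coboundary by \<open>vanish\<close>. Applying \<open>p\<close>
      removes \<open>w\<close>, whose values lie in the kernel.\<close>
    have "\<phi> (bd S (Suc m) x) \<ominus>\<^bsub>Q\<^esub> w (bd S (Suc m) x) = \<zero>\<^bsub>Q\<^esub>"
      if x: "x \<in> carrier (obj S (Suc (Suc m)))" for x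
      using w'(2) x \<phi>_closed[OF resolution_bd_closed[OF S x]] by (simp add: Q.minus_eq_zero_iff)
    from ext_vanishesD[OF vanish mod_hom_minus_map[OF Q \<phi> w] this]
    obtain v where v: "v \<in> mod_hom R (obj S m) Q"
      "\<forall>x\<in>carrier (obj S (Suc m)). \<phi> x \<ominus>\<^bsub>Q\<^esub> w x = v (bd S m x)" by blast
    show "is_coboundary R S m V (\<lambda>x. p (\<phi> x))"
    proof (rule is_coboundaryI[OF mod_hom_comp[OF v(1) p(1)]])
      fix x assume x: "x \<in> carrier (obj S (Suc m))"
      note 1 = \<phi>_closed[OF x] and 2 = mod_hom_closed[OF w x]
      have "p (v (bd S m x)) = p (\<phi> x) \<ominus>\<^bsub>V\<^esub> p (w x)"
        unfolding bspec[OF v(2) x, symmetric] by (rule mod_hom_minus[OF Q V p(1) 1 2])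
      then show "p (\<phi> x) = p (v (bd S m x))"
        using p_closed[OF 1] pw[OF x] by (simp add: a_minus_def)
    qed
  }
qed

lemma chain_lift_mono: "\<lbrakk>chain_lift R S m f E l \<phi>; l' \<le> l\<rbrakk> \<Longrightarrow> chain_lift R S m f E l' \<phi>"
  by (auto simp: chain_lift_def)

text \<open>Each component of the chain lift realises one connecting map on cocycles, and the
  commuting squares make consecutive ones match. Crossing \<open>obj E j\<close> needs vanishing of
  Ext into it in degree \<open>m + j + 1\<close>.\<close>

lemma chain_lift_coboundary_iff:
  assumes S: "projective_resolution R S U" and E: "projective_resolution R E V" and V: "left_module R V"
    and vanish: "\<And>j. ext_vanishes R S (m + j) (obj E j)"
    and \<phi>: "chain_lift R S (Suc m) f E (Suc k) \<phi>"
  shows "is_coboundary R S m V f \<longleftrightarrow>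
    is_coboundary R S (Suc (m + k)) (syzygy E (Suc k)) (\<lambda>x. \<phi> k (bd S (Suc (m + k)) x))"
  using \<phi>
proof (induction k)
  case 0
  have "is_coboundary R S m V f \<longleftrightarrow> is_coboundary R S m V (\<lambda>x. aug E (\<phi> 0 x))"
    using chain_lift_aug[OF 0] by (auto elim!: is_coboundary_cong)
  also have "\<dots> \<longleftrightarrow> is_coboundary R S (Suc m) (syzygy E (Suc 0)) (\<lambda>x. \<phi> 0 (bd S (Suc m) x))"
    unfolding syzygy_0_eq_kernel[OF E]
    by (rule connecting_coboundary_iff[OF S resolution_left_module[OF E] V resolution_aug_hom[OF E] resolution_aug_surj[OF E]])
      (use chain_lift_hom[OF 0, of 0] vanish[of 0] in simp_all)
  finally show ?case by simp
next
  case (Suc k)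
  have "is_coboundary R S m V f \<longleftrightarrow>
    is_coboundary R S (Suc (m + k)) (syzygy E (Suc k)) (\<lambda>x. \<phi> k (bd S (Suc (m + k)) x))"
    by (rule Suc.IH[OF chain_lift_mono[OF Suc.prems]]) simp
  also have "\<dots> \<longleftrightarrow> is_coboundary R S (Suc (m + k)) (syzygy E (Suc k)) (\<lambda>x. bd E k (\<phi> (Suc k) x))"
    using chain_lift_bd[OF Suc.prems, of k] by (auto elim!: is_coboundary_cong)
  also have "\<dots> \<longleftrightarrow> is_coboundary R S (Suc (Suc (m + k))) (syzygy E (Suc (Suc k)))
      (\<lambda>x. \<phi> (Suc k) (bd S (Suc (Suc (m + k))) x))"
    unfolding syzygy_Suc_eq_kernel[OF E]
    by (rule connecting_coboundary_iff[OF S resolution_left_module[OF E] left_module_syzygy[OF E]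
          resolution_bd_hom_syzygy[OF E]])
      (use chain_lift_hom[OF Suc.prems, of "Suc k"] vanish[of "Suc k"] in \<open>simp_all add: syzygy_Suc\<close>)
  finally show ?case by simp
qed

text \<open>The diagram is built from its far end. As a map into \<open>obj E k\<close> the cocycle
  \<open>g\<close> is a coboundary by \<open>vanish\<close>, and a bounding map is the component in
  degree \<open>k\<close>. Composed with \<open>bd E k\<close>, or with the augmentation when
  \<open>k = 0\<close>, it gives a cocycle one step closer to \<open>V\<close>.\<close>

lemma chain_lift_surjective:
  assumes S: "projective_resolution R S U" and E: "projective_resolution R E V" and V: "left_module R V"
    and vanish: "\<And>j. ext_vanishes R S (n + j) (obj E j)"
    and g: "is_cocycle R S (Suc (n + k)) (syzygy E (Suc k)) g"
  shows "\<exists>f \<phi>. is_cocycle R S n V f \<and> chain_lift R S n f E (Suc k) \<phi> \<and>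
    (\<forall>x\<in>carrier (obj S (Suc (n + k))). g x = \<phi> k (bd S (n + k) x))"
  using g
proof (induction k arbitrary: g)
  case 0
  note g_hom = is_cocycle_hom[OF 0, unfolded syzygy_Suc]
  have "g \<in> mod_hom R (obj S (Suc n)) (obj E 0)"
    using mod_hom_from_subset[OF g_hom submodule_subset[OF syzygy_submodule[OF E]]] by simp
  from ext_vanishesD[OF vanish[of 0, simplified] this] is_cocycle_bd[OF 0]
  obtain \<phi> where \<phi>: "\<phi> \<in> mod_hom R (obj S n) (obj E 0)" "\<forall>x\<in>carrier (obj S (Suc n)). g x = \<phi> (bd S n x)"
    by (auto simp: syzygy_Suc)
  have "aug E (\<phi> (bd S n x)) = \<zero>\<^bsub>V\<^esub>" if x: "x \<in> carrier (obj S (Suc n))" for x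
  proof -
    have "g x \<in> a_kernel (obj E 0) V (aug E)"
      using mod_hom_closed[OF is_cocycle_hom[OF 0], of x] x by (simp add: syzygy_0_eq_kernel[OF E])
    then show ?thesis using \<phi>(2) x by (simp add: a_kernel_iff)
  qed
  then have "is_cocycle R S n V (\<lambda>x. aug E (\<phi> x))"
    unfolding is_cocycle_def using mod_hom_comp[OF \<phi>(1) resolution_aug_hom[OF E]] by simp
  moreover have "chain_lift R S n (\<lambda>x. aug E (\<phi> x)) E (Suc 0) (\<lambda>j. \<phi>)"
    by (rule chain_liftI) (use \<phi>(1) in simp_all)
  ultimately show ?case using \<phi>(2) by (intro exI[of _ "\<lambda>x. aug E (\<phi> x)"] exI[of _ "\<lambda>j. \<phi>"]) simp
next
  case (Suc k)
  note g_hom = is_cocycle_hom[OF Suc.prems, unfolded syzygy_Suc]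
  have "g \<in> mod_hom R (obj S (Suc (n + Suc k))) (obj E (Suc k))"
    by (rule mod_hom_from_subset[OF g_hom submodule_subset[OF syzygy_submodule[OF E]]])
  from ext_vanishesD[OF vanish[of "Suc k"] this] is_cocycle_bd[OF Suc.prems]
  obtain \<phi>' where \<phi>': "\<phi>' \<in> mod_hom R (obj S (Suc (n + k))) (obj E (Suc k))"
    "\<forall>x\<in>carrier (obj S (Suc (Suc (n + k)))). g x = \<phi>' (bd S (Suc (n + k)) x)"
    by (auto simp: syzygy_Suc)
  have "bd E k (\<phi>' (bd S (Suc (n + k)) x)) = \<zero>\<^bsub>syzygy E (Suc k)\<^esub>"
    if x: "x \<in> carrier (obj S (Suc (Suc (n + k))))" for x
  proof -
    have "g x \<in> a_kernel (obj E (Suc k)) (syzygy E (Suc k)) (bd E k)"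
      using mod_hom_closed[OF is_cocycle_hom[OF Suc.prems], of x] x by (simp add: syzygy_Suc_eq_kernel[OF E])
    then show ?thesis using \<phi>'(2) x by (simp add: a_kernel_iff)
  qed
  then have "is_cocycle R S (Suc (n + k)) (syzygy E (Suc k)) (\<lambda>x. bd E k (\<phi>' x))"
    unfolding is_cocycle_def using mod_hom_comp[OF \<phi>'(1) resolution_bd_hom_syzygy[OF E]] by simp
  from Suc.IH[OF this] obtain f \<phi> where f: "is_cocycle R S n V f" and \<phi>: "chain_lift R S n f E (Suc k) \<phi>"
    and eq: "\<forall>x\<in>carrier (obj S (Suc (n + k))). bd E k (\<phi>' x) = \<phi> k (bd S (n + k) x)" by blast
  \<comment> \<open>The new component sits on top of those from the induction hypothesis; the only
    new square is the one at \<open>j = k\<close>, which is \<open>eq\<close>.\<close>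
  have "chain_lift R S n f E (Suc (Suc k)) (\<phi>(Suc k := \<phi>'))"
  proof (rule chain_liftI)
    fix j assume "j < Suc (Suc k)"
    then show "(\<phi>(Suc k := \<phi>')) j \<in> mod_hom R (obj S (n + j)) (obj E j)"
      using \<phi>'(1) chain_lift_hom[OF \<phi>, of j] by (cases "j = Suc k") simp_all
  next
    fix x assume "x \<in> carrier (obj S n)"
    then show "aug E ((\<phi>(Suc k := \<phi>')) 0 x) = f x" using chain_lift_aug[OF \<phi>] by simp
  next
    fix j x assume "Suc j < Suc (Suc k)" "x \<in> carrier (obj S (Suc (n + j)))"
    then show "bd E j ((\<phi>(Suc k := \<phi>')) (Suc j) x) = (\<phi>(Suc k := \<phi>')) j (bd S (n + j) x)"
      using eq chain_lift_bd[OF \<phi>, of j x] by (cases "j = k") simp_all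
  qed
  then show ?case using f \<phi>'(2) by (intro exI[of _ f] exI[of _ "\<phi>(Suc k := \<phi>')"]) (simp add: fun_upd_def)
qed

lemma chain_lift_cong:
  "\<lbrakk>chain_lift R S m f E l \<phi>; \<And>x. x \<in> carrier (obj S m) \<Longrightarrow> f x = f' x\<rbrakk> \<Longrightarrow> chain_lift R S m f' E l \<phi>"
  by (simp add: chain_lift_def)

lemma (in fin_dim_algebra) chain_lift_scalar:
  assumes E: "projective_resolution A E V"
    and \<phi>: "chain_lift A S m f E l \<phi>" and "0 < l" and c: "c \<in> carrier K"
  shows "chain_lift A S m (\<lambda>x. (c \<odot>\<^bsub>A\<^esub> \<one>\<^bsub>A\<^esub>) \<odot>\<^bsub>V\<^esub> f x) E l (\<lambda>j x. (c \<odot>\<^bsub>A\<^esub> \<one>\<^bsub>A\<^esub>) \<odot>\<^bsub>obj E j\<^esub> \<phi> j x)"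
proof (rule chain_liftI)
  note LE = resolution_left_module[OF E] and z = scalar_closed[OF c]
  note closed = mod_hom_closed[OF chain_lift_hom[OF \<phi>]]
  show "(\<lambda>x. (c \<odot>\<^bsub>A\<^esub> \<one>\<^bsub>A\<^esub>) \<odot>\<^bsub>obj E j\<^esub> \<phi> j x) \<in> mod_hom A (obj S (m + j)) (obj E j)" if "j < l" for j
    by (rule mod_hom_scalar_map[OF LE chain_lift_hom[OF \<phi> that] c])
  show "aug E ((c \<odot>\<^bsub>A\<^esub> \<one>\<^bsub>A\<^esub>) \<odot>\<^bsub>obj E 0\<^esub> \<phi> 0 x) = (c \<odot>\<^bsub>A\<^esub> \<one>\<^bsub>A\<^esub>) \<odot>\<^bsub>V\<^esub> f x" if "x \<in> carrier (obj S m)" for x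
    using that \<open>0 < l\<close> closed[of 0 x] chain_lift_aug[OF \<phi> that]
    by (simp add: mod_hom_smult[OF resolution_aug_hom[OF E] z])
  show "bd E j ((c \<odot>\<^bsub>A\<^esub> \<one>\<^bsub>A\<^esub>) \<odot>\<^bsub>obj E (Suc j)\<^esub> \<phi> (Suc j) x) = (c \<odot>\<^bsub>A\<^esub> \<one>\<^bsub>A\<^esub>) \<odot>\<^bsub>obj E j\<^esub> \<phi> j (bd S (m + j) x)"
    if "Suc j < l" "x \<in> carrier (obj S (Suc (m + j)))" for j x
    using that closed[of "Suc j" x] chain_lift_bd[OF \<phi> that]
    by (simp add: mod_hom_smult[OF resolution_bd_hom[OF E] z])
qed

lemma connected_cocycle_Suc:
  "connected_cocycle A S m f E (Suc k) (\<lambda>x. x) W g \<longleftrightarrow>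
    g \<in> carrier (Hom_module A (obj S (Suc (m + k))) W) \<and>
    (\<exists>\<phi>. chain_lift A S m f E (Suc k) \<phi> \<and> (\<forall>x\<in>carrier (obj S (Suc (m + k))). g x = \<phi> k (bd S (m + k) x)))"
  by (simp add: connected_cocycle_def)

text \<open>The lift is taken one component longer than the sequence: \<open>\<phi> (Suc k)\<close>
  exhibits the values of \<open>\<phi> k\<close> on boundaries as elements of the image of
  \<open>bd E k\<close>, that is, of the syzygy.\<close>

lemma chain_lift_boundary_cocycle:
  assumes S: "projective_resolution R S U" and E: "projective_resolution R E V"
    and \<phi>: "chain_lift R S m f E (Suc (Suc k)) \<phi>"
  shows "is_cocycle R S (Suc (m + k)) (syzygy E (Suc k)) (\<lambda>x. \<phi> k (bd S (m + k) x))"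
  unfolding is_cocycle_def
proof (intro conjI ballI)
  note L = resolution_left_module[OF S] and LE = resolution_left_module[OF E]
  have \<phi>k: "\<phi> k \<in> mod_hom R (obj S (m + k)) (obj E k)" by (rule chain_lift_hom[OF \<phi>]) simp
  have \<phi>Suc: "\<phi> (Suc k) \<in> mod_hom R (obj S (Suc (m + k))) (obj E (Suc k))"
    using chain_lift_hom[OF \<phi>, of "Suc k"] by simp
  have eq: "bd E k (\<phi> (Suc k) x) = \<phi> k (bd S (m + k) x)" if "x \<in> carrier (obj S (Suc (m + k)))" for x
    by (rule chain_lift_bd[OF \<phi> _ that]) simp
  show "(\<lambda>x. \<phi> k (bd S (m + k) x)) \<in> mod_hom R (obj S (Suc (m + k))) (syzygy E (Suc k))"
    by (rule mod_hom_cong[OF L mod_hom_comp[OF \<phi>Suc resolution_bd_hom_syzygy[OF E]]]) (rule eq[symmetric])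
  fix x assume x: "x \<in> carrier (obj S (Suc (Suc (m + k))))"
  show "\<phi> k (bd S (m + k) (bd S (Suc (m + k)) x)) = \<zero>\<^bsub>syzygy E (Suc k)\<^esub>"
    unfolding resolution_bd_bd[OF S x] mod_hom_zero[OF L LE \<phi>k] by (simp add: syzygy_Suc)
qed

text \<open>Chain lifts can be added and multiplied by scalars, so connectedness of cocycles is
  itself a linear relation and serves as both \<open>r\<close> and \<open>r'\<close>. The vanishing
  hypothesis makes it match coboundaries with coboundaries and reach every cocycle.\<close>

theorem (in fin_dim_algebra) yoneda_push_iso:
  assumes S: "projective_resolution A S U" and E: "projective_resolution A E V" and V: "left_module A V"
    and vanish: "\<And>p j. m \<le> p \<Longrightarrow> ext_vanishes A S p (obj E j)"
  shows "yoneda_push A S (Suc m) E (Suc k) (\<lambda>x. x) (syzygy E (Suc k)) \<in>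
    mod_iso K (Ext A S (Suc m) V) (Ext A S (Suc m + Suc k) (syzygy E (Suc k)))"
proof -
  let ?W = "syzygy E (Suc k)" and ?N = "Suc (Suc (m + k))"
  let ?r = "\<lambda>f g. connected_cocycle A S (Suc m) f E (Suc k) (\<lambda>x. x) ?W g"
  have W: "left_module A ?W" by (rule left_module_syzygy[OF E])
  have r_iff: "?r f g \<longleftrightarrow> g \<in> carrier (Hom_module A (obj S ?N) ?W) \<and>
      (\<exists>\<phi>. chain_lift A S (Suc m) f E (Suc k) \<phi> \<and> (\<forall>x\<in>carrier (obj S ?N). g x = \<phi> k (bd S (Suc (m + k)) x)))" for f g
    unfolding connected_cocycle_Suc by simp
  have cocycle_Hom: "g \<in> carrier (Hom_module A (obj S n) ?W)" if "g \<in> cocycles A S n ?W" for g n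
    using that by (simp add: cocycles_def)
  have "(\<lambda>c. THE d. d \<in> carrier (quotient_module (cocycle_module S ?N ?W) (coboundaries A S ?N ?W)) \<and>
      (\<exists>f\<in>c. \<exists>g\<in>d. ?r f g))
    \<in> mod_iso K (quotient_module (cocycle_module S (Suc m) V) (coboundaries A S (Suc m) V))
      (quotient_module (cocycle_module S ?N ?W) (coboundaries A S ?N ?W))"
  proof (rule relation_induces_iso[where r = ?r and r' = ?r])
    show "left_module K (cocycle_module S (Suc m) V)" by (rule left_module_cocycle_module[OF S V])
    show "left_module K (cocycle_module S ?N ?W)" by (rule left_module_cocycle_module[OF S W])
    show "submodule (coboundaries A S (Suc m) V) K (cocycle_module S (Suc m) V)"
      by (rule coboundaries_submodule[OF S V])
    show "submodule (coboundaries A S ?N ?W) K (cocycle_module S ?N ?W)"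
      by (rule coboundaries_submodule[OF S W])
  next
    fix f assume "f \<in> carrier (cocycle_module S (Suc m) V)"
    then have f: "is_cocycle A S (Suc m) V f" by (simp add: cocycles_iff)
    from chain_lift_exists[OF S E V is_cocycle_hom[OF f] is_cocycle_bd[OF f]]
    obtain \<phi> where \<phi>: "\<And>l. chain_lift A S (Suc m) f E l \<phi>" by auto
    have "is_cocycle A S ?N ?W (\<lambda>x. \<phi> k (bd S (Suc (m + k)) x))"
      using chain_lift_boundary_cocycle[OF S E \<phi>, of k] by simp
    from restrict_cocycle[OF S this]
    have g: "(\<lambda>x\<in>carrier (obj S ?N). \<phi> k (bd S (Suc (m + k)) x)) \<in> cocycles A S ?N ?W" .
    have "?r f (\<lambda>x\<in>carrier (obj S ?N). \<phi> k (bd S (Suc (m + k)) x))"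
      unfolding r_iff using cocycle_Hom[OF g] \<phi>[of "Suc k"] by (intro conjI exI[of _ \<phi>]) simp_all
    then show "\<exists>g\<in>carrier (cocycle_module S ?N ?W). ?r f g" using g by (intro bexI) simp_all
  next
    fix f g f' g'
    assume carr: "f \<in> carrier (cocycle_module S (Suc m) V)" "g \<in> carrier (cocycle_module S ?N ?W)"
      "f' \<in> carrier (cocycle_module S (Suc m) V)" "g' \<in> carrier (cocycle_module S ?N ?W)"
      and r: "?r f g" "?r f' g'"
    from r obtain \<phi> \<phi>' where \<phi>: "chain_lift A S (Suc m) f E (Suc k) \<phi>"
      "\<forall>x\<in>carrier (obj S ?N). g x = \<phi> k (bd S (Suc (m + k)) x)"
      and \<phi>': "chain_lift A S (Suc m) f' E (Suc k) \<phi>'"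
      "\<forall>x\<in>carrier (obj S ?N). g' x = \<phi>' k (bd S (Suc (m + k)) x)" unfolding r_iff by blast
    interpret H: left_module K "cocycle_module S ?N ?W" by (rule left_module_cocycle_module[OF S W])
    have "g \<oplus>\<^bsub>cocycle_module S ?N ?W\<^esub> g' \<in> cocycles A S ?N ?W"
      using H.a_closed[OF carr(2,4)] by simp
    moreover have "chain_lift A S (Suc m) (f \<oplus>\<^bsub>cocycle_module S (Suc m) V\<^esub> f') E (Suc k)
        (\<lambda>j x. \<phi> j x \<oplus>\<^bsub>obj E j\<^esub> \<phi>' j x)"
      by (rule chain_lift_cong[OF chain_lift_add[OF V E \<phi>(1) \<phi>'(1) _ S]]) simp_all
    ultimately show "?r (f \<oplus>\<^bsub>cocycle_module S (Suc m) V\<^esub> f') (g \<oplus>\<^bsub>cocycle_module S ?N ?W\<^esub> g')"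
      unfolding r_iff using \<phi>(2) \<phi>'(2) cocycle_Hom
      by (intro conjI exI[of _ "\<lambda>j x. \<phi> j x \<oplus>\<^bsub>obj E j\<^esub> \<phi>' j x"]) (simp_all add: syzygy_Suc)
  next
    fix c f g
    assume c: "c \<in> carrier K"
      and carr: "f \<in> carrier (cocycle_module S (Suc m) V)" "g \<in> carrier (cocycle_module S ?N ?W)" and r: "?r f g"
    from r obtain \<phi> where \<phi>: "chain_lift A S (Suc m) f E (Suc k) \<phi>"
      "\<forall>x\<in>carrier (obj S ?N). g x = \<phi> k (bd S (Suc (m + k)) x)" unfolding r_iff by blast
    interpret H: left_module K "cocycle_module S ?N ?W" by (rule left_module_cocycle_module[OF S W])
    have "c \<odot>\<^bsub>cocycle_module S ?N ?W\<^esub> g \<in> cocycles A S ?N ?W"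
      using H.smult_closed[OF c carr(2)] by simp
    moreover have "chain_lift A S (Suc m) (c \<odot>\<^bsub>cocycle_module S (Suc m) V\<^esub> f) E (Suc k)
        (\<lambda>j x. (c \<odot>\<^bsub>A\<^esub> \<one>\<^bsub>A\<^esub>) \<odot>\<^bsub>obj E j\<^esub> \<phi> j x)"
      by (rule chain_lift_cong[OF chain_lift_scalar[OF E \<phi>(1) _ c]]) simp_all
    ultimately show "?r (c \<odot>\<^bsub>cocycle_module S (Suc m) V\<^esub> f) (c \<odot>\<^bsub>cocycle_module S ?N ?W\<^esub> g)"
      unfolding r_iff using \<phi>(2) cocycle_Hom
      by (intro conjI exI[of _ "\<lambda>j x. (c \<odot>\<^bsub>A\<^esub> \<one>\<^bsub>A\<^esub>) \<odot>\<^bsub>obj E j\<^esub> \<phi> j x"]) (simp_all add: syzygy_Suc)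
  next
    fix f g
    assume carr: "f \<in> carrier (cocycle_module S (Suc m) V)" "g \<in> carrier (cocycle_module S ?N ?W)" and r: "?r f g"
    from r obtain \<phi> where \<phi>: "chain_lift A S (Suc m) f E (Suc k) \<phi>"
      "\<forall>x\<in>carrier (obj S ?N). g x = \<phi> k (bd S (Suc (m + k)) x)" unfolding r_iff by blast
    have "is_coboundary A S m V f \<longleftrightarrow> is_coboundary A S (Suc (m + k)) ?W (\<lambda>x. \<phi> k (bd S (Suc (m + k)) x))"
      by (rule chain_lift_coboundary_iff[OF S E V vanish \<phi>(1)]) simp
    also have "\<dots> \<longleftrightarrow> is_coboundary A S (Suc (m + k)) ?W g"
      using \<phi>(2) by (auto elim!: is_coboundary_cong)
    finally show "f \<in> coboundaries A S (Suc m) V \<longleftrightarrow> g \<in> coboundaries A S ?N ?W"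
      using carr by (simp add: coboundaries_iff[OF S] cocycles_iff)
  next
    fix g assume "g \<in> carrier (cocycle_module S ?N ?W)"
    then have g: "g \<in> cocycles A S ?N ?W" by simp
    then have "is_cocycle A S (Suc (Suc m + k)) ?W g" by (simp add: cocycles_iff)
    \<comment> \<open>Here vanishing enters one degree higher than in the comparison of
      coboundaries, just as consecutive Ext groups control injectivity and surjectivity of a
      connecting map.\<close>
    from chain_lift_surjective[OF S E V vanish this]
    obtain f \<phi> where f: "is_cocycle A S (Suc m) V f" and \<phi>: "chain_lift A S (Suc m) f E (Suc k) \<phi>"
      "\<forall>x\<in>carrier (obj S ?N). g x = \<phi> k (bd S (Suc (m + k)) x)" by auto
    have "chain_lift A S (Suc m) (restrict f (carrier (obj S (Suc m)))) E (Suc k) \<phi>"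
      by (rule chain_lift_cong[OF \<phi>(1)]) simp
    then have "?r (restrict f (carrier (obj S (Suc m)))) g"
      unfolding r_iff using cocycle_Hom[OF g] \<phi>(2) by blast
    then show "\<exists>f\<in>carrier (cocycle_module S (Suc m) V). ?r f g"
      using restrict_cocycle[OF S f] by (intro bexI) simp_all
  qed
  moreover have "yoneda_push A S (Suc m) E (Suc k) (\<lambda>x. x) ?W =
    (\<lambda>c. THE d. d \<in> carrier (quotient_module (cocycle_module S ?N ?W) (coboundaries A S ?N ?W)) \<and>
      (\<exists>f\<in>c. \<exists>g\<in>d. ?r f g))"
    by (rule ext) (simp add: yoneda_push_def Ext_def)
  ultimately show ?thesis by (simp add: Ext_def)
qed


section \<open>Composition with the truncation in the first argument\<close>

text \<open>The tail of \<open>P\<close> beyond degree \<open>k\<close>, resolving the syzygy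
  \<open>syzygy P (Suc k)\<close>; the boundary map onto that syzygy becomes the
  augmentation.\<close>

definition shift_complex :: "nat \<Rightarrow> ('a, 'p, 'u) aug_complex \<Rightarrow> ('a, 'p, 'p) aug_complex" where
  "shift_complex k P =
    \<lparr>obj = (\<lambda>j. obj P (Suc (k + j))), bd = (\<lambda>j. bd P (Suc (k + j))), aug = bd P k\<rparr>"

lemma shift_complex_simps [simp]:
  "obj (shift_complex k P) j = obj P (Suc (k + j))" "bd (shift_complex k P) j = bd P (Suc (k + j))"
  "aug (shift_complex k P) = bd P k"
  by (simp_all add: shift_complex_def)

lemma shift_complex_resolution:
  assumes "projective_resolution R P U"
  shows "projective_resolution R (shift_complex k P) (syzygy P (Suc k))"
  unfolding projective_resolution_def
  using resolution_projective[OF assms] resolution_bd_hom[OF assms] resolution_bd_hom_syzygy[OF assms, of k]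
    resolution_exact[OF assms]
  by (simp add: syzygy_Suc a_kernel_def kernel_def)

lemma is_cocycle_shift_complex:
  "is_cocycle R (shift_complex k P) n V f \<longleftrightarrow> is_cocycle R P (Suc (k + n)) V f"
  by (simp add: is_cocycle_def)

lemma is_coboundary_shift_complex:
  "is_coboundary R (shift_complex k P) m V f \<longleftrightarrow> is_coboundary R P (Suc (k + m)) V f"
  by (simp add: is_coboundary_def)

text \<open>The augmentation of the tail is \<open>bd P k\<close>, so the condition that
  \<open>\<beta> 0\<close> lies over \<open>\<theta>\<close> is exactly the commuting square at the
  seam \<open>j = k\<close>.\<close>

lemma chain_lift_splice:
  assumes \<phi>: "chain_lift R S 0 f P (Suc k) \<phi>" and \<theta>: "\<And>x. x \<in> carrier (obj S (Suc k)) \<Longrightarrow> \<theta> x = \<phi> k (bd S k x)"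
    and \<beta>: "chain_lift R S (Suc k) \<theta> (shift_complex k P) l \<beta>"
  shows "chain_lift R S 0 f P (Suc k + l) (\<lambda>j. if j \<le> k then \<phi> j else \<beta> (j - Suc k))"
proof (rule chain_liftI)
  fix j assume "j < Suc k + l"
  show "(if j \<le> k then \<phi> j else \<beta> (j - Suc k)) \<in> mod_hom R (obj S (0 + j)) (obj P j)"
  proof (cases "j \<le> k")
    case True
    then show ?thesis using chain_lift_hom[OF \<phi>, of j] by simp
  next
    case False
    then obtain i where i: "j = Suc (k + i)" using less_imp_Suc_add by (metis not_le)
    then show ?thesis using chain_lift_hom[OF \<beta>, of i] \<open>j < Suc k + l\<close> by simp
  qed
next
  fix x assume "x \<in> carrier (obj S 0)"
  then show "aug P ((if 0 \<le> k then \<phi> 0 else \<beta> (0 - Suc k)) x) = f x" using chain_lift_aug[OF \<phi>] by simp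
next
  fix j x assume j: "Suc j < Suc k + l" and x: "x \<in> carrier (obj S (Suc (0 + j)))"
  consider "Suc j \<le> k" | "j = k" | "k < j" by linarith
  then show "bd P j ((if Suc j \<le> k then \<phi> (Suc j) else \<beta> (Suc j - Suc k)) x) =
      (if j \<le> k then \<phi> j else \<beta> (j - Suc k)) (bd S (0 + j) x)"
  proof cases
    case 1
    then show ?thesis using chain_lift_bd[OF \<phi>, of j x] x by simp
  next
    case 2
    then show ?thesis using chain_lift_aug[OF \<beta>, of x] \<theta>[of x] x by simp
  next
    case 3
    then obtain i where i: "j = Suc (k + i)" using less_imp_Suc_add by blast
    then show ?thesis using chain_lift_bd[OF \<beta>, of i x] x j by simp
  qed
qed

section \<open>Pull-backs along a truncation, compared through a chain map from \<open>T\<close> to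
  the tail of \<open>P\<close>\<close>

context
  fixes R :: "('a, 'z) ring_scheme" and S :: "('a, 'x, 'u) aug_complex" and P :: "('a, 'p, 'u) aug_complex"
    and T :: "('a, 'y, 'p) aug_complex" and U :: "('a, 'u) module" and W :: "('a, 'w) module"
    and k m :: nat and \<chi> :: "nat \<Rightarrow> 'y \<Rightarrow> 'p"
  assumes S: "projective_resolution R S U" and P: "projective_resolution R P U" and U: "left_module R U"
    and T: "projective_resolution R T (syzygy P (Suc k))" and W: "left_module R W"
    and \<chi>: "chain_lift R T 0 (aug T) (shift_complex k P) (Suc (Suc m)) \<chi>"
begin

text \<open>Any choice of \<open>\<theta>\<close> and \<open>\<psi>\<close> becomes the upper part
  of a chain map from \<open>S\<close> to \<open>P\<close> over the identity of \<open>U\<close>.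
  Facts about such choices thereby reduce to the comparison theorem for two resolutions of
  \<open>U\<close>.\<close>

lemma pull_splice:
  assumes \<phi>: "chain_lift R S 0 (aug S) P (Suc k) \<phi>"
    and \<theta>: "\<And>x. x \<in> carrier (obj S (Suc k)) \<Longrightarrow> \<theta> x = \<phi> k (bd S k x)"
    and \<psi>: "chain_lift R S (Suc k) \<theta> T (Suc (Suc m)) \<psi>"
  shows "\<exists>\<alpha>. chain_lift R S 0 (aug S) P (Suc (Suc (Suc (m + k)))) \<alpha> \<and>
    \<alpha> (Suc (Suc (m + k))) = (\<lambda>x. \<chi> (Suc m) (\<psi> (Suc m) x))"
proof -
  let ?\<alpha> = "\<lambda>j. if j \<le> k then \<phi> j else (\<lambda>x. \<chi> (j - Suc k) (\<psi> (j - Suc k) x))"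
  have "chain_lift R S (Suc k) \<theta> (shift_complex k P) (Suc (Suc m)) (\<lambda>j x. \<chi> j (\<psi> j x))"
    by (rule chain_lift_comp[OF \<psi> \<chi>]) simp
  from chain_lift_splice[OF \<phi> \<theta> this]
  have "chain_lift R S 0 (aug S) P (Suc (Suc (Suc (m + k)))) ?\<alpha>" by (simp add: add.commute)
  moreover have "?\<alpha> (Suc (Suc (m + k))) = (\<lambda>x. \<chi> (Suc m) (\<psi> (Suc m) x))" by (simp add: Suc_diff_le)
  ultimately show ?thesis by (intro exI[of _ ?\<alpha>] conjI)
qed

text \<open>Both \<open>T\<close> and the tail of \<open>P\<close> resolve the syzygy, so every
  class computed from \<open>T\<close> is represented by a cocycle \<open>\<kappa>\<close> on
  \<open>P\<close>, in the degree raised by \<open>Suc k\<close>.\<close>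

lemma pull_factor:
  assumes h: "is_cocycle R T (Suc m) W h"
  shows "\<exists>\<kappa>. is_cocycle R P (Suc (Suc (m + k))) W \<kappa> \<and>
    is_coboundary R T m W (\<lambda>x. h x \<ominus>\<^bsub>W\<^esub> \<kappa> (\<chi> (Suc m) x))"
  using comparison_surjective[OF T shift_complex_resolution[OF P] left_module_syzygy[OF P] W \<chi> h]
  by (simp add: is_cocycle_shift_complex add.commute)

lemma pull_coboundary:
  assumes \<psi>: "chain_lift R S (Suc k) \<theta> T (Suc (Suc m)) \<psi>" and h: "is_coboundary R T m W h"
  shows "is_coboundary R S (Suc (m + k)) W (\<lambda>x. h (\<psi> (Suc m) x))"
  using is_coboundary_chain_lift[OF \<psi> h] by (simp add: add.commute)

lemma pull_hom:
  assumes \<psi>: "chain_lift R S (Suc k) \<theta> T (Suc (Suc m)) \<psi>"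
  shows "\<psi> (Suc m) \<in> mod_hom R (obj S (Suc (Suc (m + k)))) (obj T (Suc m))"
  using chain_lift_hom[OF \<psi>, of "Suc m"] by (simp add: add.commute)

lemma pull_cocycle:
  assumes \<psi>: "chain_lift R S (Suc k) \<theta> T (Suc (Suc m)) \<psi>" and h: "is_cocycle R T (Suc m) W h"
  shows "is_cocycle R S (Suc (Suc (m + k))) W (\<lambda>x. h (\<psi> (Suc m) x))"
  using is_cocycle_chain_lift[OF S T \<psi> h] by (simp add: add.commute)

lemma shift_hom: "\<chi> (Suc m) \<in> mod_hom R (obj T (Suc m)) (obj P (Suc (Suc (m + k))))"
  using chain_lift_hom[OF \<chi>, of "Suc m"] by (simp add: add.commute)

text \<open>Up to coboundaries \<open>h\<close> is \<open>\<kappa>\<close> after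
  \<open>\<chi>\<close>, so the pulled-back cocycle is \<open>\<kappa>\<close> after the comparison
  map \<open>\<alpha>\<close> from \<open>S\<close> to \<open>P\<close>. If this bounds, then
  \<open>\<kappa>\<close> bounds on \<open>P\<close>, and pulling that back along
  \<open>\<chi>\<close> bounds \<open>h\<close>.\<close>

lemma pull_injective:
  assumes \<phi>: "chain_lift R S 0 (aug S) P (Suc k) \<phi>"
    and \<theta>: "\<And>x. x \<in> carrier (obj S (Suc k)) \<Longrightarrow> \<theta> x = \<phi> k (bd S k x)"
    and \<psi>: "chain_lift R S (Suc k) \<theta> T (Suc (Suc m)) \<psi>"
    and h: "is_cocycle R T (Suc m) W h"
    and h\<psi>: "is_coboundary R S (Suc (m + k)) W (\<lambda>x. h (\<psi> (Suc m) x))"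
  shows "is_coboundary R T m W h"
proof -
  obtain \<kappa> where \<kappa>: "is_cocycle R P (Suc (Suc (m + k))) W \<kappa>"
    "is_coboundary R T m W (\<lambda>x. h x \<ominus>\<^bsub>W\<^esub> \<kappa> (\<chi> (Suc m) x))" using pull_factor[OF h] by blast
  obtain \<alpha> where \<alpha>: "chain_lift R S 0 (aug S) P (Suc (Suc (Suc (m + k)))) \<alpha>"
    "\<alpha> (Suc (Suc (m + k))) = (\<lambda>x. \<chi> (Suc m) (\<psi> (Suc m) x))" using pull_splice[OF \<phi> \<theta> \<psi>] by blast
  have h_closed: "h x \<in> carrier W" and \<kappa>_closed: "\<kappa> (\<chi> (Suc m) x) \<in> carrier W"
    if "x \<in> carrier (obj T (Suc m))" for x
    by (rule mod_hom_closed[OF is_cocycle_hom[OF h] that],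
        rule mod_hom_closed[OF mod_hom_comp[OF shift_hom is_cocycle_hom[OF \<kappa>(1)]] that])
  note \<psi>_closed = mod_hom_closed[OF pull_hom[OF \<psi>]]
  have "is_coboundary R S (Suc (m + k)) W (\<lambda>x. h (\<psi> (Suc m) x) \<ominus>\<^bsub>W\<^esub> \<kappa> (\<chi> (Suc m) (\<psi> (Suc m) x)))"
    by (rule pull_coboundary[OF \<psi> \<kappa>(2)])
  then have "is_coboundary R S (Suc (m + k)) W (\<lambda>x. \<kappa> (\<chi> (Suc m) (\<psi> (Suc m) x)) \<ominus>\<^bsub>W\<^esub> h (\<psi> (Suc m) x))"
    by (rule is_coboundary_minus_commute[OF W, rotated 2]) (intro h_closed \<kappa>_closed \<psi>_closed; assumption)+
  then have "is_coboundary R S (Suc (m + k)) W (\<lambda>x. \<kappa> (\<chi> (Suc m) (\<psi> (Suc m) x)))"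
    by (rule is_coboundary_trans[OF W _ _ h\<psi>, rotated 2]) (intro h_closed \<kappa>_closed \<psi>_closed; assumption)+
  then have "is_coboundary R S (Suc (m + k)) W (\<lambda>x. \<kappa> (\<alpha> (Suc (Suc (m + k))) x))" by (simp add: \<alpha>(2))
  from comparison_injective[OF S P U W \<alpha>(1) \<kappa>(1) this]
  have "is_coboundary R (shift_complex k P) m W \<kappa>" by (simp add: is_coboundary_shift_complex add.commute)
  from is_coboundary_chain_lift[OF \<chi> this]
  have "is_coboundary R T m W (\<lambda>x. \<kappa> (\<chi> (Suc m) x))" by simp
  from is_coboundary_trans[OF W h_closed \<kappa>_closed this \<kappa>(2)] show ?thesis .
qed

text \<open>Every cocycle on \<open>S\<close> comes from some \<open>\<kappa>\<close> on
  \<open>P\<close> along \<open>\<alpha>\<close>. Since \<open>\<alpha>\<close> ends with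
  \<open>\<psi>\<close> followed by \<open>\<chi>\<close>, the cocycle \<open>\<kappa>\<close> after
  \<open>\<chi>\<close> is a preimage.\<close>

lemma pull_surjective:
  assumes \<phi>: "chain_lift R S 0 (aug S) P (Suc k) \<phi>"
    and \<theta>: "\<And>x. x \<in> carrier (obj S (Suc k)) \<Longrightarrow> \<theta> x = \<phi> k (bd S k x)"
    and \<psi>: "chain_lift R S (Suc k) \<theta> T (Suc (Suc m)) \<psi>"
    and g: "is_cocycle R S (Suc (Suc (m + k))) W g"
  shows "\<exists>h. is_cocycle R T (Suc m) W h \<and> is_coboundary R S (Suc (m + k)) W (\<lambda>x. g x \<ominus>\<^bsub>W\<^esub> h (\<psi> (Suc m) x))"
proof -
  obtain \<alpha> where \<alpha>: "chain_lift R S 0 (aug S) P (Suc (Suc (Suc (m + k)))) \<alpha>"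
    "\<alpha> (Suc (Suc (m + k))) = (\<lambda>x. \<chi> (Suc m) (\<psi> (Suc m) x))" using pull_splice[OF \<phi> \<theta> \<psi>] by blast
  obtain \<kappa> where \<kappa>: "is_cocycle R P (Suc (Suc (m + k))) W \<kappa>"
    "is_coboundary R S (Suc (m + k)) W (\<lambda>x. g x \<ominus>\<^bsub>W\<^esub> \<kappa> (\<alpha> (Suc (Suc (m + k))) x))"
    using comparison_surjective[OF S P U W \<alpha>(1) g] by blast
  have "is_cocycle R (shift_complex k P) (Suc m) W \<kappa>"
    using \<kappa>(1) by (simp add: is_cocycle_shift_complex add.commute)
  from is_cocycle_chain_lift[OF T shift_complex_resolution[OF P] \<chi> this]
  have "is_cocycle R T (Suc m) W (\<lambda>x. \<kappa> (\<chi> (Suc m) x))" by simp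
  then show ?thesis using \<kappa>(2) unfolding \<alpha>(2) by (intro exI conjI)
qed

text \<open>Two choices of data lead to two comparison maps from \<open>S\<close> to
  \<open>P\<close> over the same identity, and these are homotopic. The choices cannot be compared
  directly at the level of \<open>\<psi>\<close> and \<open>\<psi>'\<close>, which lift different
  cocycles \<open>\<theta>\<close> and \<open>\<theta>'\<close>.\<close>

lemma pull_unique:
  assumes \<phi>: "chain_lift R S 0 (aug S) P (Suc k) \<phi>"
    and \<theta>: "\<And>x. x \<in> carrier (obj S (Suc k)) \<Longrightarrow> \<theta> x = \<phi> k (bd S k x)"
    and \<psi>: "chain_lift R S (Suc k) \<theta> T (Suc (Suc m)) \<psi>"
    and \<phi>': "chain_lift R S 0 (aug S) P (Suc k) \<phi>'"
    and \<theta>': "\<And>x. x \<in> carrier (obj S (Suc k)) \<Longrightarrow> \<theta>' x = \<phi>' k (bd S k x)"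
    and \<psi>': "chain_lift R S (Suc k) \<theta>' T (Suc (Suc m)) \<psi>'"
    and h: "is_cocycle R T (Suc m) W h"
  shows "is_coboundary R S (Suc (m + k)) W (\<lambda>x. h (\<psi> (Suc m) x) \<ominus>\<^bsub>W\<^esub> h (\<psi>' (Suc m) x))"
proof -
  interpret W: left_module R W by (rule W)
  obtain \<kappa> where \<kappa>: "is_cocycle R P (Suc (Suc (m + k))) W \<kappa>"
    "is_coboundary R T m W (\<lambda>x. h x \<ominus>\<^bsub>W\<^esub> \<kappa> (\<chi> (Suc m) x))" using pull_factor[OF h] by blast
  obtain \<alpha> where \<alpha>: "chain_lift R S 0 (aug S) P (Suc (Suc (Suc (m + k)))) \<alpha>"
    "\<alpha> (Suc (Suc (m + k))) = (\<lambda>x. \<chi> (Suc m) (\<psi> (Suc m) x))" using pull_splice[OF \<phi> \<theta> \<psi>] by blast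
  obtain \<alpha>' where \<alpha>': "chain_lift R S 0 (aug S) P (Suc (Suc (Suc (m + k)))) \<alpha>'"
    "\<alpha>' (Suc (Suc (m + k))) = (\<lambda>x. \<chi> (Suc m) (\<psi>' (Suc m) x))" using pull_splice[OF \<phi>' \<theta>' \<psi>'] by blast
  let ?a = "\<lambda>x. h (\<psi> (Suc m) x)" and ?a' = "\<lambda>x. h (\<psi>' (Suc m) x)"
  let ?b = "\<lambda>x. \<kappa> (\<chi> (Suc m) (\<psi> (Suc m) x))" and ?b' = "\<lambda>x. \<kappa> (\<chi> (Suc m) (\<psi>' (Suc m) x))"
  have ab: "is_coboundary R S (Suc (m + k)) W (\<lambda>x. ?a x \<ominus>\<^bsub>W\<^esub> ?b x)"
    by (rule pull_coboundary[OF \<psi> \<kappa>(2)])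
  have ab': "is_coboundary R S (Suc (m + k)) W (\<lambda>x. ?a' x \<ominus>\<^bsub>W\<^esub> ?b' x)"
    by (rule pull_coboundary[OF \<psi>' \<kappa>(2)])
  have bb': "is_coboundary R S (Suc (m + k)) W (\<lambda>x. ?b x \<ominus>\<^bsub>W\<^esub> ?b' x)"
    using chain_lift_unique[OF S P U W \<alpha>(1) \<alpha>'(1) \<kappa>(1)] by (simp add: \<alpha>(2) \<alpha>'(2))
  show ?thesis
  proof (rule is_coboundary_cong[OF is_coboundary_add[OF W is_coboundary_minus[OF W ab ab'] bb']])
    fix x assume x: "x \<in> carrier (obj S (Suc (Suc (m + k))))"
    note c = mod_hom_closed[OF pull_hom[OF \<psi>] x] mod_hom_closed[OF pull_hom[OF \<psi>'] x]
    note carr = mod_hom_closed[OF is_cocycle_hom[OF h] c(1)] mod_hom_closed[OF is_cocycle_hom[OF h] c(2)]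
      mod_hom_closed[OF mod_hom_comp[OF shift_hom is_cocycle_hom[OF \<kappa>(1)]] c(1)]
      mod_hom_closed[OF mod_hom_comp[OF shift_hom is_cocycle_hom[OF \<kappa>(1)]] c(2)]
    \<comment> \<open>The three coboundaries telescope: passing from \<open>?a\<close> to
      \<open>?b\<close>, from \<open>?b\<close> to \<open>?b'\<close> and back to
      \<open>?a'\<close>.\<close>
    have "(a \<ominus>\<^bsub>W\<^esub> b) \<ominus>\<^bsub>W\<^esub> (a' \<ominus>\<^bsub>W\<^esub> b') \<oplus>\<^bsub>W\<^esub> (b \<ominus>\<^bsub>W\<^esub> b') = a \<ominus>\<^bsub>W\<^esub> a'"
      if "a \<in> carrier W" "a' \<in> carrier W" "b \<in> carrier W" "b' \<in> carrier W" for a a' b b'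
    proof -
      have "(a \<ominus>\<^bsub>W\<^esub> b) \<ominus>\<^bsub>W\<^esub> (a' \<ominus>\<^bsub>W\<^esub> b') \<oplus>\<^bsub>W\<^esub> (b \<ominus>\<^bsub>W\<^esub> b') =
          ((a \<ominus>\<^bsub>W\<^esub> b) \<oplus>\<^bsub>W\<^esub> b) \<ominus>\<^bsub>W\<^esub> ((a' \<ominus>\<^bsub>W\<^esub> b') \<oplus>\<^bsub>W\<^esub> b')"
        using that by (simp add: W.add_minus_add)
      also have "\<dots> = a \<ominus>\<^bsub>W\<^esub> a'" using that by (simp add: W.minus_add_cancel)
      finally show ?thesis .
    qed
    from this[OF carr]
    show "(?a x \<ominus>\<^bsub>W\<^esub> ?b x) \<ominus>\<^bsub>W\<^esub> (?a' x \<ominus>\<^bsub>W\<^esub> ?b' x) \<oplus>\<^bsub>W\<^esub> (?b x \<ominus>\<^bsub>W\<^esub> ?b' x) = ?a x \<ominus>\<^bsub>W\<^esub> ?a' x" .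
  qed
qed

end

text \<open>The relation \<open>?r\<close> admits all auxiliary data, and data used for two summands
  need not agree, so it is not visibly additive. The linear relation \<open>?r'\<close> fixes one
  choice and works up to coboundaries; \<open>pull_unique\<close> shows that it contains
  \<open>?r\<close>.\<close>

theorem (in fin_dim_algebra) yoneda_pull_iso:
  fixes T :: "('a, 'y, 'p) aug_complex" and W :: "('a, 'w) module"
  assumes S: "projective_resolution A S U" and P: "projective_resolution A P U" and U: "left_module A U"
    and T: "projective_resolution A T (syzygy P (Suc k))" and W: "left_module A W"
  shows "yoneda_pull A S T (Suc m) P (Suc k) (\<lambda>x. x) (syzygy P (Suc k)) W \<in>
    mod_iso K (Ext A T (Suc m) W) (Ext A S (Suc m + Suc k) W)"
proof -
  let ?Z = "syzygy P (Suc k)" and ?N = "Suc (Suc (m + k))"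
  let ?data = "\<lambda>\<theta> \<psi>. connected_cocycle A S 0 (aug S) P (Suc k) (\<lambda>x. x) ?Z \<theta> \<and>
    chain_lift A S (Suc k) \<theta> T (Suc (Suc m)) \<psi>"
  let ?r = "\<lambda>(h :: 'y \<Rightarrow> 'w) g. \<exists>\<theta> \<psi>. ?data \<theta> \<psi> \<and> g = (\<lambda>x\<in>carrier (obj S ?N). h (\<psi> (Suc m) x))"
  have Z: "left_module A ?Z" by (rule left_module_syzygy[OF P])
  obtain \<chi> where \<chi>: "chain_lift A T 0 (aug T) (shift_complex k P) (Suc (Suc m)) \<chi>"
    using comparison_exists[OF T shift_complex_resolution[OF P] Z] by blast
  note pull = S P U T W \<chi>
  have data: "\<exists>\<phi>. chain_lift A S 0 (aug S) P (Suc k) \<phi> \<and> (\<forall>x\<in>carrier (obj S (Suc k)). \<theta> x = \<phi> k (bd S k x))"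
    if "?data \<theta> \<psi>" for \<theta> \<psi>
    using that unfolding connected_cocycle_Suc by simp
  obtain \<phi>0 where \<phi>0: "\<And>l. chain_lift A S 0 (aug S) P l \<phi>0"
    using comparison_exists[OF S P U] by blast
  \<comment> \<open>Restricted to the carrier because \<open>connected_cocycle\<close> asks for an
    element of \<open>Hom_module\<close>, which consists of extensional maps.\<close>
  define \<theta>0 where "\<theta>0 = (\<lambda>x\<in>carrier (obj S (Suc k)). \<phi>0 k (bd S k x))"
  have "is_cocycle A S (Suc k) ?Z (\<lambda>x. \<phi>0 k (bd S k x))"
    using chain_lift_boundary_cocycle[OF S P \<phi>0, of k] by simp
  then have \<theta>0: "\<theta>0 \<in> cocycles A S (Suc k) ?Z"
    unfolding \<theta>0_def by (rule restrict_cocycle[OF S])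
  then have \<theta>0_cocycle: "is_cocycle A S (Suc k) ?Z \<theta>0" by (simp add: cocycles_iff)
  have \<theta>0_eq: "\<theta>0 x = \<phi>0 k (bd S k x)" if "x \<in> carrier (obj S (Suc k))" for x
    using that by (simp add: \<theta>0_def)
  obtain \<psi>0 where \<psi>0: "chain_lift A S (Suc k) \<theta>0 T (Suc (Suc m)) \<psi>0"
    using chain_lift_exists[OF S T Z is_cocycle_hom[OF \<theta>0_cocycle] is_cocycle_bd[OF \<theta>0_cocycle]] by blast
  have data0: "?data \<theta>0 \<psi>0"
    unfolding connected_cocycle_Suc using \<theta>0 \<theta>0_eq \<psi>0 \<phi>0[of "Suc k"]
    by (auto simp: cocycles_def)
  note \<psi>0_closed = mod_hom_closed[OF pull_hom[OF pull \<psi>0]]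
  interpret W: left_module A W by (rule W)
  let ?r' = "\<lambda>h g. is_coboundary A S (Suc (m + k)) W (\<lambda>x. g x \<ominus>\<^bsub>W\<^esub> h (\<psi>0 (Suc m) x))"
  have closed: "g x \<in> carrier W" if "g \<in> cocycles A S' n W" "x \<in> carrier (obj S' n)"
    for g x n and S' :: "('a, 's, 't) aug_complex"
    using that mod_hom_closed[OF is_cocycle_hom, of A S' n W g x] by (simp add: cocycles_iff)
  have "(\<lambda>c. THE d. d \<in> carrier (quotient_module (cocycle_module S ?N W) (coboundaries A S ?N W)) \<and>
      (\<exists>f\<in>c. \<exists>g\<in>d. ?r f g))
    \<in> mod_iso K (quotient_module (cocycle_module T (Suc m) W) (coboundaries A T (Suc m) W))
      (quotient_module (cocycle_module S ?N W) (coboundaries A S ?N W))"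
  proof (rule relation_induces_iso[where r = ?r and r' = ?r'])
    show "left_module K (cocycle_module T (Suc m) W)" by (rule left_module_cocycle_module[OF T W])
    show "left_module K (cocycle_module S ?N W)" by (rule left_module_cocycle_module[OF S W])
    show "submodule (coboundaries A T (Suc m) W) K (cocycle_module T (Suc m) W)"
      by (rule coboundaries_submodule[OF T W])
    show "submodule (coboundaries A S ?N W) K (cocycle_module S ?N W)"
      by (rule coboundaries_submodule[OF S W])
  next
    fix h assume "h \<in> carrier (cocycle_module T (Suc m) W)"
    then have h: "is_cocycle A T (Suc m) W h" by (simp add: cocycles_iff)
    have "(\<lambda>x\<in>carrier (obj S ?N). h (\<psi>0 (Suc m) x)) \<in> cocycles A S ?N W"
      by (rule restrict_cocycle[OF S pull_cocycle[OF pull \<psi>0 h]])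
    then show "\<exists>g\<in>carrier (cocycle_module S ?N W). ?r h g"
      using data0 by (intro bexI[of _ "\<lambda>x\<in>carrier (obj S ?N). h (\<psi>0 (Suc m) x)"] exI[of _ \<theta>0] exI[of _ \<psi>0]) simp_all
  next
    fix h g assume "h \<in> carrier (cocycle_module T (Suc m) W)" "?r h g"
    then have h: "is_cocycle A T (Suc m) W h" by (simp add: cocycles_iff)
    obtain \<theta> \<psi> where \<psi>: "?data \<theta> \<psi>" and g: "g = (\<lambda>x\<in>carrier (obj S ?N). h (\<psi> (Suc m) x))"
      using \<open>?r h g\<close> by blast
    obtain \<phi> where \<phi>: "chain_lift A S 0 (aug S) P (Suc k) \<phi>"
      "\<forall>x\<in>carrier (obj S (Suc k)). \<theta> x = \<phi> k (bd S k x)" using data[OF \<psi>] by blast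
    have "is_coboundary A S (Suc (m + k)) W (\<lambda>x. h (\<psi> (Suc m) x) \<ominus>\<^bsub>W\<^esub> h (\<psi>0 (Suc m) x))"
      by (rule pull_unique[OF pull \<phi>(1) bspec[OF \<phi>(2)] conjunct2[OF \<psi>] \<phi>0 \<theta>0_eq \<psi>0 h])
    then show "?r' h g" unfolding g by (rule is_coboundary_cong) simp
  next
    fix h g h' g'
    assume "h \<in> carrier (cocycle_module T (Suc m) W)" "g \<in> carrier (cocycle_module S ?N W)"
      "h' \<in> carrier (cocycle_module T (Suc m) W)" "g' \<in> carrier (cocycle_module S ?N W)"
      and r: "?r' h g" "?r' h' g'"
    then have carr: "h \<in> cocycles A T (Suc m) W" "g \<in> cocycles A S ?N W"
      "h' \<in> cocycles A T (Suc m) W" "g' \<in> cocycles A S ?N W" by simp_all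
    show "?r' (h \<oplus>\<^bsub>cocycle_module T (Suc m) W\<^esub> h') (g \<oplus>\<^bsub>cocycle_module S ?N W\<^esub> g')"
    proof (rule is_coboundary_cong[OF is_coboundary_add[OF W r]])
      fix x assume x: "x \<in> carrier (obj S ?N)"
      note y = \<psi>0_closed[OF x]
      show "(g x \<ominus>\<^bsub>W\<^esub> h (\<psi>0 (Suc m) x)) \<oplus>\<^bsub>W\<^esub> (g' x \<ominus>\<^bsub>W\<^esub> h' (\<psi>0 (Suc m) x)) =
          (g \<oplus>\<^bsub>cocycle_module S ?N W\<^esub> g') x \<ominus>\<^bsub>W\<^esub> (h \<oplus>\<^bsub>cocycle_module T (Suc m) W\<^esub> h') (\<psi>0 (Suc m) x)"
        using x y closed[OF carr(1) y] closed[OF carr(2) x] closed[OF carr(3) y] closed[OF carr(4) x]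
        by (simp add: W.add_minus_add)
    qed
  next
    fix c h g
    assume c: "c \<in> carrier K" and "h \<in> carrier (cocycle_module T (Suc m) W)"
      "g \<in> carrier (cocycle_module S ?N W)" and r: "?r' h g"
    then have carr: "h \<in> cocycles A T (Suc m) W" "g \<in> cocycles A S ?N W" by simp_all
    show "?r' (c \<odot>\<^bsub>cocycle_module T (Suc m) W\<^esub> h) (c \<odot>\<^bsub>cocycle_module S ?N W\<^esub> g)"
    proof (rule is_coboundary_cong[OF is_coboundary_scalar[OF W r c]])
      fix x assume x: "x \<in> carrier (obj S ?N)"
      note y = \<psi>0_closed[OF x]
      show "(c \<odot>\<^bsub>A\<^esub> \<one>\<^bsub>A\<^esub>) \<odot>\<^bsub>W\<^esub> (g x \<ominus>\<^bsub>W\<^esub> h (\<psi>0 (Suc m) x)) =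
          (c \<odot>\<^bsub>cocycle_module S ?N W\<^esub> g) x \<ominus>\<^bsub>W\<^esub> (c \<odot>\<^bsub>cocycle_module T (Suc m) W\<^esub> h) (\<psi>0 (Suc m) x)"
        using x y closed[OF carr(1) y] closed[OF carr(2) x] scalar_closed[OF c]
        by (simp add: W.smult_minus_right)
    qed
  next
    fix h g
    assume "h \<in> carrier (cocycle_module T (Suc m) W)" "g \<in> carrier (cocycle_module S ?N W)" and r: "?r' h g"
    then have carr: "h \<in> cocycles A T (Suc m) W" "g \<in> cocycles A S ?N W" by simp_all
    then have h: "is_cocycle A T (Suc m) W h" by (simp add: cocycles_iff)
    have g_closed: "g x \<in> carrier W" and h_closed: "h (\<psi>0 (Suc m) x) \<in> carrier W" if "x \<in> carrier (obj S ?N)" for x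
      by (rule closed[OF carr(2) that], rule closed[OF carr(1) \<psi>0_closed[OF that]])
    have "is_coboundary A T m W h \<longleftrightarrow> is_coboundary A S (Suc (m + k)) W g"
    proof
      assume "is_coboundary A T m W h"
      from is_coboundary_trans[OF W g_closed h_closed pull_coboundary[OF pull \<psi>0 this] r]
      show "is_coboundary A S (Suc (m + k)) W g" .
    next
      assume g: "is_coboundary A S (Suc (m + k)) W g"
      from is_coboundary_trans[OF W h_closed g_closed g is_coboundary_minus_commute[OF W g_closed h_closed r]]
      have "is_coboundary A S (Suc (m + k)) W (\<lambda>x. h (\<psi>0 (Suc m) x))" .
      from pull_injective[OF pull \<phi>0 \<theta>0_eq \<psi>0 h this] show "is_coboundary A T m W h" .
    qed
    then show "h \<in> coboundaries A T (Suc m) W \<longleftrightarrow> g \<in> coboundaries A S ?N W"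
      using carr by (simp add: coboundaries_iff[OF S] coboundaries_iff[OF T] cocycles_iff)
  next
    fix g assume "g \<in> carrier (cocycle_module S ?N W)"
    then have "is_cocycle A S ?N W g" by (simp add: cocycles_iff)
    from pull_surjective[OF pull \<phi>0 \<theta>0_eq \<psi>0 this]
    obtain h where h: "is_cocycle A T (Suc m) W h" "?r' h g" by blast
    let ?h = "restrict h (carrier (obj T (Suc m)))"
    have "?r' ?h g" by (rule is_coboundary_cong[OF h(2)]) (simp add: \<psi>0_closed)
    then show "\<exists>h\<in>carrier (cocycle_module T (Suc m) W). ?r' h g"
      using restrict_cocycle[OF T h(1)] by (intro bexI[of _ ?h]) simp_all
  qed
  moreover have "yoneda_pull A S T (Suc m) P (Suc k) (\<lambda>x. x) ?Z W =
    (\<lambda>c. THE d. d \<in> carrier (quotient_module (cocycle_module S ?N W) (coboundaries A S ?N W)) \<and>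
      (\<exists>f\<in>c. \<exists>g\<in>d. ?r f g))"
  proof
    fix c :: "('y \<Rightarrow> 'w) set"
    \<comment> \<open>Rewrites membership of the composite in the class as existence of a related
      representative, the form in which the map induced by a relation is stated.\<close>
    have "(\<exists>h\<in>c. \<exists>\<theta> \<psi>. connected_cocycle A S 0 (aug S) P (Suc k) (\<lambda>x. x) ?Z \<theta> \<and>
          chain_lift A S (Suc k) \<theta> T (Suc (Suc m)) \<psi> \<and> (\<lambda>x\<in>carrier (obj S ?N). h (\<psi> (Suc m) x)) \<in> d) \<longleftrightarrow>
        (\<exists>f\<in>c. \<exists>g\<in>d. ?r f g)" for d
      by blast
    then show "yoneda_pull A S T (Suc m) P (Suc k) (\<lambda>x. x) ?Z W c =
      (THE d. d \<in> carrier (quotient_module (cocycle_module S ?N W) (coboundaries A S ?N W)) \<and>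
        (\<exists>f\<in>c. \<exists>g\<in>d. ?r f g))"
      by (simp add: yoneda_pull_def Ext_def)
  qed
  ultimately show ?thesis by (simp add: Ext_def)
qed

section \<open>Rotations above the injective dimension\<close>

theorem lemma4p1:
  fixes K :: "'k ring" and A :: "('k, 'a) module"
    and U :: "('a, 'u) module" and V :: "('a, 'v) module"
    and \<pi> :: "('a, 'p, 'u) aug_complex" and \<tau> :: "('a, 'q, 'v) aug_complex"
    and S :: "('a, 'x, 'u) aug_complex" and T :: "('a, 'y, 'p) aug_complex"
    and n i :: nat
  assumes "fin_dim_algebra K A" and "gorenstein A"
    and "left_module A U" and "finitely_generated A U"
    and "left_module A V" and "finitely_generated A V"
    and "projective_resolution A \<pi> U" and "projective_resolution A \<tau> V"
    and "enat n > injective_dimension A (regular_module A)"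
    and "0 < i" and "i < n"
    and "projective_resolution A S U" and "projective_resolution A T (syzygy \<pi> i)"
  shows "rotation A S T \<pi> \<tau> n i \<in> mod_iso K (Ext A S n V) (Ext A T n (syzygy \<tau> i))"
proof -
  interpret fin_dim_algebra K A by fact
  obtain k where k: "i = Suc k" using \<open>0 < i\<close> gr0_implies_Suc by blast
  \<comment> \<open>The degree is positive, so its coboundaries come from degree \<open>m\<close>
    and the successor forms of the lemmas apply.\<close>
  obtain m where m: "n = Suc m" using \<open>i < n\<close> by (cases n) auto
  \<comment> \<open>An infimum strictly below \<open>n\<close> is undercut by some actual bound;
    this gives an injective resolution that stops at \<open>d \<le> m\<close>.\<close>
  obtain d where d: "injective_dimension_le A (regular_module A) d" "d < n"
    using assms(9) unfolding injective_dimension_def Inf_less_iff by auto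
  \<comment> \<open>The index \<open>p\<close> stands for Ext in degree \<open>p + 1\<close>, so all
    degrees from \<open>n\<close> on are covered, for every term of \<open>\<tau>\<close>.\<close>
  have vanish: "ext_vanishes A S p (obj \<tau> j)" if "m \<le> p" for p j
    by (rule ext_vanishes_projective[OF assms(12) resolution_projective[OF assms(8)] d(1)]) (use d(2) m that in simp)
  have T: "projective_resolution A T (syzygy \<pi> (Suc k))" using assms(13) by (simp add: k)
  let ?W = "syzygy \<tau> (Suc k)"
  have W: "left_module A ?W" by (rule left_module_syzygy[OF assms(8)])
  have "(\<lambda>c. inv_into (carrier (Ext A T (Suc m) ?W))
      (yoneda_pull A S T (Suc m) \<pi> (Suc k) (\<lambda>x. x) (syzygy \<pi> (Suc k)) ?W)
      (yoneda_push A S (Suc m) \<tau> (Suc k) (\<lambda>x. x) ?W c)) \<in> mod_iso K (Ext A S (Suc m) V) (Ext A T (Suc m) ?W)"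
  proof (rule mod_iso_inv_comp)
    show "yoneda_push A S (Suc m) \<tau> (Suc k) (\<lambda>x. x) ?W \<in>
        mod_iso K (Ext A S (Suc m) V) (Ext A S (Suc m + Suc k) ?W)"
      by (rule yoneda_push_iso[OF assms(12,8,5) vanish])
    show "yoneda_pull A S T (Suc m) \<pi> (Suc k) (\<lambda>x. x) (syzygy \<pi> (Suc k)) ?W \<in>
        mod_iso K (Ext A T (Suc m) ?W) (Ext A S (Suc m + Suc k) ?W)"
      by (rule yoneda_pull_iso[OF assms(12,7,3) T W])
    note Z = left_module_cocycle_module[OF T W, of "Suc m"] coboundaries_submodule[OF T W, of m]
    show "x \<oplus>\<^bsub>Ext A T (Suc m) ?W\<^esub> y \<in> carrier (Ext A T (Suc m) ?W)"
      if "x \<in> carrier (Ext A T (Suc m) ?W)" "y \<in> carrier (Ext A T (Suc m) ?W)" for x y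
      using that unfolding Ext_def by (rule quotient_module_add_closed[OF Z])
    show "a \<odot>\<^bsub>Ext A T (Suc m) ?W\<^esub> x \<in> carrier (Ext A T (Suc m) ?W)"
      if "a \<in> carrier K" "x \<in> carrier (Ext A T (Suc m) ?W)" for a x
      using that unfolding Ext_def by (rule quotient_module_smult_closed[OF Z])
  qed
  moreover have "rotation A S T \<pi> \<tau> n i = (\<lambda>c. inv_into (carrier (Ext A T (Suc m) ?W))
      (yoneda_pull A S T (Suc m) \<pi> (Suc k) (\<lambda>x. x) (syzygy \<pi> (Suc k)) ?W)
      (yoneda_push A S (Suc m) \<tau> (Suc k) (\<lambda>x. x) ?W c))"
    by (rule ext) (simp add: rotation_def k m)
  ultimately show ?thesis by (simp add: k m)
qed

end
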